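(* Let $G$ be a finite simple graph with vertex set $V$, let $K$ be a field, let $S=K[V]$, and let $I(G)\subset S$ be the edge ideal of $G$. Let $i,j\ge 0$ be integers. (1) Suppose that $G$ is chordal. Then $\beta_{i,i+j}(S/I(G))\neq 0$ if and only if there exists a subset $W$ of $V$ such that the induced subgraph $G_W$ contains a strongly disjoint set of bouquets of type $(i,j)$. In particular, $\operatorname{pd} S/I(G)=d_G$. (2) If $G$ is a forest, then the graded Betti number $\beta_{i,i+j}(S/I(G))$ is equal to the number of subsets $W$ of $V$ such that the induced subgraph $G_W$ contains a strongly disjoint set of bouquets of type $(i,j)$.
   Context: For a finite simple graph $G$ with vertex set $V=V(G)$ and edge set $E(G)$ and a field $K$, $S=K[V]=K[x:x\in V]$ is the polynomial ring with each variable of degree $1$, and the edge ideal $I(G)\subset S$ is the ideal generated by all products $xy$ with $\{x,y\}\in E(G)$. $\beta_{i,j}(S/I(G))$ denotes the $i$th graded Betti number in degree $j$, i.e. the multiplicity of $S(-j)$ in homological degree $i$ of the minimal graded free resolution of $S/I(G)$ over $S$ (with $S$ in homological degree $0$), and $\operatorname{pd} S/I(G)=\max\{i:\beta_{i,j}(S/I(G))\ne 0\text{ for some }j\}$. For $W\subset V$, $G_W$ is the induced subgraph with vertex set $W$ and edge set $\{e\in E(G): e\subset W\}$. A graph is chordal if each of its cycles of length more than $3$ has a chord; a forest is a graph with no cycle. Distance of edges: for distinct edges $e,e'$ of $G$, $\operatorname{dist}_G(e,e')$ is the minimum $\ell$ such that there is a sequence of edges $e_0=e,e_1,\dots,e_\ell=e'$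 of $G$ with $e_{k-1}\cap e_k\neq\emptyset$ for all $k$ (and $\infty$ if there is no such sequence). A set of edges is pairwise $3$-disjoint in $G$ if any two distinct edges $e,e'$ of it satisfy $\operatorname{dist}_G(e,e')\ge 3$. Bouquets: a bouquet is a graph $B$ with $V(B)=\{w,z_1,\dots,z_d\}$ and $E(B)=\{\{w,z_k\}:k=1,\dots,d\}$, $d\ge 1$, with designated root $w$; the $z_k$ are its flowers and the edges $\{w,z_k\}$ its stems. A bouquet of $G$ is a bouquet that is a (not necessarily induced) subgraph of $G$. For a set $\mathcal B$ of bouquets of $G$, $F(\mathcal B)$ and $R(\mathcal B)$ are the sets of vertices that are a flower, respectively a root, of some bouquet in $\mathcal B$. The type of $\mathcal B$ is $(\#F(\mathcal B),\#R(\mathcal B))$. The empty set of bouquets is allowed and has type $(0,0)$. A set $\mathcal B=\{B_1,\dots,B_j\}$ of bouquets of $G$ is strongly disjoint in $G$ if (1) $V(B_k)\cap V(B_\ell)=\emptyset$ for all $k\ne\ell$, and (2) one can choose a stem $s_k$ from each $B_k$ so that $\{s_1,\dots,s_j\}$ is pairwise $3$-disjoint in $G$. A graph $H$ contains a strongly disjoint set of bouquets of type $(i,j)$ if there is a set $\mathcal B$ of bouquets of $H$, strongly disjoint in $H$ and of type $(i,j)$, with $V(H)=F(\mathcal B)\cup R(\mathcal B)$. Finally, $d_G=\max\{\#F(\mathcal B): \mathcal B\text{ is a strongly disjoint set of bouquets of }G\}$. *)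

theory Defs
  imports "HOL-Library.Poly_Mapping" "HOL-Library.Extended_Nat"
begin

section \<open>Finite simple graphs\<close>

record 'v ugraph =
  verts :: "'v set"
  edges :: "'v set set"

definition finite_simple_graph :: "'v ugraph \<Rightarrow> bool" where
  "finite_simple_graph G \<longleftrightarrow>
     finite (verts G) \<and> (\<forall>e\<in>edges G. e \<subseteq> verts G \<and> card e = 2)"

definition induced_subgraph :: "'v ugraph \<Rightarrow> 'v set \<Rightarrow> 'v ugraph" where
  "induced_subgraph G W = \<lparr>verts = W, edges = {e \<in> edges G. e \<subseteq> W}\<rparr>"

definition cycle_edges :: "'v list \<Rightarrow> 'v set set" where
  "cycle_edges vs = {{vs ! i, vs ! (Suc i mod length vs)} | i. i < length vs}"

text \<open>A cycle is given by the list of its vertices in cyclic order, without repeating the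
  first one at the end, so that its length is the length of the list.\<close>

definition is_cycle :: "'v ugraph \<Rightarrow> 'v list \<Rightarrow> bool" where
  "is_cycle G vs \<longleftrightarrow> length vs \<ge> 3 \<and> distinct vs \<and> cycle_edges vs \<subseteq> edges G"

definition chordal :: "'v ugraph \<Rightarrow> bool" where
  "chordal G \<longleftrightarrow> (\<forall>vs. is_cycle G vs \<and> length vs > 3 \<longrightarrow>
     (\<exists>e\<in>edges G. e \<subseteq> set vs \<and> e \<notin> cycle_edges vs))"

definition forest :: "'v ugraph \<Rightarrow> bool" where
  "forest G \<longleftrightarrow> \<not> (\<exists>vs. is_cycle G vs)"

text \<open>The infimum of the empty set is \<open>\<infinity>\<close> in \<^typ>\<open>enat\<close>.\<close>

definition edge_dist :: "'v ugraph \<Rightarrow> 'v set \<Rightarrow> 'v set \<Rightarrow> enat" where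
  "edge_dist G e e' = Inf {enat l | l. \<exists>s :: nat \<Rightarrow> 'v set.
     s 0 = e \<and> s l = e' \<and> (\<forall>k\<le>l. s k \<in> edges G) \<and> (\<forall>k<l. s k \<inter> s (Suc k) \<noteq> {})}"

definition pairwise_3_disjoint :: "'v ugraph \<Rightarrow> 'v set set \<Rightarrow> bool" where
  "pairwise_3_disjoint G A \<longleftrightarrow>
     A \<subseteq> edges G \<and> (\<forall>e\<in>A. \<forall>e'\<in>A. e \<noteq> e' \<longrightarrow> edge_dist G e e' \<ge> 3)"


section \<open>Bouquets\<close>

record 'v bouquet =
  broot :: 'v
  flowers :: "'v set"

definition bouquet_verts :: "'v bouquet \<Rightarrow> 'v set" where
  "bouquet_verts B = insert (broot B) (flowers B)"

definition stems :: "'v bouquet \<Rightarrow> 'v set set" where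
  "stems B = {{broot B, z} | z. z \<in> flowers B}"

definition is_bouquet :: "'v bouquet \<Rightarrow> bool" where
  "is_bouquet B \<longleftrightarrow> finite (flowers B) \<and> flowers B \<noteq> {} \<and> broot B \<notin> flowers B"

definition bouquet_of :: "'v ugraph \<Rightarrow> 'v bouquet \<Rightarrow> bool" where
  "bouquet_of G B \<longleftrightarrow> is_bouquet B \<and> bouquet_verts B \<subseteq> verts G \<and> stems B \<subseteq> edges G"

definition flower_set :: "'v bouquet set \<Rightarrow> 'v set" where
  "flower_set \<B> = (\<Union>B\<in>\<B>. flowers B)"

definition root_set :: "'v bouquet set \<Rightarrow> 'v set" where
  "root_set \<B> = broot ` \<B>"

definition bouquets_type :: "'v bouquet set \<Rightarrow> nat \<times> nat" where
  "bouquets_type \<B> = (card (flower_set \<B>), card (root_set \<B>))"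

definition strongly_disjoint :: "'v ugraph \<Rightarrow> 'v bouquet set \<Rightarrow> bool" where
  "strongly_disjoint G \<B> \<longleftrightarrow>
     finite \<B> \<and> (\<forall>B\<in>\<B>. bouquet_of G B) \<and>
     (\<forall>B\<in>\<B>. \<forall>B'\<in>\<B>. B \<noteq> B' \<longrightarrow> bouquet_verts B \<inter> bouquet_verts B' = {}) \<and>
     (\<exists>s. (\<forall>B\<in>\<B>. s B \<in> stems B) \<and> pairwise_3_disjoint G (s ` \<B>))"

definition contains_strongly_disjoint :: "'v ugraph \<Rightarrow> nat \<times> nat \<Rightarrow> bool" where
  "contains_strongly_disjoint H t \<longleftrightarrow>
     (\<exists>\<B>. strongly_disjoint H \<B> \<and> bouquets_type \<B> = t \<and>
          verts H = flower_set \<B> \<union> root_set \<B>)"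

definition max_flowers :: "'v ugraph \<Rightarrow> nat"  \<comment> \<open>the invariant \<open>d\<^sub>G\<close>\<close> where
  "max_flowers G = Max {card (flower_set \<B>) | \<B>. strongly_disjoint G \<B>}"


section \<open>The standard graded polynomial ring \<open>K[V]\<close>\<close>

text \<open>A monomial is its finitely supported exponent vector. The field \<open>K\<close> is the type
  \<open>'k\<close>; the variables are restricted to \<open>V\<close> by a carrier set, since \<open>V\<close> need
  not exhaust the type \<open>'v\<close>.\<close>

type_synonym ('v, 'k) mpoly = "('v \<Rightarrow>\<^sub>0 nat) \<Rightarrow>\<^sub>0 'k"

definition poly_ring :: "'v set \<Rightarrow> ('v, 'k::zero) mpoly set" where
  "poly_ring V = {p. \<forall>m\<in>Poly_Mapping.keys p. Poly_Mapping.keys m \<subseteq> V}"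

definition var :: "'v \<Rightarrow> ('v, 'k::zero_neq_one) mpoly" where
  "var x = Poly_Mapping.single (Poly_Mapping.single x 1) 1"

definition mono_deg :: "('v \<Rightarrow>\<^sub>0 nat) \<Rightarrow> nat" where
  "mono_deg m = (\<Sum>x\<in>Poly_Mapping.keys m. Poly_Mapping.lookup m x)"

text \<open>Zero is homogeneous of every degree, and it is the only homogeneous polynomial of a
  negative degree.\<close>

definition homogeneous :: "int \<Rightarrow> ('v, 'k::zero) mpoly \<Rightarrow> bool" where
  "homogeneous d p \<longleftrightarrow> (\<forall>m\<in>Poly_Mapping.keys p. int (mono_deg m) = d)"

text \<open>The graded maximal ideal: the polynomials without constant term.\<close>

definition max_ideal :: "'v set \<Rightarrow> ('v, 'k::zero) mpoly set" where
  "max_ideal V = {p \<in> poly_ring V. Poly_Mapping.lookup p 0 = 0}"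

definition ideal_generated :: "'v set \<Rightarrow> ('v, 'k::field) mpoly set \<Rightarrow> ('v, 'k) mpoly set" where
  "ideal_generated V X =
     {\<Sum>g\<in>A. c g * g | A c. finite A \<and> A \<subseteq> X \<and> c ` A \<subseteq> poly_ring V}"

definition edge_ideal :: "'v ugraph \<Rightarrow> ('v, 'k::field) mpoly set" where
  "edge_ideal G = ideal_generated (verts G) {var x * var y | x y. {x, y} \<in> edges G}"


section \<open>Minimal graded free resolutions and graded Betti numbers\<close>

text \<open>The graded free module \<open>F\<^sub>i = \<Oplus>\<^sub>k S(- shift i k)\<close>, \<open>k < rk i\<close>, of a
  resolution of \<open>S/I\<close> is the set of vectors of length \<open>rk i\<close> over \<open>S = K[V]\<close>.
  The map \<open>F\<^bsub>i+1\<^esub> \<rightarrow> F\<^sub>i\<close> is multiplication by the matrix \<open>dmat i\<close> (row index first),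
  and \<open>F\<^sub>0 \<rightarrow> S/I\<close> sends the \<open>k\<close>-th basis vector to the class of \<open>aug k\<close>.\<close>

record (overloaded) ('v, 'k) resolution =
  rk :: "nat \<Rightarrow> nat"
  shift :: "nat \<Rightarrow> nat \<Rightarrow> int"
  aug :: "nat \<Rightarrow> ('v, 'k) mpoly"
  dmat :: "nat \<Rightarrow> nat \<Rightarrow> nat \<Rightarrow> ('v, 'k) mpoly"

definition free_module :: "'v set \<Rightarrow> nat \<Rightarrow> (nat \<Rightarrow> ('v, 'k::zero) mpoly) set" where
  "free_module V n = {v. (\<forall>k<n. v k \<in> poly_ring V) \<and> (\<forall>k\<ge>n. v k = 0)}"

definition aug_map ::
    "('v, 'k::field) resolution \<Rightarrow> (nat \<Rightarrow> ('v, 'k) mpoly) \<Rightarrow> ('v, 'k) mpoly" where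
  "aug_map F v = (\<Sum>k<rk F 0. aug F k * v k)"

definition diff_map ::
    "('v, 'k::field) resolution \<Rightarrow> nat \<Rightarrow> (nat \<Rightarrow> ('v, 'k) mpoly) \<Rightarrow> nat \<Rightarrow> ('v, 'k) mpoly" where
  "diff_map F i v = (\<lambda>a. if a < rk F i then \<Sum>b<rk F (Suc i). dmat F i a b * v b else 0)"

text \<open>The clauses say: the maps are defined over \<open>K[V]\<close> and homogeneous of degree 0,
  \<open>F\<^sub>0 \<rightarrow> S/I\<close> is onto, and the complex is exact at \<open>F\<^sub>0\<close> and at every \<open>F\<^bsub>i+1\<^esub>\<close>.
  A graded map to \<open>S/I\<close> is represented by homogeneous polynomials \<open>aug k\<close> because \<open>I\<close>
  is meant to be a homogeneous ideal.\<close>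

definition graded_free_resolution ::
    "'v set \<Rightarrow> ('v, 'k::field) mpoly set \<Rightarrow> ('v, 'k) resolution \<Rightarrow> bool" where
  "graded_free_resolution V I F \<longleftrightarrow>
     (\<forall>k<rk F 0. aug F k \<in> poly_ring V \<and> homogeneous (shift F 0 k) (aug F k)) \<and>
     (\<forall>i. \<forall>a<rk F i. \<forall>b<rk F (Suc i).
        dmat F i a b \<in> poly_ring V \<and>
        homogeneous (shift F (Suc i) b - shift F i a) (dmat F i a b)) \<and>
     (\<forall>p\<in>poly_ring V. \<exists>v\<in>free_module V (rk F 0). p - aug_map F v \<in> I) \<and>
     {v \<in> free_module V (rk F 0). aug_map F v \<in> I} =
       diff_map F 0 ` free_module V (rk F 1) \<and>
     (\<forall>i. {v \<in> free_module V (rk F (Suc i)). diff_map F i v = (\<lambda>_. 0)} =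
       diff_map F (Suc i) ` free_module V (rk F (Suc (Suc i))))"

text \<open>Minimality: the image of \<open>F\<^bsub>i+1\<^esub>\<close> lies in the graded maximal ideal times \<open>F\<^sub>i\<close>.\<close>

definition minimal_graded_free_resolution ::
    "'v set \<Rightarrow> ('v, 'k::field) mpoly set \<Rightarrow> ('v, 'k) resolution \<Rightarrow> bool" where
  "minimal_graded_free_resolution V I F \<longleftrightarrow>
     graded_free_resolution V I F \<and>
     (\<forall>i. \<forall>a<rk F i. \<forall>b<rk F (Suc i). dmat F i a b \<in> max_ideal V)"

text \<open>\<open>betti V I i j\<close> is the graded Betti number of \<open>K[V]/I\<close> in homological degree \<open>i\<close>
  and internal degree \<open>j\<close>. For finite \<open>V\<close> and a homogeneous ideal \<open>I\<close> the minimal graded free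
  resolution exists and is unique up to isomorphism of graded complexes, so the choice of the
  representative is immaterial.\<close>

definition betti :: "'v set \<Rightarrow> ('v, 'k::field) mpoly set \<Rightarrow> nat \<Rightarrow> int \<Rightarrow> nat" where
  "betti V I i j =
     (let F = (SOME F. minimal_graded_free_resolution V I F)
      in card {k. k < rk F i \<and> shift F i k = j})"

definition proj_dim :: "'v set \<Rightarrow> ('v, 'k::field) mpoly set \<Rightarrow> nat" where
  "proj_dim V I = Max {i. \<exists>j. betti V I i j \<noteq> 0}"

end

(* Let v be a simplicial vertex of an induced subgraph on W, with neighbours u_1, ..., u_d. The edge
   ideal of W arises from that of W - v by adding the generators v u_1, ..., v u_d one at a time, and
   since the u_k form a clique the colon ideal at the k-th step is L_k = (I(W - v) : u_k), that is, the
   variables in N(u_k) - v together with the edge ideal of W - N[u_k]. As u_k L_k lies in I(W - v), the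
   multiplication by v u_k lifts to v times a chain map, so every mapping cone is minimal. Adjoining
   the variables of N(u_k) - v is again such a cone. This makes the graded Betti numbers
   satisfy the recursion
     b(W)_{i,i+j} = b(W - v)_{i,i+j} + sum over u in N(v) and T in N(u) - v of
       b(W - N[u])_{i-1-|T|, (i-1-|T|)+(j-1)}.
   Sets of bouquets obey the same recursion: the bouquet through v can be given a root u in N(v) and
   the flower v, and can absorb all flowers in N(u). In a forest v has at most one neighbour, so no
   subset W is counted twice. Simplicial vertices exist by Dirac's theorem. *)

theory Submission
  imports Defs Complex_Main "HOL-Library.Function_Algebras"
begin

section \<open>Polynomials, homogeneous components and monomial ideals\<close>

text \<open>\<open>betti\<close> reads its numbers off a resolution picked by \<open>SOME\<close>,
  so a recursion for ranks says something about Betti numbers only after existence and uniqueness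
  are settled. Existence comes from the construction: the iterated cones are themselves the
  resolutions. Uniqueness comes from reducing comparison maps modulo the maximal ideal, that is,
  from their constant terms. A resolution picked by \<open>SOME\<close> may start with any free
  module and any augmentation; properness of the ideal and minimality together force it to start
  with \<open>S\<close>.

  Because nothing cancels in the cones, ranks add over every field, and a sum of natural numbers
  vanishes only if each summand does. In a chordal graph one vertex set can arise from several
  neighbours \<open>u\<close>, so there the recursion yields nonvanishing but no count.

  All ideals live in the one ring \<open>K[V]\<close>, also those of induced subgraphs, which avoids
  changes of rings. They are given by predicates on supports of monomials, so that sums and colons
  become conditions on sets. The bound \<open>int i \<le> d\<close> is carried through the induction
  so that every nonzero entry sits in a degree of the form \<open>i + j\<close>.\<close>

abbreviation exps :: "('a \<Rightarrow>\<^sub>0 'b::zero) \<Rightarrow> 'a set" where "exps \<equiv> Poly_Mapping.keys"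
abbreviation coef :: "('a \<Rightarrow>\<^sub>0 'b::zero) \<Rightarrow> 'a \<Rightarrow> 'b" where "coef \<equiv> Poly_Mapping.lookup"

section \<open>Exponent vectors, degrees and supports\<close>

lemma keys_add_nat: "exps (m + n) = exps m \<union> exps (n :: 'v \<Rightarrow>\<^sub>0 nat)"
  by (auto simp: in_keys_iff lookup_add)

lemma mono_deg_superset:
  assumes "finite A" "exps m \<subseteq> A"
  shows "mono_deg m = (\<Sum>x\<in>A. coef m x)"
  unfolding mono_deg_def using assms by (intro sum.mono_neutral_left) (auto simp: in_keys_iff)

lemma mono_deg_add: "mono_deg (m + n) = mono_deg m + mono_deg n"
proof -
  let ?A = "exps m \<union> exps n"
  have "mono_deg (m + n) = (\<Sum>x\<in>?A. coef (m + n) x)" "mono_deg m = (\<Sum>x\<in>?A. coef m x)"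
    "mono_deg n = (\<Sum>x\<in>?A. coef n x)"
    by (rule mono_deg_superset; simp add: keys_add_nat)+
  then show ?thesis by (simp add: lookup_add sum.distrib)
qed

lemma mono_deg_zero [simp]: "mono_deg 0 = 0"
  by (simp add: mono_deg_def)

lemma poly_eq_sum_single: "p = (\<Sum>m\<in>exps p. Poly_Mapping.single m (coef p m))"
proof (rule poly_mapping_eqI)
  fix k
  show "coef p k = coef (\<Sum>m\<in>exps p. Poly_Mapping.single m (coef p m)) k"
    by (simp add: lookup_sum lookup_single when_def in_keys_iff sum.delta')
qed

lemma keys_multE:
  assumes "m \<in> exps (p * q)"
  obtains a b where "a \<in> exps p" "b \<in> exps q" "m = a + b"
  using assms keys_mult[of p q] by blast

lemma keys_sumE:
  assumes "m \<in> exps (sum f A)"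
  obtains a where "a \<in> A" "m \<in> exps (f a)"
proof -
  have "\<exists>a\<in>A. coef (f a) m \<noteq> 0"
    using assms by (auto simp: in_keys_iff lookup_sum intro: sum.neutral)
  then show ?thesis using that by (auto simp: in_keys_iff)
qed

lemma keys_diff': "exps (p - q) \<subseteq> exps p \<union> exps (q :: 'a \<Rightarrow>\<^sub>0 'b::ab_group_add)"
  by (auto simp: in_keys_iff lookup_minus)

lemma keys_uminus': "exps (- q) = exps (q :: 'a \<Rightarrow>\<^sub>0 'b::ab_group_add)"
  by (auto simp: in_keys_iff)

lemma lookup_single_mult:
  fixes p :: "('v \<Rightarrow>\<^sub>0 nat) \<Rightarrow>\<^sub>0 'k::comm_ring_1"
  shows "coef (Poly_Mapping.single a c * p) (a + m) = c * coef p m"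
proof -
  have "Poly_Mapping.single a c * p = Poly_Mapping.single a c * (\<Sum>m\<in>exps p. Poly_Mapping.single m (coef p m))"
    by (simp flip: poly_eq_sum_single)
  also have "\<dots> = (\<Sum>m\<in>exps p. Poly_Mapping.single (a + m) (c * coef p m))"
    by (simp add: sum_distrib_left mult_single)
  finally show ?thesis
    by (simp add: lookup_sum lookup_single when_def in_keys_iff sum.delta')
qed

lemma keys_single_mult:
  fixes p :: "('v \<Rightarrow>\<^sub>0 nat) \<Rightarrow>\<^sub>0 'k::field"
  assumes "c \<noteq> 0"
  shows "exps (Poly_Mapping.single a c * p) = (+) a ` exps p"
proof
  show "exps (Poly_Mapping.single a c * p) \<subseteq> (+) a ` exps p"
    using assms by (auto elim!: keys_multE)
  show "(+) a ` exps p \<subseteq> exps (Poly_Mapping.single a c * p)"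
    using assms by (auto simp: in_keys_iff lookup_single_mult)
qed

lemma add_eq_zero_mono: "a + b = 0 \<Longrightarrow> a = 0" for a b :: "'v \<Rightarrow>\<^sub>0 nat"
  by (metis Un_empty keys_add_nat keys_eq_empty keys_zero poly_mapping_eqI in_keys_iff empty_iff lookup_zero)

text \<open>Natural exponents add up to \<open>0\<close> only if both are \<open>0\<close>, so the
  constant term is multiplicative. It serves throughout as reduction modulo the graded maximal
  ideal.\<close>

lemma lookup_mult_zero:
  fixes p q :: "('v \<Rightarrow>\<^sub>0 nat) \<Rightarrow>\<^sub>0 'k::comm_ring_1"
  shows "coef (p * q) 0 = coef p 0 * coef q 0"
proof -
  let ?c = "\<lambda>p. Poly_Mapping.single 0 (coef p 0) :: ('v \<Rightarrow>\<^sub>0 nat) \<Rightarrow>\<^sub>0 'k"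
  have "p * q = ?c p * q + (p - ?c p) * q"
    by (simp add: algebra_simps)
  moreover have "coef ((p - ?c p) * q) 0 = 0"
  proof (rule ccontr)
    assume "coef ((p - ?c p) * q) 0 \<noteq> 0"
    then have "0 \<in> exps ((p - ?c p) * q)" by (simp add: in_keys_iff)
    then obtain a b where "a \<in> exps (p - ?c p)" "a + b = 0" by (auto elim!: keys_multE)
    then show False using add_eq_zero_mono by (fastforce simp: in_keys_iff lookup_minus)
  qed
  ultimately show ?thesis
    using lookup_single_mult[of 0 "coef p 0" q 0] by (simp add: lookup_add)
qed

section \<open>The carrier \<open>K[V]\<close> and homogeneous polynomials\<close>

lemma poly_ring_zero [simp]: "0 \<in> poly_ring V"
  and poly_ring_one [simp]: "1 \<in> poly_ring V"
  by (simp_all add: poly_ring_def)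

lemma poly_ring_add: "p \<in> poly_ring V \<Longrightarrow> q \<in> poly_ring V \<Longrightarrow> p + q \<in> poly_ring V"
  using keys_add[of p q] by (auto simp: poly_ring_def)

lemma poly_ring_uminus: "p \<in> poly_ring V \<Longrightarrow> - p \<in> poly_ring V" for p :: "('v,'k::field) mpoly"
  by (auto simp: poly_ring_def keys_uminus')

lemma poly_ring_diff: "p \<in> poly_ring V \<Longrightarrow> q \<in> poly_ring V \<Longrightarrow> p - q \<in> poly_ring V"
  for p :: "('v,'k::field) mpoly"
  using keys_diff'[of p q] by (auto simp: poly_ring_def)

lemma poly_ring_mult: "p \<in> poly_ring V \<Longrightarrow> q \<in> poly_ring V \<Longrightarrow> p * q \<in> poly_ring V"
  for p :: "('v,'k::field) mpoly"
  unfolding poly_ring_def by (fastforce elim!: keys_multE simp: keys_add_nat)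

lemma poly_ring_sum: "(\<And>a. a \<in> A \<Longrightarrow> f a \<in> poly_ring V) \<Longrightarrow> sum f A \<in> poly_ring V"
  unfolding poly_ring_def by (fastforce elim!: keys_sumE)

lemma poly_ring_single: "exps m \<subseteq> V \<Longrightarrow> Poly_Mapping.single m c \<in> poly_ring V"
  by (auto simp: poly_ring_def)

lemma homogeneous_zero [simp]: "homogeneous d 0"
  and homogeneous_one: "homogeneous 0 1"
  by (simp_all add: homogeneous_def)

lemma homogeneous_uminus: "homogeneous d p \<Longrightarrow> homogeneous d (- p)" for p :: "('v,'k::field) mpoly"
  by (auto simp: homogeneous_def keys_uminus')

lemma homogeneous_mult: "homogeneous d p \<Longrightarrow> homogeneous e q \<Longrightarrow> homogeneous (d + e) (p * q)"
  for p :: "('v,'k::field) mpoly"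
  unfolding homogeneous_def by (auto elim!: keys_multE simp: mono_deg_add)

lemma homogeneous_sum: "(\<And>a. a \<in> A \<Longrightarrow> homogeneous d (f a)) \<Longrightarrow> homogeneous d (sum f A)"
  unfolding homogeneous_def by (fastforce elim!: keys_sumE)

text \<open>The only monomial of degree 0 is the constant one. For matrices this means that a unit
  entry can join only basis elements of equal shift.\<close>

lemma homogeneous_const:
  assumes "homogeneous d p" "coef p 0 \<noteq> 0"
  shows "d = 0" "p = Poly_Mapping.single 0 (coef p 0)"
proof -
  show d: "d = 0" using assms by (force simp: homogeneous_def in_keys_iff)
  have "coef p m = 0" if "m \<noteq> 0" for m
  proof (rule ccontr)
    assume "coef p m \<noteq> 0"
    then have "mono_deg m = 0" using assms(1) d by (force simp: homogeneous_def in_keys_iff)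
    then have "m = 0" by (simp add: mono_deg_def) (metis in_keys_iff poly_mapping_eqI lookup_zero)
    with that show False ..
  qed
  then show "p = Poly_Mapping.single 0 (coef p 0)"
    by (intro poly_mapping_eqI) (simp add: lookup_single when_def)
qed

definition hom_part :: "int \<Rightarrow> ('v, 'k::field) mpoly \<Rightarrow> ('v, 'k) mpoly" where
  "hom_part d p = (\<Sum>m\<in>{m \<in> exps p. int (mono_deg m) = d}. Poly_Mapping.single m (coef p m))"

lemma lookup_hom_part: "coef (hom_part d p) m = (if int (mono_deg m) = d then coef p m else 0)"
  by (simp add: hom_part_def lookup_sum lookup_single when_def in_keys_iff sum.delta')

lemma homogeneous_hom_part: "homogeneous d (hom_part d p)"
  by (auto simp: homogeneous_def in_keys_iff lookup_hom_part split: if_splits)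

lemma hom_part_poly_ring: "p \<in> poly_ring V \<Longrightarrow> hom_part d p \<in> poly_ring V"
  unfolding poly_ring_def by (auto simp: in_keys_iff[of _ p] in_keys_iff[of _ "hom_part d p"]
    lookup_hom_part split: if_splits)

lemma hom_part_add: "hom_part d (p + q) = hom_part d p + hom_part d q"
  by (rule poly_mapping_eqI) (simp add: lookup_hom_part lookup_add)

lemma hom_part_sum: "hom_part d (sum f A) = (\<Sum>a\<in>A. hom_part d (f a))"
  by (rule poly_mapping_eqI) (simp add: lookup_hom_part lookup_sum)

lemma hom_part_homogeneous: "homogeneous d p \<Longrightarrow> hom_part d p = p"
  by (rule poly_mapping_eqI) (auto simp: lookup_hom_part homogeneous_def in_keys_iff)

text \<open>Every monomial of \<open>h\<close> has degree \<open>e\<close>, so only the part of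
  \<open>p\<close> in degree \<open>d - e\<close> can reach degree \<open>d\<close>.\<close>

lemma hom_part_mult:
  assumes "homogeneous e h"
  shows "hom_part d (h * p) = h * hom_part (d - e) p"
proof -
  let ?q = "hom_part (d - e) p"
  have "hom_part d (h * p) = hom_part d (h * ?q) + hom_part d (h * (p - ?q))"
    by (simp flip: hom_part_add add: algebra_simps)
  also have "hom_part d (h * (p - ?q)) = 0"
  proof (rule ccontr)
    assume "hom_part d (h * (p - ?q)) \<noteq> 0"
    then obtain m where "coef (hom_part d (h * (p - ?q))) m \<noteq> 0"
      by (metis lookup_zero poly_mapping_eqI)
    then have m: "m \<in> exps (h * (p - ?q))" "int (mono_deg m) = d"
      by (auto simp: lookup_hom_part in_keys_iff split: if_splits)
    from m(1) obtain a b where ab: "a \<in> exps h" "b \<in> exps (p - ?q)" "m = a + b"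
      by (rule keys_multE)
    then have "int (mono_deg b) = d - e" using m assms
      by (auto simp: homogeneous_def mono_deg_add)
    then show False using ab(2) by (simp add: in_keys_iff lookup_minus lookup_hom_part)
  qed
  also have "hom_part d (h * ?q) = h * ?q"
    using homogeneous_mult[OF assms homogeneous_hom_part[of "d - e" p]]
    by (simp add: hom_part_homogeneous)
  finally show ?thesis by simp
qed

text \<open>For monotone \<open>P\<close> these are the squarefree monomial ideals: membership of a
  monomial is decided by its support. Adding a generator is then a disjunction of predicates, and a
  colon by a monomial is a substitution in \<open>P\<close>.\<close>

definition monomial_ideal :: "'v set \<Rightarrow> ('v set \<Rightarrow> bool) \<Rightarrow> ('v, 'k::zero) mpoly set" where
  "monomial_ideal V P = {p \<in> poly_ring V. \<forall>m\<in>exps p. P (exps m)}"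

lemma monomial_ideal_add:
  "p \<in> monomial_ideal V P \<Longrightarrow> q \<in> monomial_ideal V P \<Longrightarrow> p + q \<in> monomial_ideal V P"
  using keys_add[of p q] by (auto simp: monomial_ideal_def poly_ring_add)

lemma monomial_ideal_sum:
  "(\<And>a. a \<in> A \<Longrightarrow> f a \<in> monomial_ideal V P) \<Longrightarrow> sum f A \<in> monomial_ideal V P"
  unfolding monomial_ideal_def
  by (intro CollectI conjI ballI poly_ring_sum) (auto elim!: keys_sumE)

lemma monomial_ideal_mult:
  fixes p :: "('v, 'k::field) mpoly"
  assumes "mono P" "p \<in> poly_ring V" "q \<in> monomial_ideal V P"
  shows "p * q \<in> monomial_ideal V P"
  unfolding monomial_ideal_def
proof (intro CollectI conjI ballI)
  show "p * q \<in> poly_ring V" using assms by (simp add: monomial_ideal_def poly_ring_mult)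
  fix m assume "m \<in> exps (p * q)"
  then obtain a b where "b \<in> exps q" "m = a + b" by (auto elim: keys_multE)
  moreover have "P (exps b)" using assms(3) calculation(1) by (auto simp: monomial_ideal_def)
  ultimately show "P (exps m)" using monoD[OF assms(1), of "exps b" "exps m"] by (auto simp: keys_add_nat)
qed

text \<open>Multiplication by a monomial translates exponents injectively, so no terms cancel and
  each support merely gains \<open>exps a\<close>. This computes colons by monomials.\<close>

lemma single_mult_in_monomial_ideal_iff:
  fixes p :: "('v, 'k::field) mpoly"
  assumes "p \<in> poly_ring V" "exps a \<subseteq> V"
  shows "Poly_Mapping.single a 1 * p \<in> monomial_ideal V P \<longleftrightarrow> p \<in> monomial_ideal V (\<lambda>X. P (X \<union> exps a))"
  using assms poly_ring_mult[OF poly_ring_single[OF assms(2), of "1::'k"] assms(1)]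
  by (auto simp: monomial_ideal_def keys_single_mult keys_add_nat Un_commute)

definition set_monom :: "'v set \<Rightarrow> 'v \<Rightarrow>\<^sub>0 nat" where
  "set_monom A = (\<Sum>x\<in>A. Poly_Mapping.single x 1)"

lemma lookup_set_monom: "finite A \<Longrightarrow> coef (set_monom A) x = (if x \<in> A then 1 else 0)"
  by (simp add: set_monom_def lookup_sum lookup_single when_def)

lemma keys_set_monom: "finite A \<Longrightarrow> exps (set_monom A) = A"
  by (auto simp: in_keys_iff lookup_set_monom split: if_splits)

lemma mono_deg_set_monom: "finite A \<Longrightarrow> mono_deg (set_monom A) = card A"
  by (simp add: mono_deg_def keys_set_monom lookup_set_monom)

lemma set_monom_insert: "finite A \<Longrightarrow> x \<notin> A \<Longrightarrow>
  set_monom (insert x A) = Poly_Mapping.single x 1 + set_monom A"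
  by (simp add: set_monom_def)

lemma set_monom_decompose:
  assumes "finite A" "A \<subseteq> exps m"
  obtains n where "m = set_monom A + n"
proof
  show "m = set_monom A + (m - set_monom A)"
    using assms by (intro poly_mapping_eqI)
      (auto simp: lookup_add lookup_minus lookup_set_monom in_keys_iff subset_iff)
qed

text \<open>Decided monomial by monomial: a monomial violating \<open>P\<close> is divisible by the
  squarefree monomial of \<open>A\<close>, and its quotient goes into \<open>q\<close>. The
  right-hand side is the form in which the mapping cone sees the ideal enlarged by one
  generator.\<close>

lemma monomial_ideal_disj:
  fixes p :: "('v, 'k::field) mpoly"
  assumes "mono P" "A \<subseteq> V" "finite A"
  shows "p \<in> monomial_ideal V (\<lambda>X. P X \<or> A \<subseteq> X) \<longleftrightarrow>
    (\<exists>q\<in>poly_ring V. p - Poly_Mapping.single (set_monom A) 1 * q \<in> monomial_ideal V P)"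
    (is "?L \<longleftrightarrow> ?R")
proof
  assume L: ?L
  have *: "\<exists>q\<in>poly_ring V. Poly_Mapping.single m c - Poly_Mapping.single (set_monom A) 1 * q \<in> monomial_ideal V P"
    if "exps m \<subseteq> V" "P (exps m) \<or> A \<subseteq> exps m" for m and c :: 'k
  proof (cases "P (exps m)")
    case True
    then show ?thesis using that
      by (intro bexI[of _ 0]) (auto simp: monomial_ideal_def poly_ring_single)
  next
    case False
    with that obtain n where n: "m = set_monom A + n" using set_monom_decompose assms(3) by metis
    then show ?thesis using that(1)
      by (intro bexI[of _ "Poly_Mapping.single n c"])
        (auto simp: mult_single monomial_ideal_def keys_add_nat intro: poly_ring_single)
  qed
  have "\<exists>q. \<forall>m\<in>exps p. q m \<in> poly_ring V \<and> Poly_Mapping.single m (coef p m) -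
     Poly_Mapping.single (set_monom A) 1 * q m \<in> monomial_ideal V P"
    using * L by (intro bchoice) (auto simp: monomial_ideal_def poly_ring_def)
  then obtain q where q: "\<And>m. m \<in> exps p \<Longrightarrow> q m \<in> poly_ring V" "\<And>m. m \<in> exps p \<Longrightarrow>
    Poly_Mapping.single m (coef p m) - Poly_Mapping.single (set_monom A) 1 * q m \<in> monomial_ideal V P"
    by blast
  have "p - Poly_Mapping.single (set_monom A) 1 * (\<Sum>m\<in>exps p. q m) =
     (\<Sum>m\<in>exps p. Poly_Mapping.single m (coef p m) - Poly_Mapping.single (set_monom A) 1 * q m)"
    by (simp add: sum_subtractf sum_distrib_left flip: poly_eq_sum_single)
  then show ?R using q by (metis (no_types, lifting) poly_ring_sum monomial_ideal_sum)
next
  assume ?R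
  then obtain q where q: "q \<in> poly_ring V" "p - Poly_Mapping.single (set_monom A) 1 * q \<in> monomial_ideal V P"
    by blast
  let ?a = "Poly_Mapping.single (set_monom A) 1 :: ('v,'k) mpoly"
  have "?a * q \<in> monomial_ideal V (\<lambda>X. P X \<or> A \<subseteq> X)"
    using q(1) assms poly_ring_mult[OF poly_ring_single[of "set_monom A" V 1] q(1)]
    by (auto simp: monomial_ideal_def keys_single_mult keys_add_nat keys_set_monom)
  moreover have "p - ?a * q \<in> monomial_ideal V (\<lambda>X. P X \<or> A \<subseteq> X)"
    using q(2) by (auto simp: monomial_ideal_def)
  ultimately show ?L using monomial_ideal_add by fastforce
qed

section \<open>Minimal resolutions and comparison maps\<close>

text \<open>Matrices are total functions whose entries beyond the bounds are arbitrary. Cutting off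
  at \<open>n\<close> makes the result a vector in the sense of \<open>free_module\<close>, so that
  vectors can be compared as functions.\<close>

definition mat_vec :: "nat \<Rightarrow> nat \<Rightarrow> (nat \<Rightarrow> nat \<Rightarrow> 'a::comm_ring_1) \<Rightarrow> (nat \<Rightarrow> 'a) \<Rightarrow> nat \<Rightarrow> 'a" where
  "mat_vec n m A v = (\<lambda>a. if a < n then \<Sum>b<m. A a b * v b else 0)"

definition mat_mult :: "nat \<Rightarrow> (nat \<Rightarrow> nat \<Rightarrow> 'a::comm_ring_1) \<Rightarrow> (nat \<Rightarrow> nat \<Rightarrow> 'a) \<Rightarrow> nat \<Rightarrow> nat \<Rightarrow> 'a" where
  "mat_mult m A B = (\<lambda>a c. \<Sum>b<m. A a b * B b c)"

definition unit_vec :: "nat \<Rightarrow> nat \<Rightarrow> 'a::comm_ring_1" where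
  "unit_vec c = (\<lambda>k. if k = c then 1 else 0)"

lemma mat_vec_comp: "mat_vec n m A (mat_vec m k B v) = mat_vec n k (mat_mult m A B) v"
proof -
  have "(\<Sum>b<m. A a b * (\<Sum>c<k. B b c * v c)) = (\<Sum>c<k. (\<Sum>b<m. A a b * B b c) * v c)" for a
  proof -
    have "(\<Sum>b<m. A a b * (\<Sum>c<k. B b c * v c)) = (\<Sum>b<m. \<Sum>c<k. A a b * B b c * v c)"
      by (simp add: sum_distrib_left mult.assoc)
    also have "\<dots> = (\<Sum>c<k. \<Sum>b<m. A a b * B b c * v c)" by (rule sum.swap)
    finally show ?thesis by (simp add: sum_distrib_right)
  qed
  then show ?thesis by (simp add: mat_vec_def mat_mult_def fun_eq_iff)
qed

lemma mat_vec_cong: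
  "(\<And>a b. a < n \<Longrightarrow> b < m \<Longrightarrow> A a b = B a b) \<Longrightarrow> mat_vec n m A v = mat_vec n m B v"
  by (auto simp: mat_vec_def fun_eq_iff)

lemma mat_vec_unit: "c < m \<Longrightarrow> mat_vec n m A (unit_vec c) = (\<lambda>a. if a < n then A a c else 0)"
  by (auto simp: mat_vec_def unit_vec_def fun_eq_iff if_distrib sum.delta cong: if_cong)

lemma mat_vec_add: "mat_vec n m A (\<lambda>k. v k + w k) = (\<lambda>k. mat_vec n m A v k + mat_vec n m A w k)"
  by (auto simp: mat_vec_def fun_eq_iff distrib_left sum.distrib)

lemma mat_vec_uminus: "mat_vec n m A (\<lambda>k. - v k) = (\<lambda>k. - mat_vec n m A v k)"
  by (auto simp: mat_vec_def fun_eq_iff sum_negf)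

lemma mat_vec_scale: "mat_vec n m A (\<lambda>k. c * v k) = (\<lambda>k. c * mat_vec n m A v k)"
  by (auto simp: mat_vec_def fun_eq_iff sum_distrib_left algebra_simps)

lemma mat_vec_zero [simp]: "mat_vec n m A (\<lambda>k. 0) = (\<lambda>k. 0)"
  by (auto simp: mat_vec_def fun_eq_iff)

lemma mat_vec_diff_matrix:
  "mat_vec n m (\<lambda>a b. A a b - B a b) v = (\<lambda>k. mat_vec n m A v k - mat_vec n m B v k)"
  by (auto simp: mat_vec_def fun_eq_iff left_diff_distrib sum_subtractf)

section \<open>Matrices over \<open>K[V]\<close> and lifting of maps between free modules\<close>

definition mat_over :: "'v set \<Rightarrow> nat \<Rightarrow> nat \<Rightarrow> (nat \<Rightarrow> nat \<Rightarrow> ('v, 'k::field) mpoly) \<Rightarrow> bool" where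
  "mat_over V n m A \<longleftrightarrow> (\<forall>a<n. \<forall>b<m. A a b \<in> poly_ring V)"

definition mat_homogeneous ::
    "nat \<Rightarrow> nat \<Rightarrow> (nat \<Rightarrow> int) \<Rightarrow> (nat \<Rightarrow> int) \<Rightarrow> (nat \<Rightarrow> nat \<Rightarrow> ('v, 'k::field) mpoly) \<Rightarrow> bool" where
  "mat_homogeneous n m s t A \<longleftrightarrow> (\<forall>a<n. \<forall>b<m. homogeneous (t b - s a) (A a b))"

lemma free_module_poly_ring: "v \<in> free_module V n \<Longrightarrow> v k \<in> poly_ring V"
  by (cases "k < n") (auto simp: free_module_def)

lemma free_module_add: "v \<in> free_module V n \<Longrightarrow> w \<in> free_module V n \<Longrightarrow> (\<lambda>k. v k + w k) \<in> free_module V n"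
  by (auto simp: free_module_def poly_ring_add)

lemma free_module_uminus: "v \<in> free_module V n \<Longrightarrow> (\<lambda>k. - v k) \<in> free_module V n"
  for v :: "nat \<Rightarrow> ('v,'k::field) mpoly"
  by (auto simp: free_module_def poly_ring_uminus)

lemma free_module_scale: "c \<in> poly_ring V \<Longrightarrow> v \<in> free_module V n \<Longrightarrow> (\<lambda>k. c * v k) \<in> free_module V n"
  for v :: "nat \<Rightarrow> ('v,'k::field) mpoly"
  by (auto simp: free_module_def poly_ring_mult)

lemma unit_vec_free_module: "c < n \<Longrightarrow> unit_vec c \<in> free_module V n"
  by (auto simp: free_module_def unit_vec_def)

lemma mat_vec_free_module: "mat_over V n m A \<Longrightarrow> v \<in> free_module V m \<Longrightarrow> mat_vec n m A v \<in> free_module V n"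
  by (auto simp: free_module_def mat_vec_def mat_over_def intro!: poly_ring_sum poly_ring_mult)

lemma mat_over_mult: "mat_over V n m A \<Longrightarrow> mat_over V m k B \<Longrightarrow> mat_over V n k (mat_mult m A B)"
  by (auto simp: mat_over_def mat_mult_def intro!: poly_ring_sum poly_ring_mult)

lemma mat_over_diff: "mat_over V n m A \<Longrightarrow> mat_over V n m B \<Longrightarrow> mat_over V n m (\<lambda>a b. A a b - B a b)"
  by (auto simp: mat_over_def poly_ring_diff)

text \<open>Free modules are projective: each unit vector is lifted through \<open>D\<close>, and
  the lifts are the columns of \<open>Y\<close>.\<close>

lemma mat_factor:
  assumes "\<And>v. v \<in> free_module V k \<Longrightarrow> mat_vec n k X v \<in> mat_vec n m D ` free_module V m"
  obtains Y where "mat_over V m k Y" "\<And>a c. a < n \<Longrightarrow> c < k \<Longrightarrow> mat_mult m D Y a c = X a c"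
proof -
  have "\<forall>c\<in>{..<k}. \<exists>v. v \<in> free_module V m \<and> mat_vec n m D v = mat_vec n k X (unit_vec c)"
    using assms unit_vec_free_module by (metis imageE lessThan_iff)
  then obtain y where y: "\<And>c. c < k \<Longrightarrow> y c \<in> free_module V m"
    "\<And>c. c < k \<Longrightarrow> mat_vec n m D (y c) = mat_vec n k X (unit_vec c)"
    by (metis (no_types, lifting) lessThan_iff bchoice)
  show ?thesis
  proof (rule that[of "\<lambda>b c. y c b"])
    show "mat_over V m k (\<lambda>b c. y c b)" using y(1) by (auto simp: mat_over_def free_module_def)
    fix a c assume "a < n" "c < k"
    then show "mat_mult m D (\<lambda>b c. y c b) a c = X a c"
      using fun_cong[OF y(2), of c a] by (simp add: mat_vec_unit) (simp add: mat_vec_def mat_mult_def)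
  qed
qed

text \<open>Any lift can be made homogeneous by keeping, in each entry, only the component of the
  degree dictated by the shifts. Since \<open>D\<close> and \<open>X\<close> are homogeneous, the
  product \<open>D Y\<close> is unchanged.\<close>

lemma mat_factor_homogeneous:
  assumes "\<And>v. v \<in> free_module V k \<Longrightarrow> mat_vec n k X v \<in> mat_vec n m D ` free_module V m"
    and D: "mat_homogeneous n m s t D" and X: "mat_homogeneous n k s r X"
  obtains Y where "mat_over V m k Y" "mat_homogeneous m k t r Y"
    "\<And>a c. a < n \<Longrightarrow> c < k \<Longrightarrow> mat_mult m D Y a c = X a c"
proof -
  obtain Y where Y: "mat_over V m k Y" "\<And>a c. a < n \<Longrightarrow> c < k \<Longrightarrow> mat_mult m D Y a c = X a c"
    using mat_factor assms(1) by blast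
  let ?Y = "\<lambda>b c. hom_part (r c - t b) (Y b c)"
  show ?thesis
  proof (rule that[of ?Y])
    show "mat_over V m k ?Y" using Y(1) by (auto simp: mat_over_def hom_part_poly_ring)
    show "mat_homogeneous m k t r ?Y" by (auto simp: mat_homogeneous_def homogeneous_hom_part)
    fix a c assume ac: "a < n" "c < k"
    have "X a c = hom_part (r c - s a) (X a c)"
      using X ac by (simp add: mat_homogeneous_def hom_part_homogeneous)
    also have "\<dots> = (\<Sum>b<m. hom_part (r c - s a) (D a b * Y b c))"
      using Y(2) ac by (simp add: hom_part_sum flip: Y(2)) (simp add: mat_mult_def hom_part_sum)
    also have "\<dots> = (\<Sum>b<m. D a b * ?Y b c)"
    proof (rule sum.cong)
      fix b assume "b \<in> {..<m}"
      then have "homogeneous (t b - s a) (D a b)" using D ac by (simp add: mat_homogeneous_def)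
      from hom_part_mult[OF this, of "r c - s a" "Y b c"]
      show "hom_part (r c - s a) (D a b * Y b c) = D a b * ?Y b c" by simp
    qed simp
    finally show "mat_mult m D ?Y a c = X a c" by (simp add: mat_mult_def)
  qed
qed

text \<open>A minimal graded free resolution of \<open>S/I\<close> with \<open>F\<^sub>0 = S\<close>, augmented by the projection;
  the field \<open>aug\<close> is ignored.\<close>

definition min_resolution :: "'v set \<Rightarrow> ('v, 'k::field) mpoly set \<Rightarrow> ('v, 'k) resolution \<Rightarrow> bool" where
  "min_resolution V I F \<longleftrightarrow> rk F 0 = 1 \<and> shift F 0 0 = 0 \<and>
    (\<forall>i. mat_over V (rk F i) (rk F (Suc i)) (dmat F i)) \<and>
    (\<forall>i. mat_homogeneous (rk F i) (rk F (Suc i)) (shift F i) (shift F (Suc i)) (dmat F i)) \<and>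
    (\<forall>i. \<forall>a<rk F i. \<forall>b<rk F (Suc i). coef (dmat F i a b) 0 = 0) \<and>
    {v \<in> free_module V 1. v 0 \<in> I} = diff_map F 0 ` free_module V (rk F 1) \<and>
    (\<forall>i. {v \<in> free_module V (rk F (Suc i)). diff_map F i v = (\<lambda>_. 0)} =
       diff_map F (Suc i) ` free_module V (rk F (Suc (Suc i))))"

lemma diff_map_mat_vec: "diff_map F i = mat_vec (rk F i) (rk F (Suc i)) (dmat F i)"
  by (simp add: diff_map_def mat_vec_def fun_eq_iff)

lemma min_resolutionD:
  assumes "min_resolution V I F"
  shows min_resolution_rk0: "rk F 0 = 1" and min_resolution_shift0: "shift F 0 0 = 0"
    and min_resolution_over: "mat_over V (rk F i) (rk F (Suc i)) (dmat F i)"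
    and min_resolution_homogeneous:
      "mat_homogeneous (rk F i) (rk F (Suc i)) (shift F i) (shift F (Suc i)) (dmat F i)"
    and min_resolution_minimal: "a < rk F i \<Longrightarrow> b < rk F (Suc i) \<Longrightarrow> coef (dmat F i a b) 0 = 0"
    and min_resolution_exact0: "{v \<in> free_module V 1. v 0 \<in> I} = diff_map F 0 ` free_module V (rk F 1)"
    and min_resolution_exact: "{v \<in> free_module V (rk F (Suc i)). diff_map F i v = (\<lambda>_. 0)} =
       diff_map F (Suc i) ` free_module V (rk F (Suc (Suc i)))"
  using assms by (auto simp: min_resolution_def)

lemma diff_map_free_module:
  "min_resolution V I F \<Longrightarrow> v \<in> free_module V (rk F (Suc i)) \<Longrightarrow> diff_map F i v \<in> free_module V (rk F i)"
  by (simp add: diff_map_mat_vec mat_vec_free_module min_resolution_over)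

lemma diff_map_diff_map:
  assumes "min_resolution V I F" "v \<in> free_module V (rk F (Suc (Suc i)))"
  shows "diff_map F i (diff_map F (Suc i) v) = (\<lambda>_. 0)"
  using min_resolution_exact[OF assms(1), of i] assms(2) by blast

lemma diff_map_0_ideal:
  assumes "min_resolution V I F" "v \<in> free_module V (rk F 1)"
  shows "diff_map F 0 v 0 \<in> I"
  using min_resolution_exact0[OF assms(1)] assms(2) by blast

text \<open>The integer \<open>e\<close> is the internal degree: the maps have degree 0 once the
  shifts of \<open>H\<close> are raised by \<open>e\<close>.\<close>

definition chain_map ::
    "'v set \<Rightarrow> ('v, 'k::field) resolution \<Rightarrow> ('v, 'k) resolution \<Rightarrow> int \<Rightarrow> (nat \<Rightarrow> nat \<Rightarrow> nat \<Rightarrow> ('v, 'k) mpoly) \<Rightarrow> bool" where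
  "chain_map V H F e \<psi> \<longleftrightarrow> (\<forall>i. mat_over V (rk F i) (rk H i) (\<psi> i)) \<and>
    (\<forall>i. mat_homogeneous (rk F i) (rk H i) (shift F i) (\<lambda>c. shift H i c + e) (\<psi> i)) \<and>
    (\<forall>i. \<forall>v\<in>free_module V (rk H (Suc i)).
       diff_map F i (mat_vec (rk F (Suc i)) (rk H (Suc i)) (\<psi> (Suc i)) v) =
       mat_vec (rk F i) (rk H i) (\<psi> i) (diff_map H i v))"

lemma chain_mapD:
  assumes "chain_map V H F e \<psi>"
  shows chain_map_over: "mat_over V (rk F i) (rk H i) (\<psi> i)"
    and chain_map_homogeneous:
      "a < rk F i \<Longrightarrow> c < rk H i \<Longrightarrow> homogeneous (shift H i c + e - shift F i a) (\<psi> i a c)"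
    and chain_map_commute: "v \<in> free_module V (rk H (Suc i)) \<Longrightarrow>
       diff_map F i (mat_vec (rk F (Suc i)) (rk H (Suc i)) (\<psi> (Suc i)) v) =
       mat_vec (rk F i) (rk H i) (\<psi> i) (diff_map H i v)"
  using assms by (auto simp: chain_map_def mat_homogeneous_def)

text \<open>Multiplication by \<open>b\<close> induces a map from \<open>S/L\<close> to
  \<open>S/I\<close>, which is lifted degree by degree. The invariant \<open>P\<close> contains
  exactly what the next lift needs, namely that \<open>\<psi>\<close> carries boundaries of
  \<open>H\<close> to boundaries of \<open>F\<close>; exactness of \<open>F\<close> restores it
  afterwards.\<close>

lemma comparison_map:
  fixes F H :: "('v, 'k::field) resolution"
  assumes H: "min_resolution V L H" and F: "min_resolution V I F"
    and b: "b \<in> poly_ring V" "homogeneous e b" and bL: "\<And>p. p \<in> L \<Longrightarrow> b * p \<in> I"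
  shows "\<exists>\<psi>. chain_map V H F e \<psi> \<and> \<psi> 0 0 0 = b"
proof -
  define P where "P = (\<lambda>i \<psi>. mat_over V (rk F i) (rk H i) \<psi> \<and>
    mat_homogeneous (rk F i) (rk H i) (shift F i) (\<lambda>c. shift H i c + e) \<psi> \<and> (i = 0 \<longrightarrow> \<psi> 0 0 = b) \<and>
    (\<forall>v\<in>free_module V (rk H (Suc i)). mat_vec (rk F i) (rk H i) \<psi> (diff_map H i v)
       \<in> diff_map F i ` free_module V (rk F (Suc i))))"
  define Q where "Q = (\<lambda>i \<psi> \<psi>'. \<forall>v\<in>free_module V (rk H (Suc i)).
     diff_map F i (mat_vec (rk F (Suc i)) (rk H (Suc i)) \<psi>' v) = mat_vec (rk F i) (rk H i) \<psi> (diff_map H i v))"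
  have "\<exists>f. \<forall>i. P i (f i) \<and> Q i (f i) (f (Suc i))"
  proof (rule dependent_nat_choice)
    have "mat_vec 1 1 (\<lambda>_ _. b) (diff_map H 0 v) \<in> diff_map F 0 ` free_module V (rk F 1)"
      if v: "v \<in> free_module V (rk H 1)" for v
    proof -
      have "mat_over V 1 1 (\<lambda>_ _. b)" using b by (simp add: mat_over_def)
      then have "mat_vec 1 1 (\<lambda>_ _. b) (diff_map H 0 v) \<in> free_module V 1"
        using diff_map_free_module[OF H, of v 0] v min_resolution_rk0[OF H]
        by (auto intro: mat_vec_free_module)
      moreover have "mat_vec 1 1 (\<lambda>_ _. b) (diff_map H 0 v) 0 \<in> I"
        using diff_map_0_ideal[OF H v] bL by (simp add: mat_vec_def)
      ultimately show ?thesis using min_resolution_exact0[OF F] by blast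
    qed
    then have "P 0 (\<lambda>_ _. b)" using b F H
      by (simp add: P_def min_resolution_rk0 min_resolution_shift0 mat_over_def mat_homogeneous_def)
    then show "\<exists>\<psi>. P 0 \<psi>" by blast
  next
    fix \<psi> i assume P: "P i \<psi>"
    let ?X = "mat_mult (rk H i) \<psi> (dmat H i)"
    have X: "mat_vec (rk F i) (rk H i) \<psi> (diff_map H i v) = mat_vec (rk F i) (rk H (Suc i)) ?X v" for v
      by (simp add: diff_map_mat_vec mat_vec_comp)
    have "homogeneous (shift H (Suc i) c + e - shift F i a) (?X a c)"
      if ac: "a < rk F i" "c < rk H (Suc i)" for a c
      unfolding mat_mult_def
    proof (rule homogeneous_sum)
      fix b assume "b \<in> {..<rk H i}"
      then have "homogeneous (shift H i b + e - shift F i a) (\<psi> a b)"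
        "homogeneous (shift H (Suc i) c - shift H i b) (dmat H i b c)"
        using P ac min_resolution_homogeneous[OF H, of i] by (auto simp: P_def mat_homogeneous_def)
      from homogeneous_mult[OF this]
      show "homogeneous (shift H (Suc i) c + e - shift F i a) (\<psi> a b * dmat H i b c)"
        by (simp add: algebra_simps)
    qed
    then have hX: "mat_homogeneous (rk F i) (rk H (Suc i)) (shift F i) (\<lambda>c. shift H (Suc i) c + e) ?X"
      by (simp add: mat_homogeneous_def)
    have img: "mat_vec (rk F i) (rk H (Suc i)) ?X v
       \<in> mat_vec (rk F i) (rk F (Suc i)) (dmat F i) ` free_module V (rk F (Suc i))"
      if "v \<in> free_module V (rk H (Suc i))" for v
      using P that unfolding P_def X diff_map_mat_vec[of F] by blast
    obtain Y where Y: "mat_over V (rk F (Suc i)) (rk H (Suc i)) Y"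
      "mat_homogeneous (rk F (Suc i)) (rk H (Suc i)) (shift F (Suc i)) (\<lambda>c. shift H (Suc i) c + e) Y"
      "\<And>a c. a < rk F i \<Longrightarrow> c < rk H (Suc i) \<Longrightarrow> mat_mult (rk F (Suc i)) (dmat F i) Y a c = ?X a c"
      using mat_factor_homogeneous[OF img min_resolution_homogeneous[OF F] hX] by blast
    have comm: "diff_map F i (mat_vec (rk F (Suc i)) (rk H (Suc i)) Y v) =
       mat_vec (rk F i) (rk H i) \<psi> (diff_map H i v)" for v
      using mat_vec_cong[OF Y(3)] by (simp add: X) (simp add: diff_map_mat_vec mat_vec_comp)
    have "mat_vec (rk F (Suc i)) (rk H (Suc i)) Y (diff_map H (Suc i) v)
       \<in> diff_map F (Suc i) ` free_module V (rk F (Suc (Suc i)))"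
      if v: "v \<in> free_module V (rk H (Suc (Suc i)))" for v
    proof -
      have "diff_map F i (mat_vec (rk F (Suc i)) (rk H (Suc i)) Y (diff_map H (Suc i) v)) = (\<lambda>_. 0)"
        using diff_map_diff_map[OF H v] by (simp add: comm)
      moreover have "mat_vec (rk F (Suc i)) (rk H (Suc i)) Y (diff_map H (Suc i) v) \<in> free_module V (rk F (Suc i))"
        using diff_map_free_module[OF H v] Y(1) by (simp add: mat_vec_free_module)
      ultimately show ?thesis using min_resolution_exact[OF F, of i] by blast
    qed
    then have "P (Suc i) Y" using Y by (simp add: P_def)
    moreover have "Q i \<psi> Y" using comm by (simp add: Q_def)
    ultimately show "\<exists>Y. P (Suc i) Y \<and> Q i \<psi> Y" by blast
  qed
  then obtain f where f: "\<And>i. P i (f i)" "\<And>i. Q i (f i) (f (Suc i))" by blast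
  then show ?thesis by (intro exI[of _ f]) (simp add: P_def Q_def chain_map_def)
qed

text \<open>A self-map \<open>\<Psi>\<close> of the resolution that vanishes at \<open>F\<^sub>0\<close> is null-homotopic, and the
  homotopy forces its entries into the maximal ideal. The induction only needs the
  weaker equation \<open>\<Psi>\<^sub>i d = d h d\<close>.\<close>

lemma null_homotopic_minimal:
  fixes F :: "('v, 'k::field) resolution"
  assumes F: "min_resolution V I F"
    and over: "\<And>i. mat_over V (rk F i) (rk F i) (\<Psi> i)"
    and comm: "\<And>i v. v \<in> free_module V (rk F (Suc i)) \<Longrightarrow>
       diff_map F i (mat_vec (rk F (Suc i)) (rk F (Suc i)) (\<Psi> (Suc i)) v) =
       mat_vec (rk F i) (rk F i) (\<Psi> i) (diff_map F i v)"
    and zero: "\<Psi> 0 0 0 = 0" and ac: "a < rk F i" "c < rk F i"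
  shows "coef (\<Psi> i a c) 0 = 0"
proof -
  let ?D = "\<lambda>i. mat_vec (rk F i) (rk F i) (\<Psi> i)"
  let ?h = "\<lambda>i. mat_vec (rk F (Suc i)) (rk F i)"
  have step: "\<exists>h'. mat_over V (rk F (Suc (Suc i))) (rk F (Suc i)) h' \<and>
      (\<forall>a<rk F (Suc i). \<forall>c<rk F (Suc i). mat_mult (rk F (Suc (Suc i))) (dmat F (Suc i)) h' a c =
        \<Psi> (Suc i) a c - mat_mult (rk F i) h (dmat F i) a c)"
    if h: "mat_over V (rk F (Suc i)) (rk F i) h"
      "\<And>v. v \<in> free_module V (rk F (Suc i)) \<Longrightarrow> ?D i (diff_map F i v) = diff_map F i (?h i h (diff_map F i v))"
    for i h
  proof -
    \<comment> \<open>The difference of \<open>\<Psi>\<close> and \<open>h d\<close> is killed by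
      the differential, by commutation and the assumption on \<open>h\<close>. Hence it factors
      through the next differential, and the factor is the next homotopy.\<close>
    let ?X = "\<lambda>a c. \<Psi> (Suc i) a c - mat_mult (rk F i) h (dmat F i) a c"
    have oX: "mat_over V (rk F (Suc i)) (rk F (Suc i)) ?X"
      using over h(1) min_resolution_over[OF F] by (intro mat_over_diff mat_over_mult)
    have img: "mat_vec (rk F (Suc i)) (rk F (Suc i)) ?X v \<in>
       mat_vec (rk F (Suc i)) (rk F (Suc (Suc i))) (dmat F (Suc i)) ` free_module V (rk F (Suc (Suc i)))"
      if v: "v \<in> free_module V (rk F (Suc i))" for v
    proof -
      have X: "mat_vec (rk F (Suc i)) (rk F (Suc i)) ?X v = (\<lambda>k. ?D (Suc i) v k + - ?h i h (diff_map F i v) k)"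
        by (simp add: mat_vec_diff_matrix diff_map_mat_vec mat_vec_comp)
      have "diff_map F i (mat_vec (rk F (Suc i)) (rk F (Suc i)) ?X v) =
        (\<lambda>k. diff_map F i (?D (Suc i) v) k + - diff_map F i (?h i h (diff_map F i v)) k)"
        unfolding X diff_map_mat_vec mat_vec_add mat_vec_uminus ..
      also have "\<dots> = (\<lambda>_. 0)" using comm[OF v] h(2)[OF v] by simp
      finally have "mat_vec (rk F (Suc i)) (rk F (Suc i)) ?X v \<in> diff_map F (Suc i) ` free_module V (rk F (Suc (Suc i)))"
        using min_resolution_exact[OF F, of i] mat_vec_free_module[OF oX v] by blast
      then show ?thesis by (simp add: diff_map_mat_vec)
    qed
    from mat_factor[OF img] show ?thesis by metis
  qed
  have ex: "\<exists>h. mat_over V (rk F (Suc i)) (rk F i) h \<and> (\<forall>v \<in> free_module V (rk F (Suc i)).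
     ?D i (diff_map F i v) = diff_map F i (?h i h (diff_map F i v)))" for i
  proof (induction i)
    case 0
    \<comment> \<open>As \<open>F\<close> starts with rank 1, the single entry
      \<open>\<Psi> 0 0 0 = 0\<close> is the whole map, and the zero homotopy starts the
      induction.\<close>
    have "?D 0 v = (\<lambda>_. 0)" for v
      using zero by (auto simp: mat_vec_def fun_eq_iff min_resolution_rk0[OF F])
    moreover have "?h 0 (\<lambda>_ _. 0) v = (\<lambda>_. 0)" for v :: "nat \<Rightarrow> ('v, 'k) mpoly"
      by (auto simp: mat_vec_def fun_eq_iff)
    ultimately show ?case
      by (intro exI[of _ "\<lambda>_ _. 0"]) (simp add: mat_over_def, simp add: diff_map_mat_vec)
  next
    case (Suc i)
    then obtain h where h: "mat_over V (rk F (Suc i)) (rk F i) h"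
      "\<And>v. v \<in> free_module V (rk F (Suc i)) \<Longrightarrow> ?D i (diff_map F i v) = diff_map F i (?h i h (diff_map F i v))"
      by blast
    from step[OF h] obtain h' where h': "mat_over V (rk F (Suc (Suc i))) (rk F (Suc i)) h'"
      "\<And>a c. a < rk F (Suc i) \<Longrightarrow> c < rk F (Suc i) \<Longrightarrow> mat_mult (rk F (Suc (Suc i))) (dmat F (Suc i)) h' a c =
        \<Psi> (Suc i) a c - mat_mult (rk F i) h (dmat F i) a c"
      by blast
    have "?D (Suc i) (diff_map F (Suc i) v) = diff_map F (Suc i) (?h (Suc i) h' (diff_map F (Suc i) v))"
      if v: "v \<in> free_module V (rk F (Suc (Suc i)))" for v
    proof -
      let ?w = "diff_map F (Suc i) v"
      have "diff_map F (Suc i) (?h (Suc i) h' w) = (\<lambda>k. ?D (Suc i) w k - ?h i h (diff_map F i w) k)" for w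
        using mat_vec_cong[of "rk F (Suc i)" "rk F (Suc i)", OF h'(2)]
        by (simp add: diff_map_mat_vec mat_vec_comp mat_vec_diff_matrix)
      then show ?thesis using diff_map_diff_map[OF F v] by simp
    qed
    then show ?case using h'(1) by blast
  qed
  show ?thesis
  proof (cases i)
    case 0
    then show ?thesis using zero ac by (simp add: min_resolution_rk0[OF F])
  next
    case (Suc i')
    obtain h where h: "mat_over V (rk F (Suc i')) (rk F i') h"
      "\<And>v. v \<in> free_module V (rk F (Suc i')) \<Longrightarrow> ?D i' (diff_map F i' v) = diff_map F i' (?h i' h (diff_map F i' v))"
      using ex[of i'] by blast
    from step[OF h] obtain h' where h': "mat_mult (rk F (Suc i)) (dmat F i) h' a c =
        \<Psi> i a c - mat_mult (rk F i') h (dmat F i') a c"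
      using ac Suc by blast
    then have "\<Psi> i a c = mat_mult (rk F (Suc i)) (dmat F i) h' a c + mat_mult (rk F i') h (dmat F i') a c"
      by simp
    then show ?thesis using ac Suc
      by (simp add: lookup_add mat_mult_def lookup_sum lookup_mult_zero min_resolution_minimal[OF F])
  qed
qed

section \<open>Uniqueness of graded Betti numbers\<close>

text \<open>The identity on the functions supported in \<open>J\<close> factors through a space of
  dimension at most \<open>card J'\<close>. Concretely, the independent unit vectors
  \<open>e a\<close> lie in the span of the rows \<open>r b\<close> of \<open>B\<close>.\<close>

lemma card_le_of_inverse_matrix:
  fixes A B :: "nat \<Rightarrow> nat \<Rightarrow> 'k::field"
  assumes "finite J" "finite J'"
    and inv: "\<And>a c. a \<in> J \<Longrightarrow> c \<in> J \<Longrightarrow> (\<Sum>b\<in>J'. A a b * B b c) = (if a = c then 1 else 0)"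
  shows "card J \<le> card J'"
proof -
  interpret vector_space "\<lambda>(c::'k) (f::nat \<Rightarrow> 'k) x. c * f x"
    by unfold_locales (auto simp: algebra_simps fun_eq_iff)
  define e where "e = (\<lambda>(a::nat) (c::nat). if c = a then 1 else 0 :: 'k)"
  define r where "r = (\<lambda>b c. if c \<in> J then B b c else 0)"
  have sum_apply: "(\<Sum>x\<in>S. f x) c = (\<Sum>x\<in>S. f x c)" for f :: "nat \<Rightarrow> nat \<Rightarrow> 'k" and S c
    by (induction S rule: infinite_finite_induct) auto
  have inj: "inj_on e J"
  proof (rule inj_onI)
    fix a b assume "e a = e b"
    then have "e a b = e b b" by simp
    then show "a = b" by (simp add: e_def split: if_splits)
  qed
  have "e a \<in> span (r ` J')" if a: "a \<in> J" for a
  proof -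
    have "e a = (\<Sum>b\<in>J'. (\<lambda>x. A a b * r b x))"
    proof
      fix c
      show "e a c = (\<Sum>b\<in>J'. (\<lambda>x. A a b * r b x)) c"
        using inv[OF a, of c] a by (cases "c \<in> J") (auto simp: sum_apply e_def r_def)
    qed
    also have "\<dots> \<in> span (r ` J')" by (intro span_sum span_scale span_base imageI)
    finally show ?thesis .
  qed
  moreover have "independent (e ` J)"
  proof -
    have "u v = 0" if u: "(\<Sum>v\<in>e ` J. (\<lambda>x. u v * v x)) = 0" and v: "v \<in> e ` J" for u v
    proof -
      obtain a where a: "a \<in> J" "v = e a" using v by blast
      have "(\<Sum>v\<in>e ` J. (\<lambda>x. u v * v x)) a = (\<Sum>b\<in>J. u (e b) * e b a)"
        by (simp add: sum.reindex[OF inj] sum_apply)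
      also have "\<dots> = u v"
        using a assms(1) by (simp add: e_def if_distrib cong: if_cong)
      finally show ?thesis using u by simp
    qed
    then show ?thesis using dependent_finite[of "e ` J"] assms(1) by blast
  qed
  ultimately have "card (e ` J) \<le> card (r ` J')"
    using independent_span_bound[of "r ` J'" "e ` J"] assms(2) by blast
  then show ?thesis
    using card_image[OF inj] card_image_le[OF assms(2), of r] by simp
qed

definition graded_rank :: "('v, 'k::field) resolution \<Rightarrow> nat \<Rightarrow> int \<Rightarrow> nat" where
  "graded_rank F i d = card {k. k < rk F i \<and> shift F i k = d}"

text \<open>Let \<open>f\<close> and \<open>g\<close> lift the identity of \<open>S/I\<close> in
  both directions. The map \<open>g f - 1\<close> vanishes at the start of \<open>F\<close>, so all
  its constant terms are 0, and the constant terms of \<open>g\<close> and \<open>f\<close> form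
  matrices with product 1. A nonzero constant term joins equal shifts only, so this identity holds
  for each degree \<open>d\<close> separately.\<close>

lemma graded_rank_le:
  fixes F F' :: "('v, 'k::field) resolution"
  assumes F: "min_resolution V I F" and F': "min_resolution V I F'"
  shows "graded_rank F i d \<le> graded_rank F' i d"
proof -
  have one: "1 * p \<in> I" if "p \<in> I" for p using that by simp
  obtain f where f: "chain_map V F F' 0 f" "f 0 0 0 = 1"
    using comparison_map[OF F F' poly_ring_one homogeneous_one one] by blast
  obtain g where g: "chain_map V F' F 0 g" "g 0 0 0 = 1"
    using comparison_map[OF F' F poly_ring_one homogeneous_one one] by blast
  define \<Psi> where "\<Psi> = (\<lambda>i a c. mat_mult (rk F' i) (g i) (f i) a c - (if a = c then 1 else 0))"
  have id: "mat_vec n n (\<lambda>a c. if a = c then 1 else 0) v = v" if "v \<in> free_module V n"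
    for n and v :: "nat \<Rightarrow> ('v, 'k) mpoly"
  proof
    fix a
    have "(\<Sum>c<n. (if a = c then 1 else 0) * v c) = (\<Sum>c<n. if a = c then v c else 0)"
      by (intro sum.cong) auto
    then show "mat_vec n n (\<lambda>a c. if a = c then 1 else 0) v a = v a"
      using that by (simp add: mat_vec_def free_module_def)
  qed
  have \<Psi>: "mat_vec (rk F i) (rk F i) (\<Psi> i) v =
      (\<lambda>k. mat_vec (rk F i) (rk F' i) (g i) (mat_vec (rk F' i) (rk F i) (f i) v) k + - v k)"
    if "v \<in> free_module V (rk F i)" for v :: "nat \<Rightarrow> ('v, 'k) mpoly" and i
    using id[OF that] by (simp add: \<Psi>_def mat_vec_diff_matrix mat_vec_comp)
  have "coef (\<Psi> i a c) 0 = 0" if "a < rk F i" "c < rk F i" for a c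
  proof (rule null_homotopic_minimal[OF F _ _ _ that])
    show "mat_over V (rk F i) (rk F i) (\<Psi> i)" for i
      unfolding \<Psi>_def by (intro mat_over_diff mat_over_mult chain_map_over[OF f(1)] chain_map_over[OF g(1)])
        (simp add: mat_over_def)
    show "\<Psi> 0 0 0 = 0" using f(2) g(2) by (simp add: \<Psi>_def mat_mult_def min_resolution_rk0[OF F'])
    fix i and v :: "nat \<Rightarrow> ('v, 'k) mpoly" assume v: "v \<in> free_module V (rk F (Suc i))"
    have fv: "mat_vec (rk F' (Suc i)) (rk F (Suc i)) (f (Suc i)) v \<in> free_module V (rk F' (Suc i))"
      using chain_map_over[OF f(1)] v by (simp add: mat_vec_free_module)
    have "diff_map F i (mat_vec (rk F (Suc i)) (rk F (Suc i)) (\<Psi> (Suc i)) v) =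
       (\<lambda>k. diff_map F i (mat_vec (rk F (Suc i)) (rk F' (Suc i)) (g (Suc i))
          (mat_vec (rk F' (Suc i)) (rk F (Suc i)) (f (Suc i)) v)) k + - diff_map F i v k)"
      unfolding \<Psi>[OF v] diff_map_mat_vec mat_vec_add mat_vec_uminus ..
    also have "\<dots> = mat_vec (rk F i) (rk F i) (\<Psi> i) (diff_map F i v)"
      using chain_map_commute[OF g(1) fv] chain_map_commute[OF f(1) v] \<Psi>[OF diff_map_free_module[OF F v]] by simp
    finally show "diff_map F i (mat_vec (rk F (Suc i)) (rk F (Suc i)) (\<Psi> (Suc i)) v) =
       mat_vec (rk F i) (rk F i) (\<Psi> i) (diff_map F i v)" .
  qed
  then have inv: "(\<Sum>b<rk F' i. coef (g i a b) 0 * coef (f i b c) 0) = (if a = c then 1 else 0)"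
    if "a < rk F i" "c < rk F i" for a c
    using that by (cases "a = c") (simp_all add: \<Psi>_def lookup_minus mat_mult_def lookup_sum lookup_mult_zero)
  let ?J = "{k. k < rk F i \<and> shift F i k = d}" and ?J' = "{k. k < rk F' i \<and> shift F' i k = d}"
  have "card ?J \<le> card ?J'"
  proof (rule card_le_of_inverse_matrix[where A = "\<lambda>a b. coef (g i a b) 0" and B = "\<lambda>b c. coef (f i b c) 0"])
    fix a c assume ac: "a \<in> ?J" "c \<in> ?J"
    have "coef (f i b c) 0 = 0" if b: "b < rk F' i" "shift F' i b \<noteq> d" for b
    proof (rule ccontr)
      assume "coef (f i b c) 0 \<noteq> 0"
      moreover have "homogeneous (shift F i c + 0 - shift F' i b) (f i b c)"
        using chain_map_homogeneous[OF f(1)] b ac by blast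
      ultimately show False using homogeneous_const(1) b ac by force
    qed
    then have "(\<Sum>b\<in>?J'. coef (g i a b) 0 * coef (f i b c) 0) =
      (\<Sum>b<rk F' i. coef (g i a b) 0 * coef (f i b c) 0)"
      by (intro sum.mono_neutral_left) auto
    then show "(\<Sum>b\<in>?J'. coef (g i a b) 0 * coef (f i b c) 0) = (if a = c then 1 else 0)"
      using inv ac by simp
  qed auto
  then show ?thesis by (simp add: graded_rank_def)
qed

text \<open>Provides the witness for the choice made in \<open>betti\<close>: the augmentation 1 is
  the projection of \<open>S\<close> onto \<open>S/I\<close>.\<close>

lemma min_resolution_imp_minimal_graded:
  assumes F: "min_resolution V I F"
  shows "minimal_graded_free_resolution V I (F\<lparr>aug := \<lambda>_. 1\<rparr>)"
proof -
  let ?F = "F\<lparr>aug := \<lambda>_. 1\<rparr>"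
  have aug: "aug_map ?F v = v 0" for v
    by (simp add: aug_map_def min_resolution_rk0[OF F])
  have diff: "diff_map ?F i = diff_map F i" for i
    by (simp add: diff_map_def fun_eq_iff)
  have zI: "0 \<in> I"
    using diff_map_0_ideal[OF F, of "\<lambda>_. 0"] by (simp add: free_module_def diff_map_mat_vec)
  have "p - aug_map ?F (\<lambda>k. if k = 0 then p else 0) \<in> I"
    "p \<in> poly_ring V \<Longrightarrow> (\<lambda>k. if k = 0 then p else 0) \<in> free_module V (rk F 0)" for p
    using zI by (auto simp: aug free_module_def min_resolution_rk0[OF F])
  then have "\<forall>p\<in>poly_ring V. \<exists>v\<in>free_module V (rk F 0). p - aug_map ?F v \<in> I" by blast
  then have "graded_free_resolution V I ?F"
    using F homogeneous_one
    by (simp add: graded_free_resolution_def min_resolution_def diff aug mat_over_def mat_homogeneous_def)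
  then show ?thesis
    using F by (simp add: minimal_graded_free_resolution_def max_ideal_def min_resolution_def mat_over_def)
qed

text \<open>The class of 1 must be hit modulo a proper ideal, so some \<open>aug F k0\<close> has a
  nonzero constant term and is therefore a scalar. A second basis element would give a relation with
  a unit entry, against minimality.\<close>

lemma minimal_graded_imp_min_resolution:
  fixes F :: "('v, 'k::field) resolution"
  assumes F: "minimal_graded_free_resolution V I F"
    and I: "I = monomial_ideal V P" "mono P" "\<not> P {}"
  shows "min_resolution V I F"
proof -
  have G: "graded_free_resolution V I F" and
    min: "\<And>i a b. a < rk F i \<Longrightarrow> b < rk F (Suc i) \<Longrightarrow> dmat F i a b \<in> max_ideal V"
    using F by (auto simp: minimal_graded_free_resolution_def)
  have I0: "coef p 0 = 0" if "p \<in> I" for p :: "('v, 'k) mpoly"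
  proof (rule ccontr)
    assume "coef p 0 \<noteq> 0"
    then have "0 \<in> exps p" by (simp add: in_keys_iff)
    then have "P (exps (0 :: 'v \<Rightarrow>\<^sub>0 nat))" using that I(1) unfolding monomial_ideal_def by blast
    then show False using I(3) by simp
  qed
  have augh: "aug F k \<in> poly_ring V" "homogeneous (shift F 0 k) (aug F k)" if "k < rk F 0" for k
    using G that by (auto simp: graded_free_resolution_def)
  have ker: "{v \<in> free_module V (rk F 0). aug_map F v \<in> I} = diff_map F 0 ` free_module V (rk F 1)"
    using G by (simp add: graded_free_resolution_def)
  have "\<forall>p\<in>poly_ring V. \<exists>v\<in>free_module V (rk F 0). p - aug_map F v \<in> I"
    using G by (simp add: graded_free_resolution_def)
  then obtain v where v: "1 - aug_map F v \<in> I"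
    using poly_ring_one by blast
  have "coef (aug_map F v) 0 = 1" using I0[OF v] by (simp add: lookup_minus)
  then have "(\<Sum>k<rk F 0. coef (aug F k) 0 * coef (v k) 0) \<noteq> 0"
    by (simp add: aug_map_def lookup_sum lookup_mult_zero)
  have "\<exists>k<rk F 0. coef (aug F k) 0 \<noteq> 0"
  proof (rule ccontr)
    assume "\<not> (\<exists>k<rk F 0. coef (aug F k) 0 \<noteq> 0)"
    then have "(\<Sum>k<rk F 0. coef (aug F k) 0 * coef (v k) 0) = 0" by (intro sum.neutral) auto
    then show False using \<open>(\<Sum>k<rk F 0. coef (aug F k) 0 * coef (v k) 0) \<noteq> 0\<close> by simp
  qed
  then obtain k0 where k0: "k0 < rk F 0" "coef (aug F k0) 0 \<noteq> 0" by blast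
  define c where "c = coef (aug F k0) 0"
  have shift0: "shift F 0 k0 = 0"
    by (rule homogeneous_const(1)[OF augh(2)[OF k0(1)] k0(2)])
  have aug0: "aug F k0 = Poly_Mapping.single 0 c"
    unfolding c_def by (rule homogeneous_const(2)[OF augh(2)[OF k0(1)] k0(2)])
  have cinv: "Poly_Mapping.single 0 c * Poly_Mapping.single 0 (inverse c) = (1 :: ('v, 'k) mpoly)"
    using k0 by (simp add: mult_single c_def)
  have uniq: "k = k0" if k: "k < rk F 0" for k
  proof (rule ccontr)
    assume ne: "k \<noteq> k0"
    \<comment> \<open>The relation expressing the \<open>k\<close>-th generator of
      \<open>S/I\<close> through the \<open>k0\<close>-th one. It lies in the kernel and so in the
      image of the differential, whose values have no constant terms, whereas its coordinate
      \<open>k\<close> is 1.\<close>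
    define w where "w = (\<lambda>j. if j = k then 1 else if j = k0
      then - (Poly_Mapping.single 0 (inverse c) * aug F k) else 0 :: ('v, 'k) mpoly)"
    have "w \<in> free_module V (rk F 0)"
      using k k0 augh(1)[OF k]
      by (auto simp: free_module_def w_def intro!: poly_ring_uminus poly_ring_mult poly_ring_single)
    moreover have "aug_map F w = (\<Sum>j\<in>{k, k0}. aug F j * w j)"
      unfolding aug_map_def using k k0 by (intro sum.mono_neutral_right) (auto simp: w_def)
    then have "aug_map F w = 0"
      using ne cinv by (simp add: w_def aug0 flip: mult.assoc)
    then have "aug_map F w \<in> I" by (simp add: I(1) monomial_ideal_def)
    ultimately obtain u where "w = diff_map F 0 u" using ker by blast
    then have "coef (w k) 0 = (\<Sum>b<rk F (Suc 0). coef (dmat F 0 k b) 0 * coef (u b) 0)"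
      using k by (simp add: diff_map_def lookup_sum lookup_mult_zero)
    also have "\<dots> = 0" using min[OF k] by (simp add: max_ideal_def)
    finally show False by (simp add: w_def)
  qed
  have k00: "k0 = 0" using uniq[of 0] k0(1) by simp
  have rk0: "rk F 0 = 1" using uniq[of 1] k0(1) k00 by (cases "rk F 0 > 1") auto
  \<comment> \<open>The augmentation is now multiplication by the invertible scalar
    \<open>c\<close>, so it has the same kernel modulo \<open>I\<close> as the projection.\<close>
  have "v \<in> free_module V 1 \<and> v 0 \<in> I \<longleftrightarrow> v \<in> free_module V (rk F 0) \<and> aug_map F v \<in> I" for v
  proof -
    have am: "aug_map F v = Poly_Mapping.single 0 c * v 0"
      using aug0 k00 by (simp add: aug_map_def rk0)
    moreover have "v 0 = Poly_Mapping.single 0 (inverse c) * aug_map F v"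
      unfolding am by (metis cinv mult.assoc mult.commute mult.right_neutral)
    moreover have "Poly_Mapping.single 0 x * p \<in> I" if "p \<in> I" for x and p :: "('v, 'k) mpoly"
      using that unfolding I(1) by (intro monomial_ideal_mult I poly_ring_single) simp
    ultimately have "aug_map F v \<in> I \<longleftrightarrow> v 0 \<in> I" by metis
    then show ?thesis by (simp add: rk0)
  qed
  then have "{v \<in> free_module V 1. v 0 \<in> I} = diff_map F 0 ` free_module V (rk F 1)"
    using ker by blast
  moreover have "mat_over V (rk F i) (rk F (Suc i)) (dmat F i)"
    "mat_homogeneous (rk F i) (rk F (Suc i)) (shift F i) (shift F (Suc i)) (dmat F i)"
    "{v \<in> free_module V (rk F (Suc i)). diff_map F i v = (\<lambda>_. 0)} =
       diff_map F (Suc i) ` free_module V (rk F (Suc (Suc i)))" for i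
    using G by (simp_all add: graded_free_resolution_def mat_over_def mat_homogeneous_def)
  moreover have "coef (dmat F i a b) 0 = 0" if "a < rk F i" "b < rk F (Suc i)" for i a b
    using min[OF that] by (simp add: max_ideal_def)
  ultimately show ?thesis
    using shift0 k00 rk0 by (simp add: min_resolution_def)
qed

text \<open>From here on any explicit resolution may stand in for the one chosen in
  \<open>betti\<close>.\<close>

lemma betti_eq_graded_rank:
  fixes F :: "('v, 'k::field) resolution"
  assumes F: "min_resolution V I F" and I: "I = monomial_ideal V P" "mono P" "\<not> P {}"
  shows "betti V I i d = graded_rank F i d"
proof -
  define F' where "F' = (SOME F. minimal_graded_free_resolution V I F)"
  have "minimal_graded_free_resolution V I F'"
    unfolding F'_def using min_resolution_imp_minimal_graded[OF F] by (rule someI)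
  then have F': "min_resolution V I F'" by (rule minimal_graded_imp_min_resolution[OF _ I])
  have "betti V I i d = graded_rank F' i d" by (simp add: betti_def graded_rank_def F'_def Let_def)
  then show ?thesis using graded_rank_le[OF F F'] graded_rank_le[OF F' F] by (metis order_antisym)
qed

section \<open>Mapping cones\<close>

definition join_vec :: "nat \<Rightarrow> (nat \<Rightarrow> 'a) \<Rightarrow> (nat \<Rightarrow> 'a) \<Rightarrow> nat \<Rightarrow> 'a" where
  "join_vec n f h = (\<lambda>k. if k < n then f k else h (k - n))"

lemma join_vec_free_module:
  "f \<in> free_module V n \<Longrightarrow> h \<in> free_module V m \<Longrightarrow> join_vec n f h \<in> free_module V (n + m)"
  by (auto simp: free_module_def join_vec_def)

lemma free_module_splitE:
  assumes "v \<in> free_module V (n + m)"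
  obtains f h where "f \<in> free_module V n" "h \<in> free_module V m" "v = join_vec n f h"
proof (rule that)
  show "(\<lambda>k. if k < n then v k else 0) \<in> free_module V n" "(\<lambda>k. v (n + k)) \<in> free_module V m"
    using assms by (auto simp: free_module_def)
  show "v = join_vec n (\<lambda>k. if k < n then v k else 0) (\<lambda>k. v (n + k))"
    by (auto simp: join_vec_def fun_eq_iff)
qed

lemma join_vec_eq_zeroD:
  assumes "join_vec n f h = (\<lambda>_. 0)"
  shows "a < n \<Longrightarrow> f a = 0" "h a = 0"
  using fun_cong[OF assms, of a] fun_cong[OF assms, of "n + a"] by (auto simp: join_vec_def)

lemma sum_lessThan_add: "(\<Sum>b<n + m. g b) = (\<Sum>b<n. g b) + (\<Sum>b<m. g (n + b :: nat))"
  for g :: "nat \<Rightarrow> 'a::comm_monoid_add"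
  by (induction m) (auto simp: add.assoc)

text \<open>In degree \<open>i\<close> the cone is the sum of the \<open>i\<close>-th module of
  \<open>F\<close> and the \<open>(i-1)\<close>-st of \<open>H\<close>. The value 0 at
  \<open>i = 0\<close> is essential, as \<open>i - 1\<close> would truncate to 0 and select the
  module in degree 0 of \<open>H\<close>.\<close>

definition prev_rk :: "('v, 'k::field) resolution \<Rightarrow> nat \<Rightarrow> nat" where
  "prev_rk H i = (case i of 0 \<Rightarrow> 0 | Suc j \<Rightarrow> rk H j)"

lemma prev_rk_simps [simp]: "prev_rk H 0 = 0" "prev_rk H (Suc j) = rk H j"
  by (simp_all add: prev_rk_def)

text \<open>The mapping cone of \<open>x \<psi> : H \<rightarrow> F\<close>, with the shifts of \<open>H\<close> raised by \<open>e\<close>.\<close>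

definition cone :: "('v, 'k::field) resolution \<Rightarrow> ('v, 'k) resolution \<Rightarrow>
    (nat \<Rightarrow> nat \<Rightarrow> nat \<Rightarrow> ('v, 'k) mpoly) \<Rightarrow> ('v, 'k) mpoly \<Rightarrow> int \<Rightarrow> ('v, 'k) resolution" where
  "cone F H \<psi> x e = \<lparr>
     rk = (\<lambda>i. rk F i + prev_rk H i),
     shift = (\<lambda>i k. if k < rk F i then shift F i k else shift H (i - 1) (k - rk F i) + e),
     aug = (\<lambda>_. 1),
     dmat = (\<lambda>i a c. if c < rk F (Suc i) then (if a < rk F i then dmat F i a c else 0)
        else if a < rk F i then x * \<psi> i a (c - rk F (Suc i))
        else - dmat H (i - 1) (a - rk F i) (c - rk F (Suc i)))\<rparr>"

lemma rk_cone: "rk (cone F H \<psi> x e) i = rk F i + prev_rk H i"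
  by (simp add: cone_def)

lemma diff_map_cone:
  "diff_map (cone F H \<psi> x e) i (join_vec (rk F (Suc i)) f h) = join_vec (rk F i)
     (\<lambda>a. diff_map F i f a + x * mat_vec (rk F i) (rk H i) (\<psi> i) h a)
     (\<lambda>a. if i = 0 then 0 else - diff_map H (i - 1) h a)" (is "?l = ?r")
proof
  fix a
  show "?l a = ?r a"
  proof (cases "a < rk F i")
    case True
    then show ?thesis
      by (simp add: diff_map_def rk_cone join_vec_def sum_lessThan_add)
        (simp add: cone_def mat_vec_def sum_distrib_left mult.assoc)
  next
    case False
    then show ?thesis
      by (cases i) (auto simp: diff_map_def rk_cone join_vec_def sum_lessThan_add,
        auto simp: cone_def sum_negf)
  qed
qed

text \<open>The chain map \<open>x \<psi>\<close> lifts multiplication by \<open>x b\<close> from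
  \<open>S/L\<close> to \<open>S/I\<close>. The hypothesis \<open>colon\<close> makes that map
  injective, so the cone has homology only in degree 0, where it is the cokernel
  \<open>S/I'\<close>. Minimality rests on \<open>x\<close> having no constant term, whatever the
  entries of \<open>\<psi>\<close> are. The shift \<open>d + 1\<close> is the degree of
  \<open>x b\<close>.\<close>

lemma min_resolution_cone:
  fixes F H :: "('v, 'k::field) resolution"
  assumes F: "min_resolution V I F" and H: "min_resolution V L H"
    and \<psi>: "chain_map V H F d \<psi>" "\<psi> 0 0 0 = b"
    and x: "x \<in> poly_ring V" "homogeneous 1 x" "coef x 0 = 0"
    and colon: "\<And>p. p \<in> poly_ring V \<Longrightarrow> x * b * p \<in> I \<Longrightarrow> p \<in> L"
    and I': "\<And>p. p \<in> poly_ring V \<Longrightarrow> p \<in> I' \<longleftrightarrow> (\<exists>q\<in>poly_ring V. p - x * b * q \<in> I)"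
  shows "min_resolution V I' (cone F H \<psi> x (d + 1))"
proof -
  let ?C = "cone F H \<psi> x (d + 1)"
  have \<psi>0: "mat_vec (rk F 0) (rk H 0) (\<psi> 0) h = (\<lambda>a. if a = 0 then b * h 0 else 0)" for h
    using \<psi>(2) by (auto simp: mat_vec_def min_resolution_rk0[OF F] min_resolution_rk0[OF H] fun_eq_iff)
  have over: "mat_over V (rk ?C i) (rk ?C (Suc i)) (dmat ?C i)" for i
    using min_resolution_over[OF F, of i] min_resolution_over[OF H, of "i - 1"] chain_map_over[OF \<psi>(1), of i] x(1)
    by (cases i) (auto simp: mat_over_def cone_def poly_ring_mult poly_ring_uminus)
  have hom: "mat_homogeneous (rk ?C i) (rk ?C (Suc i)) (shift ?C i) (shift ?C (Suc i)) (dmat ?C i)" for i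
    unfolding mat_homogeneous_def
  proof (intro allI impI)
    fix a c assume ac: "a < rk ?C i" "c < rk ?C (Suc i)"
    show "homogeneous (shift ?C (Suc i) c - shift ?C i a) (dmat ?C i a c)"
    proof (cases "c < rk F (Suc i)")
      case True
      then show ?thesis using min_resolution_homogeneous[OF F, of i]
        by (auto simp: cone_def mat_homogeneous_def)
    next
      case c: False
      then obtain c' where c': "c = rk F (Suc i) + c'" by (metis add_diff_inverse_nat)
      with ac have c'': "c' < rk H i" by (simp add: rk_cone)
      show ?thesis
      proof (cases "a < rk F i")
        case True
        have "homogeneous (1 + (shift H i c' + d - shift F i a)) (x * \<psi> i a c')"
          using chain_map_homogeneous[OF \<psi>(1) True c''] x(2) by (rule homogeneous_mult[rotated])
        then show ?thesis using True c' by (simp add: cone_def algebra_simps)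
      next
        case False
        with ac obtain j where j: "i = Suc j" by (cases i) (auto simp: rk_cone)
        with False ac have "a - rk F i < rk H j" by (simp add: rk_cone)
        then have "homogeneous (shift H (Suc j) c' - shift H j (a - rk F i)) (dmat H j (a - rk F i) c')"
          using min_resolution_homogeneous[OF H, of j] c'' j by (simp add: mat_homogeneous_def)
        then show ?thesis using False c' j by (simp add: cone_def homogeneous_uminus)
      qed
    qed
  qed
  have minimal: "coef (dmat ?C i a c) 0 = 0" if "a < rk ?C i" "c < rk ?C (Suc i)" for i a c
    using that min_resolution_minimal[OF F, of a i c] x(3)
      min_resolution_minimal[OF H, of "a - rk F i" "i - 1" "c - rk F (Suc i)"]
    by (cases i) (auto simp: cone_def lookup_mult_zero)
  have exact0: "{v \<in> free_module V 1. v 0 \<in> I'} = diff_map ?C 0 ` free_module V (rk ?C 1)"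
  proof (intro equalityI subsetI)
    fix v assume v: "v \<in> {v \<in> free_module V 1. v 0 \<in> I'}"
    then have "v 0 \<in> poly_ring V" using free_module_poly_ring by blast
    with v I' obtain q where q: "q \<in> poly_ring V" "v 0 - x * b * q \<in> I" by blast
    have b: "b \<in> poly_ring V" using chain_map_over[OF \<psi>(1), of 0] \<psi>(2)
      by (simp add: mat_over_def min_resolution_rk0[OF F] min_resolution_rk0[OF H])
    let ?w = "\<lambda>k::nat. if k = 0 then v 0 - x * b * q else 0"
    have "?w \<in> free_module V 1"
      using \<open>v 0 \<in> poly_ring V\<close> x(1) b q(1)
      by (auto simp: free_module_def intro!: poly_ring_diff poly_ring_mult)
    then have "?w \<in> {v \<in> free_module V 1. v 0 \<in> I}" using q(2) by simp
    then obtain f where f: "f \<in> free_module V (rk F 1)" "?w = diff_map F 0 f"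
      unfolding min_resolution_exact0[OF F] by blast
    let ?h = "\<lambda>k::nat. if k = 0 then q else 0"
    have h: "?h \<in> free_module V (rk H 0)" using q(1) by (simp add: free_module_def min_resolution_rk0[OF H])
    have "diff_map ?C 0 (join_vec (rk F (Suc 0)) f ?h) = v"
      unfolding diff_map_cone \<psi>0 f(2)[symmetric] using v
      by (auto simp: join_vec_def fun_eq_iff min_resolution_rk0[OF F] free_module_def algebra_simps)
    moreover have "join_vec (rk F (Suc 0)) f ?h \<in> free_module V (rk ?C 1)"
      using join_vec_free_module[OF f(1) h] by (simp add: rk_cone)
    ultimately show "v \<in> diff_map ?C 0 ` free_module V (rk ?C 1)" by blast
  next
    fix v assume "v \<in> diff_map ?C 0 ` free_module V (rk ?C 1)"
    then obtain f h where f: "f \<in> free_module V (rk F 1)" and h: "h \<in> free_module V (rk H 0)"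
      and v: "v = diff_map ?C 0 (join_vec (rk F 1) f h)"
      by (auto simp: rk_cone elim!: free_module_splitE)
    have "v 0 - x * b * h 0 = diff_map F 0 f 0"
      unfolding v One_nat_def diff_map_cone \<psi>0
      by (simp add: join_vec_def min_resolution_rk0[OF F] algebra_simps)
    then have "v 0 - x * b * h 0 \<in> I" using diff_map_0_ideal[OF F f] by simp
    moreover have "v \<in> free_module V 1"
      using v over[of 0] join_vec_free_module[OF f h]
      by (simp add: diff_map_mat_vec rk_cone min_resolution_rk0[OF F])
        (metis One_nat_def mat_vec_free_module)
    ultimately show "v \<in> {v \<in> free_module V 1. v 0 \<in> I'}"
      using I' free_module_poly_ring[OF h] free_module_poly_ring by blast
  qed
  have exact: "{v \<in> free_module V (rk ?C (Suc i)). diff_map ?C i v = (\<lambda>_. 0)} =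
       diff_map ?C (Suc i) ` free_module V (rk ?C (Suc (Suc i)))" for i
  proof (intro equalityI subsetI)
    fix v assume v: "v \<in> {v \<in> free_module V (rk ?C (Suc i)). diff_map ?C i v = (\<lambda>_. 0)}"
    then obtain f h where f: "f \<in> free_module V (rk F (Suc i))" and h: "h \<in> free_module V (rk H i)"
      and v_eq: "v = join_vec (rk F (Suc i)) f h"
      by (auto simp: rk_cone elim!: free_module_splitE)
    have z: "join_vec (rk F i) (\<lambda>a. diff_map F i f a + x * mat_vec (rk F i) (rk H i) (\<psi> i) h a)
     (\<lambda>a. if i = 0 then 0 else - diff_map H (i - 1) h a) = (\<lambda>_. 0)"
      using v unfolding v_eq mem_Collect_eq diff_map_cone by blast
    have z1: "diff_map F i f a + x * mat_vec (rk F i) (rk H i) (\<psi> i) h a = 0" for a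
      using join_vec_eq_zeroD(1)[OF z, of a] by (cases "a < rk F i") (auto simp: diff_map_def mat_vec_def)
    \<comment> \<open>For positive \<open>i\<close> the second component of the cycle is itself a
      cycle of \<open>H\<close>. For \<open>i = 0\<close> there is no such equation; instead the
      first component puts \<open>x b h 0\<close> into \<open>I\<close>, and the colon condition
      puts \<open>h 0\<close> into \<open>L\<close>.\<close>
    have "h \<in> diff_map H i ` free_module V (rk H (Suc i))"
    proof (cases i)
      case 0
      have "x * b * h 0 = - diff_map F 0 f 0"
        using z1[of 0] 0 by (simp add: \<psi>0 eq_neg_iff_add_eq_0 add.commute mult.assoc)
      also have "\<dots> = diff_map F 0 (\<lambda>k. - f k) 0"
        by (simp add: diff_map_mat_vec mat_vec_uminus)
      also have "\<dots> \<in> I" using diff_map_0_ideal[OF F free_module_uminus] f 0 by simp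
      finally have "h 0 \<in> L" using colon free_module_poly_ring[OF h] by blast
      then have "h \<in> {v \<in> free_module V 1. v 0 \<in> L}" using h 0 by (simp add: min_resolution_rk0[OF H])
      then show ?thesis unfolding min_resolution_exact0[OF H] using 0 by simp
    next
      case (Suc j)
      then have "h \<in> {v \<in> free_module V (rk H (Suc j)). diff_map H j v = (\<lambda>_. 0)}"
        using join_vec_eq_zeroD(2)[OF z] h by (auto simp: fun_eq_iff)
      then show ?thesis unfolding min_resolution_exact[OF H] using Suc by simp
    qed
    then obtain h' where h': "h' \<in> free_module V (rk H (Suc i))" "h = diff_map H i h'" by blast
    let ?p = "mat_vec (rk F (Suc i)) (rk H (Suc i)) (\<psi> (Suc i))"
    \<comment> \<open>From \<open>d f + x \<psi> h = 0\<close> and \<open>h = d h'\<close>, the sum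
      \<open>f + x \<psi> h'\<close> is a cycle of \<open>F\<close>, hence a boundary
      \<open>d f'\<close>.\<close>
    let ?u = "\<lambda>k. f k + x * ?p h' k"
    have "diff_map F i ?u = (\<lambda>k. diff_map F i f k + x * diff_map F i (?p h') k)"
      unfolding diff_map_mat_vec mat_vec_add mat_vec_scale ..
    also have "\<dots> = (\<lambda>_. 0)" unfolding chain_map_commute[OF \<psi>(1) h'(1)] h'(2)[symmetric] z1 ..
    finally have "diff_map F i ?u = (\<lambda>_. 0)" .
    moreover have "?u \<in> free_module V (rk F (Suc i))"
      using mat_vec_free_module[OF chain_map_over[OF \<psi>(1)] h'(1)]
      by (intro free_module_add free_module_scale f x(1))
    ultimately have "?u \<in> {v \<in> free_module V (rk F (Suc i)). diff_map F i v = (\<lambda>_. 0)}" by simp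
    then obtain f' where f': "f' \<in> free_module V (rk F (Suc (Suc i)))" "?u = diff_map F (Suc i) f'"
      unfolding min_resolution_exact[OF F] by blast
    \<comment> \<open>The cone has differential \<open>- d\<close> on \<open>H\<close>, so
      \<open>- h'\<close> is mapped to \<open>h\<close>. The same sign removes the correction
      \<open>x \<psi> h'\<close> from the first component.\<close>
    let ?h = "\<lambda>k. - h' k"
    have "diff_map ?C (Suc i) (join_vec (rk F (Suc (Suc i))) f' ?h) = v"
      unfolding diff_map_cone v_eq f'(2)[symmetric] h'(2)
      by (simp add: mat_vec_uminus diff_map_mat_vec)
    moreover have "join_vec (rk F (Suc (Suc i))) f' ?h \<in> free_module V (rk ?C (Suc (Suc i)))"
      using join_vec_free_module[OF f'(1) free_module_uminus[OF h'(1)]] by (simp add: rk_cone)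
    ultimately show "v \<in> diff_map ?C (Suc i) ` free_module V (rk ?C (Suc (Suc i)))" by blast
  next
    fix v assume "v \<in> diff_map ?C (Suc i) ` free_module V (rk ?C (Suc (Suc i)))"
    then obtain w where w: "w \<in> free_module V (rk ?C (Suc (Suc i)))" "v = diff_map ?C (Suc i) w" by blast
    then obtain f h where f: "f \<in> free_module V (rk F (Suc (Suc i)))" and h: "h \<in> free_module V (rk H (Suc i))"
      and w_eq: "w = join_vec (rk F (Suc (Suc i))) f h"
      by (auto simp: rk_cone elim!: free_module_splitE)
    have "v \<in> free_module V (rk ?C (Suc i))"
      unfolding w(2) diff_map_mat_vec by (rule mat_vec_free_module[OF over w(1)])
    moreover have "diff_map ?C i v = (\<lambda>_. 0)"
    proof -
      let ?p = "mat_vec (rk F (Suc i)) (rk H (Suc i)) (\<psi> (Suc i))"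
      let ?f = "\<lambda>k. diff_map F (Suc i) f k + x * ?p h k" and ?h = "\<lambda>k. - diff_map H i h k"
      have v_eq: "v = join_vec (rk F (Suc i)) ?f ?h" unfolding w(2) w_eq diff_map_cone by simp
      have "diff_map F i ?f = (\<lambda>k. diff_map F i (diff_map F (Suc i) f) k + x * diff_map F i (?p h) k)"
        unfolding diff_map_mat_vec mat_vec_add mat_vec_scale ..
      then have dF: "diff_map F i ?f = (\<lambda>k. x * mat_vec (rk F i) (rk H i) (\<psi> i) (diff_map H i h) k)"
        using diff_map_diff_map[OF F f] chain_map_commute[OF \<psi>(1) h] by simp
      have "diff_map H j (\<lambda>k. - diff_map H i h k) = (\<lambda>_. 0)" if "i = Suc j" for j
        using diff_map_diff_map[OF H, of h j] h that by (simp add: diff_map_mat_vec mat_vec_uminus)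
      then show ?thesis
        unfolding v_eq diff_map_cone dF mat_vec_uminus by (cases i) (auto simp: join_vec_def fun_eq_iff)
    qed
    ultimately show "v \<in> {v \<in> free_module V (rk ?C (Suc i)). diff_map ?C i v = (\<lambda>_. 0)}" by simp
  qed
  have "rk ?C 0 = 1" "shift ?C 0 0 = 0"
    by (simp_all add: cone_def min_resolution_rk0[OF F] min_resolution_shift0[OF F])
  then show ?thesis
    using over hom minimal exact0 exact unfolding min_resolution_def by blast
qed

lemma graded_rank_cone:
  "graded_rank (cone F H \<psi> x e) i d =
     graded_rank F i d + (case i of 0 \<Rightarrow> 0 | Suc j \<Rightarrow> graded_rank H j (d - e))"
proof -
  let ?C = "cone F H \<psi> x e"
  let ?A = "{k. k < rk F i \<and> shift F i k = d}"
    and ?B = "{k. k < prev_rk H i \<and> shift H (i - 1) k = d - e}"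
  have "{k. k < rk ?C i \<and> shift ?C i k = d} = ?A \<union> (+) (rk F i) ` ?B"
  proof (intro equalityI subsetI)
    fix k assume k: "k \<in> {k. k < rk ?C i \<and> shift ?C i k = d}"
    show "k \<in> ?A \<union> (+) (rk F i) ` ?B"
    proof (cases "k < rk F i")
      case True
      then show ?thesis using k by (simp add: cone_def)
    next
      case False
      then have "k = rk F i + (k - rk F i)" "k - rk F i \<in> ?B" using k by (auto simp: cone_def)
      then show ?thesis by blast
    qed
  qed (auto simp: cone_def)
  moreover have "card (?A \<union> (+) (rk F i) ` ?B) = card ?A + card ((+) (rk F i) ` ?B)"
    by (rule card_Un_disjoint) auto
  moreover have "card ((+) (rk F i) ` ?B) = card ?B" by (rule card_image) simp
  ultimately show ?thesis by (cases i) (simp_all add: graded_rank_def)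
qed

text \<open>Bundles the existence of a resolution with its table of ranks, so that tables can be
  computed recursively and compared with \<open>betti\<close> once at the end.\<close>

definition has_betti :: "'v set \<Rightarrow> ('v, 'k::field) mpoly set \<Rightarrow> (nat \<Rightarrow> int \<Rightarrow> nat) \<Rightarrow> bool" where
  "has_betti V I c \<longleftrightarrow> (\<exists>F. min_resolution V I F \<and> (\<forall>i d. graded_rank F i d = c i d))"

lemma has_betti_zero:
  "has_betti V (monomial_ideal V (\<lambda>_. False) :: ('v, 'k::field) mpoly set)
    (\<lambda>i d. if i = 0 \<and> d = 0 then 1 else 0)"
proof -
  define F :: "('v, 'k) resolution" where
    "F = \<lparr>rk = (\<lambda>i. if i = 0 then 1 else 0), shift = (\<lambda>_ _. 0), aug = (\<lambda>_. 1), dmat = (\<lambda>_ _ _. 0)\<rparr>"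
  have rk: "rk F i = (if i = 0 then 1 else 0)" for i by (simp add: F_def)
  have fm: "free_module V 0 = {\<lambda>_. 0 :: ('v, 'k) mpoly}" by (auto simp: free_module_def)
  have "{v \<in> free_module V 1. v 0 \<in> (monomial_ideal V (\<lambda>_. False) :: ('v, 'k) mpoly set)} = {\<lambda>_. 0}"
    by (auto simp: free_module_def monomial_ideal_def fun_eq_iff not_less_eq_eq Suc_le_eq)
      (metis keys_eq_empty gr0I)
  then have "min_resolution V (monomial_ideal V (\<lambda>_. False)) F"
    by (auto simp: min_resolution_def rk fm mat_over_def mat_homogeneous_def diff_map_def fun_eq_iff)
      (simp_all add: F_def)
  moreover have "graded_rank F i d = (if i = 0 \<and> d = 0 then 1 else 0)" for i d
    by (auto simp: graded_rank_def F_def)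
  ultimately show ?thesis unfolding has_betti_def by blast
qed

text \<open>One new squarefree generator, \<open>x\<close> times the product of \<open>B\<close>.
  The condition \<open>colon\<close> identifies its colon ideal. By \<open>QB\<close> the product of
  \<open>B\<close> alone already multiplies that colon ideal into the old ideal, which is what
  allows \<open>x\<close> to be split off the comparison map.\<close>

lemma has_betti_cone:
  assumes I: "has_betti V (monomial_ideal V P :: ('v, 'k::field) mpoly set) c"
    and L: "has_betti V (monomial_ideal V Q :: ('v, 'k) mpoly set) c'"
    and P: "mono P" and B: "finite B" "B \<subseteq> V" and x: "x \<in> V" "x \<notin> B"
    and colon: "\<And>X. Q X \<longleftrightarrow> P (X \<union> insert x B)" and QB: "\<And>X. Q X \<Longrightarrow> P (X \<union> B)"
  shows "has_betti V (monomial_ideal V (\<lambda>X. P X \<or> insert x B \<subseteq> X) :: ('v, 'k) mpoly set)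
    (\<lambda>i d. c i d + (case i of 0 \<Rightarrow> 0 | Suc j \<Rightarrow> c' j (d - (int (card B) + 1))))"
proof -
  obtain F :: "('v, 'k) resolution" where F: "min_resolution V (monomial_ideal V P) F" "\<And>i d. graded_rank F i d = c i d"
    using I by (auto simp: has_betti_def)
  obtain H :: "('v, 'k) resolution" where H: "min_resolution V (monomial_ideal V Q) H" "\<And>i d. graded_rank H i d = c' i d"
    using L by (auto simp: has_betti_def)
  let ?b = "Poly_Mapping.single (set_monom B) 1 :: ('v, 'k) mpoly"
  let ?x = "Poly_Mapping.single (Poly_Mapping.single x 1) 1 :: ('v, 'k) mpoly"
  have b: "?b \<in> poly_ring V" "homogeneous (int (card B)) ?b"
    using B by (simp_all add: poly_ring_single keys_set_monom homogeneous_def mono_deg_set_monom)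
  have xb: "?x * ?b = Poly_Mapping.single (set_monom (insert x B)) 1"
    using B x by (simp add: mult_single set_monom_insert)
  have bL: "?b * p \<in> monomial_ideal V P" if "p \<in> monomial_ideal V Q" for p
  proof (subst single_mult_in_monomial_ideal_iff)
    show "p \<in> poly_ring V" "exps (set_monom B) \<subseteq> V" "p \<in> monomial_ideal V (\<lambda>X. P (X \<union> exps (set_monom B)))"
      using that QB B by (auto simp: monomial_ideal_def keys_set_monom)
  qed
  obtain \<psi> where \<psi>: "chain_map V H F (int (card B)) \<psi>" "\<psi> 0 0 0 = ?b"
    using comparison_map[OF H(1) F(1) b bL] by blast
  have "min_resolution V (monomial_ideal V (\<lambda>X. P X \<or> insert x B \<subseteq> X)) (cone F H \<psi> ?x (int (card B) + 1))"
  proof (rule min_resolution_cone[OF F(1) H(1) \<psi>])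
    have "Poly_Mapping.single x 1 \<noteq> (0 :: 'v \<Rightarrow>\<^sub>0 nat)"
      by (metis lookup_single_eq lookup_zero zero_neq_one)
    then show "?x \<in> poly_ring V" "homogeneous 1 ?x" "coef ?x 0 = 0"
      using x by (auto simp: poly_ring_single homogeneous_def mono_deg_def lookup_single when_def)
    show "p \<in> monomial_ideal V Q" if "p \<in> poly_ring V" "?x * ?b * p \<in> monomial_ideal V P" for p
      using that B x unfolding xb
      by (subst (asm) single_mult_in_monomial_ideal_iff) (auto simp: keys_set_monom monomial_ideal_def colon)
    show "p \<in> monomial_ideal V (\<lambda>X. P X \<or> insert x B \<subseteq> X) \<longleftrightarrow>
        (\<exists>q\<in>poly_ring V. p - ?x * ?b * q \<in> monomial_ideal V P)" for p
      unfolding xb using B x by (intro monomial_ideal_disj P) auto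
  qed
  then show ?thesis unfolding has_betti_def
    by (intro exI conjI allI) (auto simp: graded_rank_cone F H split: nat.split)
qed

section \<open>Adding a simplicial vertex to an edge ideal\<close>

lemma ideal_generated_add:
  fixes p q :: "('v, 'k::field) mpoly"
  assumes "p \<in> ideal_generated V X" "q \<in> ideal_generated V X"
  shows "p + q \<in> ideal_generated V X"
proof -
  obtain A a where A: "finite A" "A \<subseteq> X" "a ` A \<subseteq> poly_ring V" "p = (\<Sum>g\<in>A. a g * g)"
    using assms(1) by (auto simp: ideal_generated_def)
  obtain B b where B: "finite B" "B \<subseteq> X" "b ` B \<subseteq> poly_ring V" "q = (\<Sum>g\<in>B. b g * g)"
    using assms(2) by (auto simp: ideal_generated_def)
  define c where "c = (\<lambda>g. (if g \<in> A then a g else 0) + (if g \<in> B then b g else 0))"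
  have "p = (\<Sum>g\<in>A \<union> B. (if g \<in> A then a g else 0) * g)" "q = (\<Sum>g\<in>A \<union> B. (if g \<in> B then b g else 0) * g)"
    unfolding A(4) B(4) using A(1) B(1) by (auto intro!: sum.mono_neutral_cong_left)
  then have "p + q = (\<Sum>g\<in>A \<union> B. c g * g)"
    by (simp add: c_def distrib_right sum.distrib)
  moreover have "c ` (A \<union> B) \<subseteq> poly_ring V" using A(3) B(3) by (auto simp: c_def image_subset_iff intro!: poly_ring_add)
  moreover have "finite (A \<union> B)" "A \<union> B \<subseteq> X" using A B by auto
  ultimately show ?thesis unfolding ideal_generated_def by blast
qed

lemma ideal_generated_zero: "0 \<in> ideal_generated V X"
  unfolding ideal_generated_def by (intro CollectI exI[of _ "{}"]) simp

lemma ideal_generated_sum: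
  "(\<And>a. a \<in> A \<Longrightarrow> f a \<in> ideal_generated V X) \<Longrightarrow> sum f A \<in> ideal_generated V X"
  by (induction A rule: infinite_finite_induct) (simp_all add: ideal_generated_zero ideal_generated_add)

lemma ideal_generated_mult:
  assumes "g \<in> X" "p \<in> poly_ring V"
  shows "p * g \<in> ideal_generated V X"
proof -
  have "p * g = (\<Sum>h\<in>{g}. (\<lambda>_. p) h * h)" by simp
  then show ?thesis unfolding ideal_generated_def using assms
    by (intro CollectI exI[of _ "{g}"] exI[of _ "\<lambda>_. p"]) auto
qed

text \<open>The predicate of the edge ideal of the subgraph induced on \<open>W\<close>, extended to
  the full ring: variables outside \<open>W\<close> occur freely.\<close>

definition edge_within :: "'v ugraph \<Rightarrow> 'v set \<Rightarrow> 'v set \<Rightarrow> bool" where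
  "edge_within G W X \<longleftrightarrow> (\<exists>x\<in>W \<inter> X. \<exists>y\<in>W \<inter> X. {x, y} \<in> edges G)"

lemma mono_edge_within: "mono (edge_within G W)"
  by (intro monoI) (auto simp: edge_within_def)

lemma edge_doubleton:
  assumes "finite_simple_graph G" "{x, y} \<in> edges G"
  shows "x \<noteq> y" "x \<in> verts G" "y \<in> verts G"
proof -
  have "card {x, y} = 2" "{x, y} \<subseteq> verts G" using assms unfolding finite_simple_graph_def by blast+
  then show "x \<noteq> y" "x \<in> verts G" "y \<in> verts G" by auto
qed

text \<open>A monomial whose support contains an edge is a multiple of that edge's generator, so the
  ideal is spanned by such monomials.\<close>

lemma edge_ideal_eq_monomial_ideal:
  assumes G: "finite_simple_graph G"
  shows "(edge_ideal G :: ('v, 'k::field) mpoly set) = monomial_ideal (verts G) (edge_within G (verts G))"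
proof (intro equalityI subsetI)
  let ?X = "{var x * var y | x y. {x, y} \<in> edges G} :: ('v, 'k) mpoly set"
  have var: "var x * var y = (Poly_Mapping.single (set_monom {x, y}) 1 :: ('v, 'k) mpoly)"
    if "{x, y} \<in> edges G" for x y
    using edge_doubleton(1)[OF G that] by (simp add: var_def mult_single set_monom_insert) (simp add: set_monom_def)
  {
    fix p :: "('v, 'k) mpoly" assume "p \<in> edge_ideal G"
    then obtain A c where A: "A \<subseteq> ?X" "c ` A \<subseteq> poly_ring (verts G)" "p = (\<Sum>g\<in>A. c g * g)"
      unfolding edge_ideal_def ideal_generated_def by blast
    have gX: "g \<in> monomial_ideal (verts G) (edge_within G (verts G))" if "g \<in> ?X" for g
    proof -
      obtain x y where "{x, y} \<in> edges G" "g = var x * var y" using \<open>g \<in> ?X\<close> by blast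
      then show ?thesis using edge_doubleton[OF G, of x y] var[of x y]
        by (auto simp: monomial_ideal_def edge_within_def keys_set_monom poly_ring_single)
    qed
    have "c g * g \<in> monomial_ideal (verts G) (edge_within G (verts G))" if "g \<in> A" for g
      using that A by (intro monomial_ideal_mult mono_edge_within gX) blast+
    then show "p \<in> monomial_ideal (verts G) (edge_within G (verts G))"
      unfolding A(3) by (rule monomial_ideal_sum)
  next
    fix p :: "('v, 'k) mpoly" assume p: "p \<in> monomial_ideal (verts G) (edge_within G (verts G))"
    have "Poly_Mapping.single m (coef p m) \<in> edge_ideal G" if m: "m \<in> exps p" for m
    proof -
      obtain x y where xy: "{x, y} \<in> edges G" "{x, y} \<subseteq> exps m"
        using p m unfolding monomial_ideal_def edge_within_def by blast
      obtain n where n: "m = set_monom {x, y} + n" using set_monom_decompose[of "{x, y}" m] xy(2) by blast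
      have "exps m \<subseteq> verts G" using p m by (auto simp: monomial_ideal_def poly_ring_def)
      then have "Poly_Mapping.single n (coef p m) \<in> poly_ring (verts G)"
        by (auto simp: n keys_add_nat intro: poly_ring_single)
      moreover have "Poly_Mapping.single m (coef p m) = Poly_Mapping.single n (coef p m) * (var x * var y)"
        unfolding var[OF xy(1)] by (simp add: mult_single n add.commute)
      ultimately show ?thesis
        unfolding edge_ideal_def using xy(1) by (auto intro!: ideal_generated_mult)
    qed
    then have "(\<Sum>m\<in>exps p. Poly_Mapping.single m (coef p m)) \<in> edge_ideal G"
      unfolding edge_ideal_def by (rule ideal_generated_sum)
    then show "p \<in> edge_ideal G" by (simp flip: poly_eq_sum_single)
  }
qed

text \<open>A variable on which \<open>P\<close> does not depend is a nonzerodivisor modulo the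
  ideal, so the colon is the ideal itself and the cone is taken with \<open>B = {}\<close> over two
  copies of one resolution. The result is the tensor product with the Koszul complex on
  \<open>X\<close>, whose basis is indexed by the subsets \<open>T\<close>.\<close>

lemma has_betti_koszul:
  fixes X :: "'v set"
  assumes "finite X" "X \<subseteq> V" "mono P" "\<And>x Y. x \<in> X \<Longrightarrow> P (insert x Y) \<longleftrightarrow> P Y"
    and P: "has_betti V (monomial_ideal V P :: ('v, 'k::field) mpoly set) c"
  shows "has_betti V (monomial_ideal V (\<lambda>Y. P Y \<or> X \<inter> Y \<noteq> {}) :: ('v, 'k) mpoly set)
    (\<lambda>i d. \<Sum>T\<in>Pow X. if card T \<le> i then c (i - card T) (d - int (card T)) else 0)"
  using assms(1,2,4)
proof (induction X)
  case empty
  then show ?case using P by simp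
next
  case (insert x X)
  let ?P = "\<lambda>Y. P Y \<or> X \<inter> Y \<noteq> {}"
  let ?c = "\<lambda>i d. \<Sum>T\<in>Pow X. if card T \<le> i then c (i - card T) (d - int (card T)) else 0"
  have IH: "has_betti V (monomial_ideal V ?P :: ('v, 'k) mpoly set) ?c"
    using insert by blast
  have "has_betti V (monomial_ideal V (\<lambda>Y. ?P Y \<or> insert x {} \<subseteq> Y) :: ('v, 'k) mpoly set)
    (\<lambda>i d. ?c i d + (case i of 0 \<Rightarrow> 0 | Suc j \<Rightarrow> ?c j (d - (int (card ({} :: 'v set)) + 1))))"
  proof (rule has_betti_cone[OF IH IH])
    show "mono ?P" using monoD[OF \<open>mono P\<close>] by (intro monoI) auto
    show "?P Y \<longleftrightarrow> ?P (Y \<union> insert x {})" for Y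
      using insert.prems(2)[of x Y] insert.hyps by auto
  qed (use insert in auto)
  moreover have "(\<lambda>Y. ?P Y \<or> insert x {} \<subseteq> Y) = (\<lambda>Y. P Y \<or> insert x X \<inter> Y \<noteq> {})" by auto
  moreover have "?c i d + (case i of 0 \<Rightarrow> 0 | Suc j \<Rightarrow> ?c j (d - (int (card ({} :: 'v set)) + 1))) =
    (\<Sum>T\<in>Pow (insert x X). if card T \<le> i then c (i - card T) (d - int (card T)) else 0)" for i d
  proof -
    have inj: "inj_on (insert x) (Pow X)" using insert.hyps by (auto simp: inj_on_def)
    have "(\<Sum>T\<in>Pow (insert x X). if card T \<le> i then c (i - card T) (d - int (card T)) else 0) =
      ?c i d + (\<Sum>T\<in>insert x ` Pow X. if card T \<le> i then c (i - card T) (d - int (card T)) else 0)"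
      unfolding Pow_insert using insert.hyps by (intro sum.union_disjoint) auto
    also have "(\<Sum>T\<in>insert x ` Pow X. if card T \<le> i then c (i - card T) (d - int (card T)) else 0) =
      (\<Sum>T\<in>Pow X. if Suc (card T) \<le> i then c (i - Suc (card T)) (d - int (Suc (card T))) else 0)"
    proof -
      have "card (insert x T) = Suc (card T)" if "T \<in> Pow X" for T
        using that insert.hyps by (intro card_insert_disjoint) (auto intro: finite_subset)
      then show ?thesis unfolding sum.reindex[OF inj] by (intro sum.cong) simp_all
    qed
    also have "\<dots> = (case i of 0 \<Rightarrow> 0 | Suc j \<Rightarrow> ?c j (d - (int (card ({} :: 'v set)) + 1)))"
      by (cases i) (auto simp: algebra_simps intro!: sum.cong)
    finally show ?thesis by simp
  qed
  ultimately show ?case by simp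
qed

section \<open>Neighbourhoods and simplicial vertices\<close>

definition nbhd :: "'v ugraph \<Rightarrow> 'v set \<Rightarrow> 'v \<Rightarrow> 'v set" where
  "nbhd G W x = {y \<in> W. {x, y} \<in> edges G}"

lemma in_nbhd: "y \<in> nbhd G W x \<longleftrightarrow> y \<in> W \<and> {x, y} \<in> edges G"
  by (simp add: nbhd_def)

definition simplicial :: "'v ugraph \<Rightarrow> 'v set \<Rightarrow> 'v \<Rightarrow> bool" where
  "simplicial G W v \<longleftrightarrow> v \<in> W \<and> (\<forall>x\<in>nbhd G W v. \<forall>y\<in>nbhd G W v. x \<noteq> y \<longrightarrow> {x, y} \<in> edges G)"

lemma simplicialD:
  "simplicial G W v \<Longrightarrow> x \<in> nbhd G W v \<Longrightarrow> y \<in> nbhd G W v \<Longrightarrow> x \<noteq> y \<Longrightarrow> {x, y} \<in> edges G"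
  by (simp add: simplicial_def)

text \<open>The colon predicate \<open>?Q u\<close> does not mention the generators
  \<open>v u'\<close> adjoined earlier, so the neighbours of \<open>v\<close> may be processed in
  any order, by induction over subsets of \<open>nbhd G W v\<close>. The 2 in the degree is that of
  \<open>v u\<close>, and \<open>T\<close> indexes the Koszul part.\<close>

lemma has_betti_simplicial:
  fixes G :: "'v ugraph"
  assumes G: "finite_simple_graph G" and W: "W \<subseteq> verts G" and v: "simplicial G W v"
    and c: "has_betti (verts G) (monomial_ideal (verts G) (edge_within G (W - {v})) :: ('v, 'k::field) mpoly set) c"
    and c': "\<And>u. u \<in> nbhd G W v \<Longrightarrow> has_betti (verts G)
      (monomial_ideal (verts G) (edge_within G (W - insert u (nbhd G W u))) :: ('v, 'k) mpoly set) (c' u)"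
  shows "has_betti (verts G) (monomial_ideal (verts G) (edge_within G W) :: ('v, 'k) mpoly set)
    (\<lambda>i d. c i d + (\<Sum>u\<in>nbhd G W v. case i of 0 \<Rightarrow> 0 | Suc j \<Rightarrow>
      (\<Sum>T\<in>Pow (nbhd G W u - {v}). if card T \<le> j then c' u (j - card T) (d - 2 - int (card T)) else 0)))"
proof -
  let ?V = "verts G"
  let ?Q = "\<lambda>u X. edge_within G (W - insert u (nbhd G W u)) X \<or> (nbhd G W u - {v}) \<inter> X \<noteq> {}"
  let ?e = "\<lambda>u j d. \<Sum>T\<in>Pow (nbhd G W u - {v}). if card T \<le> j then c' u (j - card T) (d - int (card T)) else 0"
  have finW: "finite W" using G W by (auto simp: finite_simple_graph_def intro: finite_subset)
  have sym: "{a, b} \<in> edges G \<longleftrightarrow> {b, a} \<in> edges G" for a b by (simp add: insert_commute)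
  have vW: "v \<in> W" using v by (simp add: simplicial_def)
  have Q: "has_betti ?V (monomial_ideal ?V (?Q u) :: ('v, 'k) mpoly set) (?e u)" if u: "u \<in> nbhd G W v" for u
  proof (rule has_betti_koszul[OF _ _ mono_edge_within _ c'[OF u]])
    show "finite (nbhd G W u - {v})" "nbhd G W u - {v} \<subseteq> ?V" using finW W by (auto simp: nbhd_def)
  qed (auto simp: edge_within_def)
  have nbrs: "has_betti ?V (monomial_ideal ?V (\<lambda>X. edge_within G (W - {v}) X \<or> (\<exists>u\<in>U. {v, u} \<subseteq> X)) :: ('v, 'k) mpoly set)
     (\<lambda>i d. c i d + (\<Sum>u\<in>U. case i of 0 \<Rightarrow> 0 | Suc j \<Rightarrow> ?e u j (d - 2)))"
    if "finite U" "U \<subseteq> nbhd G W v" for U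
    using that
  proof (induction U)
    case empty
    then show ?case using c by simp
  next
    case (insert u U)
    let ?P = "\<lambda>X. edge_within G (W - {v}) X \<or> (\<exists>u\<in>U. {v, u} \<subseteq> X)"
    let ?d = "\<lambda>i d. c i d + (\<Sum>u\<in>U. case i of 0 \<Rightarrow> 0 | Suc j \<Rightarrow> ?e u j (d - 2))"
    have IH: "has_betti ?V (monomial_ideal ?V ?P :: ('v, 'k) mpoly set) ?d" using insert by blast
    have u: "u \<in> nbhd G W v" using insert.prems by blast
    have vu: "{v, u} \<in> edges G" "u \<in> W" using u by (auto simp: nbhd_def)
    have ne: "u \<noteq> v" using edge_doubleton(1)[OF G vu(1)] by blast
    have QB: "edge_within G (W - {v}) (X \<union> {u})" if "?Q u X" for X
      using that
    proof
      assume "edge_within G (W - insert u (nbhd G W u)) X"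
      moreover have "v \<in> nbhd G W u" using vu vW sym[of v u] by (simp add: in_nbhd)
      ultimately show ?thesis unfolding edge_within_def by blast
    next
      assume "(nbhd G W u - {v}) \<inter> X \<noteq> {}"
      then obtain y where "y \<in> W" "{u, y} \<in> edges G" "y \<noteq> v" "y \<in> X"
        unfolding nbhd_def by blast
      then show ?thesis using vu ne unfolding edge_within_def by blast
    qed
    have colon: "?Q u X \<longleftrightarrow> ?P (X \<union> insert v {u})" for X
    proof
      assume "?Q u X"
      then have "edge_within G (W - {v}) (X \<union> {u})" by (rule QB)
      moreover have "X \<union> {u} \<subseteq> X \<union> insert v {u}" by blast
      ultimately have "edge_within G (W - {v}) (X \<union> insert v {u})"
        using monoD[OF mono_edge_within] by (metis le_boolD)
      then show "?P (X \<union> insert v {u})" ..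
    next
      assume "?P (X \<union> insert v {u})"
      then show "?Q u X"
      proof
        assume "edge_within G (W - {v}) (X \<union> insert v {u})"
        then obtain a b where ab: "a \<in> W - {v}" "b \<in> W - {v}" "a \<in> insert u X" "b \<in> insert u X" "{a, b} \<in> edges G"
          unfolding edge_within_def by blast
        show ?thesis
        proof (cases "a \<in> insert u (nbhd G W u) \<or> b \<in> insert u (nbhd G W u)")
          case True
          have "u \<notin> nbhd G W u" using edge_doubleton(1)[OF G, of u u] by (auto simp: in_nbhd)
          moreover have "a \<noteq> b" using edge_doubleton(1)[OF G ab(5)] .
          moreover have "b \<in> nbhd G W u" if "a = u" using ab that by (simp add: in_nbhd)
          moreover have "a \<in> nbhd G W u" if "b = u" using ab that sym[of a b] by (simp add: in_nbhd)
          ultimately have "\<exists>y\<in>X. y \<in> nbhd G W u - {v}" using True ab by blast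
          then show ?thesis by blast
        next
          case False
          with ab have "a \<in> (W - insert u (nbhd G W u)) \<inter> X" "b \<in> (W - insert u (nbhd G W u)) \<inter> X" by blast+
          with ab(5) have "edge_within G (W - insert u (nbhd G W u)) X"
            unfolding edge_within_def by blast
          then show ?thesis ..
        qed
      next
        \<comment> \<open>An earlier generator \<open>v u'\<close> contributes the variable
          \<open>u'\<close> to the colon ideal. The neighbours of \<open>v\<close> form a clique, so
          \<open>u'\<close> is among the variables from \<open>nbhd G W u - {v}\<close>
          already.\<close>
        assume "\<exists>u'\<in>U. {v, u'} \<subseteq> X \<union> insert v {u}"
        then obtain u' where u': "u' \<in> U" "u' \<in> X \<union> {v, u}" by blast
        then have "u' \<in> nbhd G W v" "u' \<noteq> u" using insert.prems(1) insert.hyps(2) by blast+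
        then have "{u, u'} \<in> edges G" using simplicialD[OF v u] by blast
        moreover have "u' \<noteq> v" using \<open>u' \<in> nbhd G W v\<close> edge_doubleton(1)[OF G, of v u'] by (simp add: in_nbhd)
        moreover have "u' \<in> W" using \<open>u' \<in> nbhd G W v\<close> by (simp add: in_nbhd)
        ultimately have "u' \<in> (nbhd G W u - {v}) \<inter> X"
          using u'(2) \<open>u' \<noteq> u\<close> by (simp add: in_nbhd)
        then show ?thesis by blast
      qed
    qed
    have betti: "has_betti ?V (monomial_ideal ?V (\<lambda>X. ?P X \<or> insert v {u} \<subseteq> X) :: ('v, 'k) mpoly set)
     (\<lambda>i d. ?d i d + (case i of 0 \<Rightarrow> 0 | Suc j \<Rightarrow> ?e u j (d - (int (card {u}) + 1))))"
    proof (rule has_betti_cone[OF IH Q[OF u]])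
      show "mono ?P" using monoD[OF mono_edge_within[of G "W - {v}"]] by (intro monoI) auto
      show "?P (X \<union> {u})" if "?Q u X" for X using QB[OF that] ..
      show "finite {u}" "{u} \<subseteq> ?V" "v \<in> ?V" "v \<notin> {u}" using vu vW W ne by auto
      show "?Q u X \<longleftrightarrow> ?P (X \<union> insert v {u})" for X by (rule colon)
    qed
    have ideal: "(\<lambda>X. ?P X \<or> insert v {u} \<subseteq> X) = (\<lambda>X. edge_within G (W - {v}) X \<or> (\<exists>u\<in>insert u U. {v, u} \<subseteq> X))"
      by auto
    have card2: "int (card {u}) + 1 = 2" by simp
    have count: "(\<lambda>i d. ?d i d + (case i of 0 \<Rightarrow> 0 | Suc j \<Rightarrow> ?e u j (d - (int (card {u}) + 1)))) =
      (\<lambda>i d. c i d + (\<Sum>u\<in>insert u U. case i of 0 \<Rightarrow> 0 | Suc j \<Rightarrow> ?e u j (d - 2)))"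
      unfolding sum.insert[OF insert.hyps] card2 by (intro ext) (simp add: ac_simps split: nat.split)
    show ?case using betti unfolding ideal count .
  qed
  have "has_betti ?V (monomial_ideal ?V
      (\<lambda>X. edge_within G (W - {v}) X \<or> (\<exists>u\<in>nbhd G W v. {v, u} \<subseteq> X)) :: ('v, 'k) mpoly set)
     (\<lambda>i d. c i d + (\<Sum>u\<in>nbhd G W v. case i of 0 \<Rightarrow> 0 | Suc j \<Rightarrow> ?e u j (d - 2)))"
    by (rule nbrs) (simp_all add: nbhd_def finW)
  moreover have "(\<lambda>X. edge_within G (W - {v}) X \<or> (\<exists>u\<in>nbhd G W v. {v, u} \<subseteq> X)) = edge_within G W"
    (is "?l = ?r")
  proof
    fix X
    show "?l X = ?r X"
    proof
      assume "?l X"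
      then show "?r X"
      proof
        assume "\<exists>u\<in>nbhd G W v. {v, u} \<subseteq> X"
        then obtain u where "u \<in> W \<inter> X" "v \<in> W \<inter> X" "{v, u} \<in> edges G" using vW by (auto simp: in_nbhd)
        then show ?thesis unfolding edge_within_def by blast
      qed (auto simp: edge_within_def)
    next
      assume "?r X"
      then obtain a b where ab: "a \<in> W \<inter> X" "b \<in> W \<inter> X" "{a, b} \<in> edges G"
        unfolding edge_within_def by blast
      consider "a = v" | "b = v" | "a \<noteq> v" "b \<noteq> v" by blast
      then show "?l X"
      proof cases
        case 1
        then have "b \<in> nbhd G W v" "{v, b} \<subseteq> X" using ab by (auto simp: in_nbhd)
        then show ?thesis by blast
      next
        case 2
        then have "a \<in> nbhd G W v" "{v, a} \<subseteq> X" using ab sym[of a b] by (auto simp: in_nbhd)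
        then show ?thesis by blast
      next
        case 3
        then have "edge_within G (W - {v}) X" using ab unfolding edge_within_def by blast
        then show ?thesis ..
      qed
    qed
  qed
  ultimately show ?thesis by simp
qed

section \<open>Dirac's theorem\<close>

lemma nbhd_sym: "{x, y} \<in> edges G \<longleftrightarrow> {y, x} \<in> edges G"
  by (simp add: insert_commute)

definition path_between :: "'v ugraph \<Rightarrow> 'v set \<Rightarrow> 'v \<Rightarrow> 'v \<Rightarrow> nat \<Rightarrow> (nat \<Rightarrow> 'v) \<Rightarrow> bool" where
  "path_between G C s t n p \<longleftrightarrow> p 0 = s \<and> p n = t \<and> (\<forall>k<n. {p k, p (Suc k)} \<in> edges G) \<and>
     (\<forall>k. 0 < k \<and> k < n \<longrightarrow> p k \<in> C)"

text \<open>Skipping the stretch from \<open>k\<close> to \<open>l\<close> saves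
  \<open>l - Suc k\<close> steps, so on a shortest path an edge between two positions must join
  consecutive ones.\<close>

lemma path_shortcut:
  assumes p: "path_between G C s t n p" and kl: "k < l" "l \<le> n" and e: "{p k, p l} \<in> edges G"
  shows "path_between G C s t (n - (l - Suc k)) (\<lambda>j. if j \<le> k then p j else p (j + (l - Suc k)))"
  unfolding path_between_def
proof (intro conjI allI impI)
  let ?q = "\<lambda>j. if j \<le> k then p j else p (j + (l - Suc k))"
  show "?q 0 = s" "?q (n - (l - Suc k)) = t" using p kl by (auto simp: path_between_def)
  fix j
  show "{?q j, ?q (Suc j)} \<in> edges G" if j: "j < n - (l - Suc k)"
  proof -
    consider "j < k" | "j = k" | "j > k" by linarith
    then show ?thesis
    proof cases
      case 2
      then show ?thesis using e kl by simp
    next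
      case 3
      have "j + (l - Suc k) < n" using j by linarith
      then have "{p (j + (l - Suc k)), p (Suc (j + (l - Suc k)))} \<in> edges G"
        using p by (simp add: path_between_def)
      then show ?thesis using 3 by simp
    qed (use p kl in \<open>auto simp: path_between_def\<close>)
  qed
  show "?q j \<in> C" if j: "0 < j \<and> j < n - (l - Suc k)"
  proof -
    have "j + (l - Suc k) < n" using j by linarith
    then show ?thesis using p j kl by (simp add: path_between_def)
  qed
qed

text \<open>A shortest path from \<open>s\<close> to \<open>t\<close> through non-neighbours of \<open>x\<close> closes up with \<open>x\<close> to a
  chordless cycle unless it is a single edge.\<close>

lemma chordal_path_ends_adjacent:
  assumes G: "finite_simple_graph G" and ch: "chordal G"
    and xs: "{x, s} \<in> edges G" "{x, t} \<in> edges G" "s \<noteq> t"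
    and C: "\<And>c. c \<in> C \<Longrightarrow> c \<noteq> x \<and> {x, c} \<notin> edges G"
    and p: "path_between G C s t n0 p0"
  shows "{s, t} \<in> edges G"
proof (rule ccontr)
  assume st: "{s, t} \<notin> edges G"
  define n where "n = (LEAST n. \<exists>p. path_between G C s t n p)"
  have "\<exists>p. path_between G C s t n p" unfolding n_def by (rule LeastI) (use p in blast)
  then obtain p where p: "path_between G C s t n p" by blast
  have least: "n \<le> m" if "path_between G C s t m q" for m q
    unfolding n_def by (rule Least_le) (use that in blast)
  have ends: "p 0 = s" "p n = t" and step: "\<And>k. k < n \<Longrightarrow> {p k, p (Suc k)} \<in> edges G"
    and inner: "\<And>k. 0 < k \<Longrightarrow> k < n \<Longrightarrow> p k \<in> C"
    using p by (auto simp: path_between_def)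
  have n0: "n \<noteq> 0" using ends xs(3) by metis
  have n1: "n \<noteq> 1" using ends st step[of 0] by auto
  have chordless: "{p k, p l} \<notin> edges G" if "k < l" "l \<le> n" "l \<noteq> Suc k" for k l
  proof
    assume "{p k, p l} \<in> edges G"
    from least[OF path_shortcut[OF p that(1,2) this]] show False using that n0 by linarith
  qed
  \<comment> \<open>A repeated vertex shortens the path: if it is the endpoint, by stopping at
    \<open>k\<close>; otherwise the edge leaving \<open>p l\<close> also joins \<open>p k\<close> to
    \<open>p (Suc l)\<close>.\<close>
  have inj: "p k \<noteq> p l" if kl: "k < l" "l \<le> n" for k l
  proof
    assume eq: "p k = p l"
    show False
    proof (cases "l = n")
      case True
      have "path_between G C s t k p"
        using p eq kl True unfolding path_between_def by simp
      from least[OF this] show False using kl by simp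
    next
      case False
      then have "{p k, p (Suc l)} \<in> edges G" using step[of l] kl eq by simp
      then show False using chordless[of k "Suc l"] kl False by simp
    qed
  qed
  have px: "p k \<noteq> x" if "k \<le> n" for k
  proof -
    have "s \<noteq> x" "t \<noteq> x" using edge_doubleton(1)[OF G xs(1)] edge_doubleton(1)[OF G xs(2)] by auto
    then show ?thesis using C[OF inner[of k]] ends that n0 by (cases "k = 0 \<or> k = n") auto
  qed
  \<comment> \<open>The closed walk from \<open>x\<close> along the path and back to
    \<open>x\<close>. Its length \<open>n + 2\<close> exceeds 3 because \<open>s\<close> and
    \<open>t\<close> are distinct and not adjacent.\<close>
  define vs where "vs = x # map p [0..<Suc n]"
  have len: "length vs = n + 2" by (simp add: vs_def)
  have nth0: "vs ! 0 = x" by (simp add: vs_def)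
  have nthS: "vs ! Suc k = p k" if "k \<le> n" for k
    using that nth_map_upt[of k "Suc n" 0 p] unfolding vs_def nth_Cons_Suc by simp
  have setvs: "set vs = insert x (p ` {..n})"
    by (simp add: vs_def atLeast0AtMost atLeastLessThanSuc_atLeastAtMost del: upt_Suc)
  have "inj_on p {0..<Suc n}"
  proof (rule inj_onI)
    fix a b assume "a \<in> {0..<Suc n}" "b \<in> {0..<Suc n}" "p a = p b"
    then show "a = b" using inj[of a b] inj[of b a] by (cases a b rule: linorder_cases) auto
  qed
  moreover have "x \<notin> p ` {0..<Suc n}"
  proof
    assume "x \<in> p ` {0..<Suc n}"
    then obtain k where "k \<in> {0..<Suc n}" "x = p k" by blast
    then show False using px[of k] by simp
  qed
  ultimately have dist: "distinct vs"
    by (simp only: vs_def distinct.simps distinct_map set_map set_upt distinct_upt simp_thms)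
  have ce0: "{x, p 0} \<in> cycle_edges vs"
    unfolding cycle_edges_def using nth0 nthS[of 0] len
    by (intro CollectI exI[of _ 0]) simp
  have ceS: "{p k, p (Suc k)} \<in> cycle_edges vs" if "k < n" for k
    unfolding cycle_edges_def using nthS[of k] nthS[of "Suc k"] len that
    by (intro CollectI exI[of _ "Suc k"]) simp
  have cen: "{p n, x} \<in> cycle_edges vs"
    unfolding cycle_edges_def using nthS[of n] nth0 len
    by (intro CollectI exI[of _ "Suc n"]) simp
  have "cycle_edges vs \<subseteq> edges G"
  proof
    fix e assume "e \<in> cycle_edges vs"
    then obtain i where i: "i < length vs" "e = {vs ! i, vs ! (Suc i mod length vs)}"
      by (auto simp: cycle_edges_def)
    consider "i = 0" | "i = Suc n" | k where "i = Suc k" "k < n"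
      using i(1) len by (cases i) (auto simp: less_Suc_eq)
    then show "e \<in> edges G"
    proof cases
      case 1
      then have "e = {x, p 0}" using i len nth0 nthS[of 0] by simp
      then show ?thesis using ends xs by simp
    next
      case 2
      then have "e = {p n, x}" using i len nth0 nthS[of n] by simp
      then show ?thesis using ends xs nbhd_sym[of x t G] by simp
    next
      case 3
      then have "e = {p k, p (Suc k)}" using i len nthS[of k] nthS[of "Suc k"] by simp
      then show ?thesis using step 3 by simp
    qed
  qed
  then have "is_cycle G vs" using dist len n0 by (simp add: is_cycle_def)
  moreover have "length vs > 3" using len n0 n1 by simp
  ultimately obtain e where e: "e \<in> edges G" "e \<subseteq> set vs" "e \<notin> cycle_edges vs"
    using ch unfolding chordal_def by blast
  have "card e = 2" using G e(1) by (simp add: finite_simple_graph_def)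
  then obtain a b where ab: "e = {a, b}" "a \<noteq> b" by (auto simp: card_2_iff)
  \<comment> \<open>Inner vertices of the path are not adjacent to \<open>x\<close>, and the edges
    from \<open>x\<close> to the two ends belong to the cycle, so no chord meets
    \<open>x\<close>.\<close>
  have xk: False if k: "e = {x, p k}" "k \<le> n" for k
  proof -
    consider "k = 0" | "k = n" | "0 < k" "k < n" using k(2) by linarith
    then show False
    proof cases
      case 1
      then show False using ce0 e k by simp
    next
      case 2
      then show False using cen e k by (simp add: insert_commute)
    next
      case 3
      then show False using C[OF inner[of k]] e k by simp
    qed
  qed
  have pkl: False if "e = {p k, p l}" "k < l" "l \<le> n" for k l
    using chordless[OF that(2,3)] ceS[of k] e that by (cases "l = Suc k") auto
  show False
  proof (cases "x \<in> e")
    case True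
    then obtain c where c: "e = {x, c}" "c \<noteq> x" using ab by (cases "a = x") (auto simp: insert_commute)
    then obtain k where "k \<le> n" "c = p k" using e(2) setvs by auto
    then show False using xk[of k] c by simp
  next
    case False
    then have "a \<in> p ` {..n}" "b \<in> p ` {..n}" using e(2) setvs ab by auto
    then obtain k l where kl: "k \<le> n" "l \<le> n" "a = p k" "b = p l" by auto
    show False
    proof (cases k l rule: linorder_cases)
      case less
      then show False using pkl[of k l] kl ab by simp
    next
      case equal
      then show False using kl ab by simp
    next
      case greater
      then show False using pkl[of l k] kl ab by (simp add: insert_commute)
    qed
  qed
qed

text \<open>Dirac's theorem in a form that is stable under induction: the vertex is found away from a
  prescribed one.\<close>

lemma simplicial_off_closed_nbhd:
  assumes G: "finite_simple_graph G" and ch: "chordal G"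
  shows "W \<subseteq> verts G \<Longrightarrow> x \<in> W \<Longrightarrow> \<not> W \<subseteq> insert x (nbhd G W x) \<Longrightarrow>
    \<exists>y\<in>W - insert x (nbhd G W x). simplicial G W y"
proof (induction "card W" arbitrary: W x rule: less_induct)
  case less
  note W = less.prems(1) and xW = less.prems(2)
  have finW: "finite W" using G W by (auto simp: finite_simple_graph_def intro: finite_subset)
  define A where "A = W - insert x (nbhd G W x)"
  obtain c0 where c0: "c0 \<in> A" using less.prems(3) unfolding A_def by blast
  \<comment> \<open>\<open>C\<close> will be the component of \<open>c0\<close> in the graph on the
    vertices of \<open>W\<close> outside the closed neighbourhood of \<open>x\<close>, and
    \<open>S\<close> the set of neighbours of \<open>x\<close> adjacent to \<open>C\<close>. Two
    vertices of \<open>S\<close> are joined by a path through \<open>C\<close>, which chordality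
    turns into an edge.\<close>
  define R where "R = {(a, b). a \<in> A \<and> b \<in> A \<and> {a, b} \<in> edges G}"
  define C where "C = {c. (c0, c) \<in> R\<^sup>*}"
  define S where "S = {s \<in> nbhd G W x. \<exists>c\<in>C. {s, c} \<in> edges G}"
  have c0C: "c0 \<in> C" by (simp add: C_def)
  have CA: "C \<subseteq> A"
  proof
    fix c assume "c \<in> C"
    then have "(c0, c) \<in> R\<^sup>*" by (simp add: C_def)
    then show "c \<in> A" by (induction) (use c0 in \<open>auto simp: R_def\<close>)
  qed
  have CR: "b \<in> C" if "a \<in> C" "(a, b) \<in> R" for a b
    using that unfolding C_def by (auto intro: rtrancl_into_rtrancl)
  have Cx: "c \<noteq> x \<and> {x, c} \<notin> edges G" if "c \<in> C" for c
    using that CA unfolding A_def by (auto simp: in_nbhd)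
  have CN: "nbhd G W c \<subseteq> C \<union> S" if c: "c \<in> C" for c
  proof
    fix y assume y: "y \<in> nbhd G W c"
    then have cy: "y \<in> W" "{c, y} \<in> edges G" by (auto simp: in_nbhd)
    show "y \<in> C \<union> S"
    proof (cases "y \<in> A")
      case True
      then have "(c, y) \<in> R" using cy c CA by (auto simp: R_def)
      then show ?thesis using CR c by blast
    next
      case False
      have "y \<noteq> x" using Cx[OF c] cy nbhd_sym[of x c G] by metis
      then have "y \<in> nbhd G W x" using False cy by (simp add: A_def)
      then show ?thesis using c cy nbhd_sym[of y c G] unfolding S_def by blast
    qed
  qed
  have symR: "(c, c') \<in> R\<^sup>*" if "c \<in> C" "c' \<in> C" for c c'
  proof -
    have "sym R" by (auto simp: sym_def R_def insert_commute)
    then have "(c, c0) \<in> R\<^sup>*" using that sym_rtrancl unfolding C_def sym_def by blast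
    then show ?thesis using that unfolding C_def by auto
  qed
  have clique: "{s, t} \<in> edges G" if s: "s \<in> S" and t: "t \<in> S" and ne: "s \<noteq> t" for s t
  proof -
    obtain c where c: "c \<in> C" "{s, c} \<in> edges G" using s by (auto simp: S_def)
    obtain c' where c': "c' \<in> C" "{t, c'} \<in> edges G" using t by (auto simp: S_def)
    have xs: "{x, s} \<in> edges G" "{x, t} \<in> edges G" using s t by (auto simp: S_def in_nbhd)
    obtain m where "(c, c') \<in> R ^^ m" using symR[OF c(1) c'(1)] rtrancl_imp_relpow by blast
    then obtain f where f: "f 0 = c" "f m = c'" "\<And>i. i < m \<Longrightarrow> (f i, f (Suc i)) \<in> R"
      unfolding relpow_fun_conv by blast
    have fC: "f i \<in> C" if "i \<le> m" for i
      using that by (induction i) (use f c CR in auto)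
    define p where "p = (\<lambda>k. if k = 0 then s else if k \<le> Suc m then f (k - 1) else t)"
    have pb: "path_between G C s t (Suc (Suc m)) p"
      unfolding path_between_def
    proof (intro conjI allI impI)
      show "p 0 = s" "p (Suc (Suc m)) = t" by (auto simp: p_def)
      fix k
      show "{p k, p (Suc k)} \<in> edges G" if k: "k < Suc (Suc m)"
      proof -
        consider "k = 0" | "k = Suc m" | i where "k = Suc i" "i < m"
          using k by (cases k) (auto simp: less_Suc_eq)
        then show ?thesis
        proof cases
          case 2
          then show ?thesis using f c' nbhd_sym[of t c' G] by (simp add: p_def)
        next
          case 3
          then show ?thesis using f(3)[of i] by (simp add: p_def R_def)
        qed (use f c in \<open>simp add: p_def\<close>)
      qed
      show "p k \<in> C" if "0 < k \<and> k < Suc (Suc m)" using that fC[of "k - 1"] by (auto simp: p_def)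
    qed
    show ?thesis
    proof (rule chordal_path_ends_adjacent[OF G ch xs ne _ pb])
      show "c \<noteq> x \<and> {x, c} \<notin> edges G" if "c \<in> C" for c using Cx[OF that] .
    qed
  qed
  \<comment> \<open>\<open>H\<close> omits \<open>x\<close>, so the induction applies to it, and it
    contains all neighbours in \<open>W\<close> of vertices of \<open>C\<close>. A vertex of
    \<open>C\<close> simplicial in \<open>H\<close> is therefore simplicial in
    \<open>W\<close>.\<close>
  define H where "H = C \<union> S"
  have SN: "S \<subseteq> nbhd G W x" by (auto simp: S_def)
  have xN: "x \<notin> nbhd G W x" using edge_doubleton(1)[OF G, of x x] by (auto simp: in_nbhd)
  have HW: "H \<subseteq> W - {x}" using CA SN xN unfolding H_def A_def by (auto simp: in_nbhd)
  then have "card H < card W" using finW xW by (intro psubset_card_mono) auto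
  moreover have "H \<subseteq> verts G" using HW W by blast
  ultimately have IH: "\<exists>y\<in>H - insert h (nbhd G H h). simplicial G H y"
    if "h \<in> H" "\<not> H \<subseteq> insert h (nbhd G H h)" for h
    using less.hyps that by blast
  have CS: "c \<notin> S" if "c \<in> C" for c using that CA SN unfolding A_def by blast
  \<comment> \<open>If some \<open>s\<close> in \<open>S\<close> misses a vertex of
    \<open>H\<close>, the simplicial vertex found away from \<open>s\<close> is outside the clique
    \<open>S\<close>. Otherwise every vertex of \<open>S\<close> is adjacent to all others, so a
    vertex found away from some \<open>c\<close> in \<open>C\<close> is again in \<open>C\<close>.
    If neither kind of vertex exists, \<open>H\<close> is complete.\<close>
  have "\<exists>y\<in>C. simplicial G H y"
  proof (cases "\<exists>s\<in>S. \<not> H \<subseteq> insert s (nbhd G H s)")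
    case True
    then obtain s where s: "s \<in> S" "\<not> H \<subseteq> insert s (nbhd G H s)" by blast
    then obtain y where y: "y \<in> H" "y \<notin> insert s (nbhd G H s)" "simplicial G H y"
      using IH[of s] unfolding H_def by blast
    have "y \<notin> S" using clique[OF s(1), of y] y by (auto simp: in_nbhd)
    then show ?thesis using y unfolding H_def by blast
  next
    case S: False
    show ?thesis
    proof (cases "\<exists>c\<in>C. \<not> H \<subseteq> insert c (nbhd G H c)")
      case True
      then obtain c where c: "c \<in> C" "\<not> H \<subseteq> insert c (nbhd G H c)" by blast
      then obtain y where y: "y \<in> H" "y \<notin> insert c (nbhd G H c)" "simplicial G H y"
        using IH[of c] unfolding H_def by blast
      have "y \<notin> S"
      proof
        assume yS: "y \<in> S"
        then have "c \<in> insert y (nbhd G H y)" using S c(1) unfolding H_def by blast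
        then have "{y, c} \<in> edges G" using CS[OF c(1)] yS by (auto simp: in_nbhd)
        then show False using y nbhd_sym[of y c G] by (simp add: in_nbhd)
      qed
      then show ?thesis using y unfolding H_def by blast
    next
      case False
      have "simplicial G H c0"
        unfolding simplicial_def
      proof (intro conjI ballI impI)
        show "c0 \<in> H" using c0C by (simp add: H_def)
        fix a b assume "a \<in> nbhd G H c0" "b \<in> nbhd G H c0" "a \<noteq> b"
        then have "a \<in> H" "b \<in> H" by (auto simp: in_nbhd)
        then have "b \<in> insert a (nbhd G H a)" using S False unfolding H_def by blast
        then show "{a, b} \<in> edges G" using \<open>a \<noteq> b\<close> by (simp add: in_nbhd)
      qed
      then show ?thesis using c0C by blast
    qed
  qed
  then obtain y where y: "y \<in> C" "simplicial G H y" by blast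
  have "nbhd G W y \<subseteq> nbhd G H y" using CN[OF y(1)] by (auto simp: in_nbhd H_def)
  then have "simplicial G W y" using y CA unfolding simplicial_def A_def by blast
  then show ?case using y(1) CA unfolding A_def by blast
qed

text \<open>If every vertex is adjacent to all others, the induced graph is complete and any vertex
  will do.\<close>

lemma ex_simplicial:
  assumes G: "finite_simple_graph G" and ch: "chordal G" and W: "W \<subseteq> verts G" "W \<noteq> {}"
  obtains v where "simplicial G W v"
proof (cases "\<exists>x\<in>W. \<not> W \<subseteq> insert x (nbhd G W x)")
  case True
  then show ?thesis using simplicial_off_closed_nbhd[OF G ch W(1)] that by blast
next
  case False
  obtain v where "v \<in> W" using W by blast
  have "{a, b} \<in> edges G" if "a \<in> nbhd G W v" "b \<in> nbhd G W v" "a \<noteq> b" for a b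
  proof -
    have "a \<in> W" "b \<in> W" using that by (auto simp: in_nbhd)
    then have "b \<in> insert a (nbhd G W a)" using False by blast
    then show ?thesis using \<open>a \<noteq> b\<close> by (simp add: in_nbhd)
  qed
  then show ?thesis using that[of v] \<open>v \<in> W\<close> by (simp add: simplicial_def)
qed

section \<open>Types of sets of bouquets\<close>

definition separated :: "'v ugraph \<Rightarrow> 'v set \<Rightarrow> 'v set \<Rightarrow> bool" where
  "separated G e e' \<longleftrightarrow> e \<inter> e' = {} \<and> (\<forall>a\<in>e. \<forall>b\<in>e'. {a, b} \<notin> edges G)"

lemma separated_commute: "separated G e e' \<longleftrightarrow> separated G e' e"
  unfolding separated_def by (metis inf_commute insert_commute)

text \<open>Distance 0 is excluded by \<open>e \<noteq> e'\<close>, distance 1 means a common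
  vertex, and distance at most 2 means in addition a possible edge from \<open>e\<close> to
  \<open>e'\<close> as the middle term of the sequence. Thus distance at least 3 is a condition on
  the four end vertices alone.\<close>

lemma edge_dist_ge_3_iff:
  assumes G: "finite_simple_graph G" and e: "e \<in> edges G" "e' \<in> edges G" "e \<noteq> e'"
  shows "edge_dist G e e' \<ge> 3 \<longleftrightarrow> separated G e e'"
proof
  define D where "D = {enat l | l. \<exists>s :: nat \<Rightarrow> 'a set.
     s 0 = e \<and> s l = e' \<and> (\<forall>k\<le>l. s k \<in> edges G) \<and> (\<forall>k<l. s k \<inter> s (Suc k) \<noteq> {})}"
  have dist: "edge_dist G e e' = Inf D" by (simp add: edge_dist_def D_def)
  {
    assume ge: "edge_dist G e e' \<ge> 3"
    have l: "3 \<le> l" if "enat l \<in> D" for l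
    proof -
      have "3 \<le> enat l" using ge Inf_lower[OF that] unfolding dist by (rule order_trans)
      then show ?thesis by (simp add: numeral_eq_enat)
    qed
    show "separated G e e'"
      unfolding separated_def
    proof (intro conjI ballI notI)
      show "e \<inter> e' = {}"
      proof (rule ccontr)
        assume "e \<inter> e' \<noteq> {}"
        then have "enat 1 \<in> D" unfolding D_def using e
          by (intro CollectI exI[of _ 1] conjI refl exI[of _ "\<lambda>k. if k = 0 then e else e'"]) auto
        from l[OF this] show False by simp
      qed
      fix a b assume ab: "a \<in> e" "b \<in> e'" "{a, b} \<in> edges G"
      have "enat 2 \<in> D" unfolding D_def using e ab
        by (intro CollectI exI[of _ 2] conjI refl exI[of _ "\<lambda>k. if k = 0 then e else if k = 1 then {a, b} else e'"])
          (auto simp: less_2_cases_iff)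
      from l[OF this] show False by simp
    qed
  next
    assume sep: "separated G e e'"
    show "edge_dist G e e' \<ge> 3"
      unfolding dist
    proof (rule Inf_greatest)
      fix d assume "d \<in> D"
      then obtain l and s :: "nat \<Rightarrow> 'a set" where l: "d = enat l" and s: "s 0 = e" "s l = e'"
        "\<And>k. k \<le> l \<Longrightarrow> s k \<in> edges G" "\<And>k. k < l \<Longrightarrow> s k \<inter> s (Suc k) \<noteq> {}"
        unfolding D_def by blast
      have "l \<noteq> 0" using s e by metis
      moreover have "l \<noteq> 1" using s sep unfolding separated_def by fastforce
      moreover have "l \<noteq> 2"
      proof
        assume l2: "l = 2"
        then have "s 0 \<inter> s 1 \<noteq> {}" "s 1 \<inter> s 2 \<noteq> {}" "s 1 \<in> edges G"
          using s(3)[of 1] s(4)[of 0] s(4)[of 1] by (auto simp: numeral_2_eq_2)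
        then obtain a b where ab: "a \<in> e" "b \<in> e'" "a \<in> s 1" "b \<in> s 1" using s l2 by auto
        then have "a \<noteq> b" using sep unfolding separated_def by blast
        moreover have "card (s 1) = 2" using G \<open>s 1 \<in> edges G\<close> by (simp add: finite_simple_graph_def)
        ultimately have "s 1 = {a, b}" using ab by (auto simp: card_2_iff)
        then show False using sep ab \<open>s 1 \<in> edges G\<close> unfolding separated_def by metis
      qed
      ultimately have "3 \<le> l" by linarith
      then show "3 \<le> d" by (simp add: l numeral_eq_enat)
    qed
  }
qed

text \<open>Since an arbitrary flower may be moved to any bouquet whose root it is adjacent to, only the
  root set \<open>R\<close> and the chosen stem \<open>{r, s r}\<close> at every root matter.\<close>

definition bouquet_type_of ::
    "'v ugraph \<Rightarrow> 'v set \<Rightarrow> nat \<Rightarrow> nat \<Rightarrow> 'v set \<Rightarrow> ('v \<Rightarrow> 'v) \<Rightarrow> bool" where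
  "bouquet_type_of G U i j R s \<longleftrightarrow> R \<subseteq> U \<and> card R = j \<and> card (U - R) = i \<and>
     (\<forall>r\<in>R. s r \<in> U - R \<and> {r, s r} \<in> edges G) \<and>
     (\<forall>r\<in>R. \<forall>r'\<in>R. r \<noteq> r' \<longrightarrow> separated G {r, s r} {r', s r'}) \<and>
     (\<forall>z\<in>U - R. \<exists>r\<in>R. {r, z} \<in> edges G)"

lemma bouquet_type_ofD:
  assumes "bouquet_type_of G U i j R s"
  shows "R \<subseteq> U" "card R = j" "card (U - R) = i"
    "\<And>r. r \<in> R \<Longrightarrow> s r \<in> U - R" "\<And>r. r \<in> R \<Longrightarrow> {r, s r} \<in> edges G"
    "\<And>r r'. r \<in> R \<Longrightarrow> r' \<in> R \<Longrightarrow> r \<noteq> r' \<Longrightarrow> separated G {r, s r} {r', s r'}"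
    "\<And>z. z \<in> U - R \<Longrightarrow> \<exists>r\<in>R. {r, z} \<in> edges G"
  using assms by (simp_all add: bouquet_type_of_def)

lemma bouquet_type_ofI:
  assumes "R \<subseteq> U" "card R = j" "card (U - R) = i"
    "\<And>r. r \<in> R \<Longrightarrow> s r \<in> U - R \<and> {r, s r} \<in> edges G"
    "\<And>r r'. r \<in> R \<Longrightarrow> r' \<in> R \<Longrightarrow> r \<noteq> r' \<Longrightarrow> separated G {r, s r} {r', s r'}"
    "\<And>z. z \<in> U - R \<Longrightarrow> \<exists>r\<in>R. {r, z} \<in> edges G"
  shows "bouquet_type_of G U i j R s"
  using assms by (simp add: bouquet_type_of_def)

definition has_type :: "'v ugraph \<Rightarrow> 'v set \<Rightarrow> nat \<Rightarrow> nat \<Rightarrow> bool" where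
  "has_type G U i j \<longleftrightarrow> (\<exists>R s. bouquet_type_of G U i j R s)"

text \<open>Disjoint bouquets have different roots, so the stems can be indexed by roots. They also
  have different stems, which is needed because 3-disjointness speaks about the set of chosen
  stems.\<close>

lemma strongly_disjoint_has_type:
  assumes G: "finite_simple_graph G" and sd: "strongly_disjoint G \<B>"
  shows "has_type G (flower_set \<B> \<union> root_set \<B>) (card (flower_set \<B>)) (card (root_set \<B>))"
proof -
  have bq: "\<And>B. B \<in> \<B> \<Longrightarrow> bouquet_of G B"
    and disj: "\<And>B B'. B \<in> \<B> \<Longrightarrow> B' \<in> \<B> \<Longrightarrow> B \<noteq> B' \<Longrightarrow> bouquet_verts B \<inter> bouquet_verts B' = {}"
    using sd by (simp_all add: strongly_disjoint_def)
  have "\<exists>s. (\<forall>B\<in>\<B>. s B \<in> stems B) \<and> pairwise_3_disjoint G (s ` \<B>)"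
    using sd by (simp add: strongly_disjoint_def)
  then obtain st where st: "\<forall>B\<in>\<B>. st B \<in> stems B" and p3: "pairwise_3_disjoint G (st ` \<B>)"
    by blast
  have "\<exists>z. z \<in> flowers B \<and> st B = {broot B, z}" if "B \<in> \<B>" for B
    using bspec[OF st that] by (auto simp: stems_def)
  then obtain z where z: "\<And>B. B \<in> \<B> \<Longrightarrow> z B \<in> flowers B" "\<And>B. B \<in> \<B> \<Longrightarrow> st B = {broot B, z B}"
    by metis
  have inj: "inj_on broot \<B>"
  proof (rule inj_onI, rule ccontr)
    fix B B' assume "B \<in> \<B>" "B' \<in> \<B>" "broot B = broot B'" "B \<noteq> B'"
    with disj[of B B'] show False by (auto simp: bouquet_verts_def)
  qed
  have rf: "broot B \<notin> flowers B'" if "B \<in> \<B>" "B' \<in> \<B>" for B B'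
  proof (cases "B = B'")
    case True
    then show ?thesis using bq[OF that(1)] by (auto simp: bouquet_of_def is_bouquet_def)
  next
    case False
    from disj[OF that False] show ?thesis by (auto simp: bouquet_verts_def)
  qed
  then have rfs: "flower_set \<B> \<union> root_set \<B> - root_set \<B> = flower_set \<B>"
    by (auto simp: flower_set_def root_set_def)
  define s where "s = (\<lambda>r. z (inv_into \<B> broot r))"
  have s: "s (broot B) = z B" if "B \<in> \<B>" for B
    using that by (simp add: s_def inv_into_f_f[OF inj])
  have edge: "{broot B, y} \<in> edges G" if "B \<in> \<B>" "y \<in> flowers B" for B y
    using bq[OF that(1)] that(2) by (auto simp: bouquet_of_def stems_def)
  have sep: "separated G {r, s r} {r', s r'}" if rr: "r \<in> root_set \<B>" "r' \<in> root_set \<B>" "r \<noteq> r'" for r r'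
  proof -
    obtain B B' where B: "B \<in> \<B>" "B' \<in> \<B>" "r = broot B" "r' = broot B'"
      using rr(1,2) by (auto simp: root_set_def)
    then have ne: "B \<noteq> B'" using rr(3) by blast
    have "st B \<subseteq> bouquet_verts B" "st B' \<subseteq> bouquet_verts B'" using B z by (auto simp: bouquet_verts_def)
    then have "st B \<noteq> st B'" using disj[OF B(1,2) ne] z(2)[OF B(1)] by blast
    moreover have "st B \<in> edges G" "st B' \<in> edges G" using B z edge by auto
    moreover have "edge_dist G (st B) (st B') \<ge> 3"
      using p3 B \<open>st B \<noteq> st B'\<close> by (auto simp: pairwise_3_disjoint_def)
    ultimately have "separated G (st B) (st B')" using edge_dist_ge_3_iff[OF G] by blast
    then show ?thesis using B z s by simp
  qed
  have "bouquet_type_of G (flower_set \<B> \<union> root_set \<B>) (card (flower_set \<B>)) (card (root_set \<B>)) (root_set \<B>) s"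
    unfolding bouquet_type_of_def rfs
  proof (intro conjI ballI impI)
    fix r assume "r \<in> root_set \<B>"
    then obtain B where B: "B \<in> \<B>" "r = broot B" by (auto simp: root_set_def)
    then show "s r \<in> flower_set \<B>" "{r, s r} \<in> edges G"
      using z(1) s edge by (auto simp: flower_set_def)
  next
    fix y assume "y \<in> flower_set \<B>"
    then show "\<exists>r\<in>root_set \<B>. {r, y} \<in> edges G"
      using edge by (auto simp: flower_set_def root_set_def)
  qed (use sep in auto)
  then show ?thesis unfolding has_type_def by blast
qed

lemma has_type_strongly_disjoint:
  fixes G :: "'v ugraph"
  assumes G: "finite_simple_graph G" and U: "U \<subseteq> verts G" and t: "has_type G U i j"
  obtains \<B> where "strongly_disjoint G \<B>" "bouquets_type \<B> = (i, j)" "U = flower_set \<B> \<union> root_set \<B>"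
proof -
  obtain R s where RS: "bouquet_type_of G U i j R s"
    using t unfolding has_type_def by blast
  note R = bouquet_type_ofD(1-3)[OF RS] and s = bouquet_type_ofD(4,5)[OF RS]
    and sep = bouquet_type_ofD(6)[OF RS] and dom = bouquet_type_ofD(7)[OF RS]
  have finU: "finite U" using U G by (auto simp: finite_simple_graph_def intro: finite_subset)
  then have finR: "finite R" using R(1) by (rule rev_finite_subset)
  obtain g0 where g0: "\<And>z. z \<in> U - R \<Longrightarrow> g0 z \<in> R \<and> {g0 z, z} \<in> edges G" using dom by metis
  have sinj: "inj_on s R"
  proof (rule inj_onI, rule ccontr)
    fix r r' assume "r \<in> R" "r' \<in> R" "s r = s r'" "r \<noteq> r'"
    with sep[of r r'] show False by (auto simp: separated_def)
  qed
  \<comment> \<open>Assigns each flower to one root: the end of a chosen stem stays with its own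
    root, any other vertex goes to some adjacent root. The fibres of \<open>g\<close> become the
    bouquets, which makes them disjoint.\<close>
  define g where "g = (\<lambda>z. if z \<in> s ` R then inv_into R s z else g0 z)"
  have g: "g z \<in> R" "{g z, z} \<in> edges G" if "z \<in> U - R" for z
    using g0[OF that] s(2) by (auto simp: g_def inv_into_f_f[OF sinj])
  have gs: "g (s r) = r" if "r \<in> R" for r using that by (simp add: g_def inv_into_f_f[OF sinj])
  define b where "b = (\<lambda>r. \<lparr>broot = r, flowers = {z \<in> U - R. g z = r}\<rparr>)"
  have b: "broot (b r) = r" "flowers (b r) = {z \<in> U - R. g z = r}" for r by (simp_all add: b_def)
  have fl: "flower_set (b ` R) = U - R" using g(1) by (auto simp: flower_set_def b)
  have rt: "root_set (b ` R) = R" by (auto simp: root_set_def b image_image)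
  have binj: "inj_on b R" by (rule inj_on_inverseI[of _ broot]) (simp add: b)
  show ?thesis
  proof (rule that[of "b ` R"])
    show "U = flower_set (b ` R) \<union> root_set (b ` R)" using R(1) by (auto simp: fl rt)
    show "bouquets_type (b ` R) = (i, j)" by (simp add: bouquets_type_def fl rt R)
    have "bouquet_of G (b r)" if r: "r \<in> R" for r
      unfolding bouquet_of_def is_bouquet_def
    proof (intro conjI)
      show "finite (flowers (b r))" using finU by (simp add: b)
      show "flowers (b r) \<noteq> {}" using s(1)[OF r] gs[OF r] by (auto simp: b)
      show "broot (b r) \<notin> flowers (b r)" using r by (simp add: b)
      show "bouquet_verts (b r) \<subseteq> verts G" using r R(1) U by (auto simp: bouquet_verts_def b)
      show "stems (b r) \<subseteq> edges G" using g(2) by (auto simp: stems_def b)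
    qed
    moreover have "bouquet_verts (b r) \<inter> bouquet_verts (b r') = {}" if "r \<in> R" "r' \<in> R" "r \<noteq> r'" for r r'
      using that by (auto simp: bouquet_verts_def b)
    moreover define st where "st = (\<lambda>B :: 'v bouquet. {broot B, s (broot B)})"
    have st: "st (b r) = {r, s r}" for r by (simp add: st_def b)
    have "st (b r) \<in> stems (b r)" if "r \<in> R" for r
      using s(1)[OF that] gs[OF that] by (auto simp: st stems_def b)
    moreover have "pairwise_3_disjoint G (st ` b ` R)"
      unfolding pairwise_3_disjoint_def
    proof (intro conjI ballI impI)
      show "st ` b ` R \<subseteq> edges G" using s(2) by (auto simp: st)
      fix e e' assume "e \<in> st ` b ` R" "e' \<in> st ` b ` R" and ne: "e \<noteq> e'"
      then obtain r r' where r: "r \<in> R" "r' \<in> R" "e = {r, s r}" "e' = {r', s r'}"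
        unfolding image_image st by blast
      then have "separated G e e'" using sep[of r r'] ne by blast
      then show "edge_dist G e e' \<ge> 3" using edge_dist_ge_3_iff[OF G _ _ ne] r s(2) by blast
    qed
    ultimately show "strongly_disjoint G (b ` R)"
      unfolding strongly_disjoint_def using finR by (intro conjI exI[of _ st]) auto
  qed
qed

section \<open>Types in induced subgraphs and the invariant \<open>d_G\<close>\<close>

lemma finite_simple_induced:
  "finite_simple_graph G \<Longrightarrow> U \<subseteq> verts G \<Longrightarrow> finite_simple_graph (induced_subgraph G U)"
  by (auto simp: finite_simple_graph_def induced_subgraph_def intro: finite_subset)

text \<open>Every edge that \<open>bouquet_type_of\<close> asks about has both ends in
  \<open>U\<close>, also inside \<open>separated\<close>.\<close>

lemma has_type_induced: "has_type (induced_subgraph G U) U i j \<longleftrightarrow> has_type G U i j"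
proof -
  have e: "{a, b} \<in> edges (induced_subgraph G U) \<longleftrightarrow> {a, b} \<in> edges G" if "a \<in> U" "b \<in> U" for a b
    using that by (simp add: induced_subgraph_def)
  have sep: "separated (induced_subgraph G U) {a, b} {c, d} \<longleftrightarrow> separated G {a, b} {c, d}"
    if "a \<in> U" "b \<in> U" "c \<in> U" "d \<in> U" for a b c d
    using that by (simp add: separated_def e)
  have "bouquet_type_of (induced_subgraph G U) U i j R s \<longleftrightarrow> bouquet_type_of G U i j R s" for R s
  proof (cases "R \<subseteq> U \<and> (\<forall>r\<in>R. s r \<in> U - R)")
    case True
    then have RU: "r \<in> U" "s r \<in> U" if "r \<in> R" for r using that by blast+
    have "(\<forall>r\<in>R. s r \<in> U - R \<and> {r, s r} \<in> edges (induced_subgraph G U)) \<longleftrightarrow>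
      (\<forall>r\<in>R. s r \<in> U - R \<and> {r, s r} \<in> edges G)"
      using RU e by (intro ball_cong) auto
    moreover have "(\<forall>r\<in>R. \<forall>r'\<in>R. r \<noteq> r' \<longrightarrow> separated (induced_subgraph G U) {r, s r} {r', s r'}) \<longleftrightarrow>
      (\<forall>r\<in>R. \<forall>r'\<in>R. r \<noteq> r' \<longrightarrow> separated G {r, s r} {r', s r'})"
      using RU sep by (intro ball_cong refl) simp
    moreover have "(\<forall>z\<in>U - R. \<exists>r\<in>R. {r, z} \<in> edges (induced_subgraph G U)) \<longleftrightarrow>
      (\<forall>z\<in>U - R. \<exists>r\<in>R. {r, z} \<in> edges G)"
      using RU e by (intro ball_cong bex_cong refl) auto
    ultimately show ?thesis unfolding bouquet_type_of_def by simp
  qed (unfold bouquet_type_of_def, blast)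
  then show ?thesis by (simp add: has_type_def)
qed

lemma contains_strongly_disjoint_iff:
  assumes G: "finite_simple_graph G" and U: "U \<subseteq> verts G"
  shows "contains_strongly_disjoint (induced_subgraph G U) (i, j) \<longleftrightarrow> has_type G U i j"
proof
  let ?H = "induced_subgraph G U"
  have H: "finite_simple_graph ?H" by (rule finite_simple_induced[OF G U])
  have vH: "verts ?H = U" by (simp add: induced_subgraph_def)
  {
    assume "contains_strongly_disjoint ?H (i, j)"
    then obtain \<B> where B: "strongly_disjoint ?H \<B>" "bouquets_type \<B> = (i, j)"
      "U = flower_set \<B> \<union> root_set \<B>"
      unfolding contains_strongly_disjoint_def vH by blast
    then have "has_type ?H U i j"
      using strongly_disjoint_has_type[OF H B(1)] by (simp add: bouquets_type_def)
    then show "has_type G U i j" by (simp add: has_type_induced)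
  next
    assume "has_type G U i j"
    then have "has_type ?H U i j" by (simp add: has_type_induced)
    from has_type_strongly_disjoint[OF H _ this] show "contains_strongly_disjoint ?H (i, j)"
      unfolding contains_strongly_disjoint_def vH by (metis order_refl vH)
  }
qed

text \<open>In \<open>d_G\<close> distances are measured in \<open>G\<close> itself, not in the
  subgraph induced on the bouquets. For the bound 3 both readings agree, since separation only looks
  at the ends of the stems.\<close>

lemma max_flowers_eq:
  assumes G: "finite_simple_graph G"
  shows "max_flowers G = Max {i. \<exists>j. \<exists>U\<subseteq>verts G. has_type G U i j}"
proof -
  have "{card (flower_set \<B>) | \<B>. strongly_disjoint G \<B>} = {i. \<exists>j. \<exists>U\<subseteq>verts G. has_type G U i j}"
  proof (intro equalityI subsetI)
    fix i assume "i \<in> {card (flower_set \<B>) | \<B>. strongly_disjoint G \<B>}"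
    then obtain \<B> where B: "strongly_disjoint G \<B>" "i = card (flower_set \<B>)" by blast
    have "bouquet_verts B \<subseteq> verts G" if "B \<in> \<B>" for B
      using B(1) that by (simp add: strongly_disjoint_def bouquet_of_def)
    then have "flower_set \<B> \<union> root_set \<B> \<subseteq> verts G"
      unfolding flower_set_def root_set_def bouquet_verts_def by blast
    then show "i \<in> {i. \<exists>j. \<exists>U\<subseteq>verts G. has_type G U i j}"
      using strongly_disjoint_has_type[OF G B(1)] B(2) by blast
  next
    fix i assume "i \<in> {i. \<exists>j. \<exists>U\<subseteq>verts G. has_type G U i j}"
    then obtain j U where U: "U \<subseteq> verts G" "has_type G U i j" by blast
    then obtain \<B> where "strongly_disjoint G \<B>" "bouquets_type \<B> = (i, j)"
      using has_type_strongly_disjoint[OF G] by metis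
    then show "i \<in> {card (flower_set \<B>) | \<B>. strongly_disjoint G \<B>}"
      by (auto simp: bouquets_type_def)
  qed
  then show ?thesis by (simp add: max_flowers_def)
qed

text \<open>A root \<open>u\<close> next to \<open>v\<close> can take all of its neighbours as
  flowers, so removing its closed neighbourhood removes one whole bouquet:
  \<open>card (nbhd G U u)\<close> flowers, \<open>v\<close> included, and one root. The two
  inequalities guard the truncated subtractions.\<close>

lemma has_type_simplicial_iff:
  assumes G: "finite_simple_graph G" and U: "U \<subseteq> verts G" and v: "simplicial G U v"
  shows "has_type G U i j \<longleftrightarrow> (\<exists>u\<in>nbhd G U v. card (nbhd G U u) \<le> i \<and> 1 \<le> j \<and>
    has_type G (U - insert u (nbhd G U u)) (i - card (nbhd G U u)) (j - 1))"
proof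
  have finU: "finite U" using U G by (auto simp: finite_simple_graph_def intro: finite_subset)
  have irr: "{a, a} \<notin> edges G" for a using edge_doubleton(1)[OF G, of a a] by blast
  have vU: "v \<in> U" using v by (simp add: simplicial_def)
  {
    assume "has_type G U i j"
    then obtain R s where RS: "bouquet_type_of G U i j R s"
      unfolding has_type_def by blast
    note R = bouquet_type_ofD(1-3)[OF RS] and s = bouquet_type_ofD(4,5)[OF RS]
      and sep = bouquet_type_ofD(6)[OF RS] and dom = bouquet_type_ofD(7)[OF RS]
    have "\<exists>R s. bouquet_type_of G U i j R s \<and> v \<notin> R"
    proof (cases "v \<in> R")
      case False
      then show ?thesis using RS by blast
    next
      case vR: True
      define u where "u = s v"
      have u: "u \<in> U" "u \<notin> R" "{v, u} \<in> edges G" "u \<noteq> v" using s[OF vR] vR unfolding u_def by auto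
      have uN: "u \<in> nbhd G U v" using u by (simp add: in_nbhd)
      \<comment> \<open>If \<open>v\<close> is a root, it changes places with its stem flower
        \<open>u\<close>. The stems stay the same as sets, and the other flowers of \<open>v\<close>
        are adjacent to \<open>u\<close> because the neighbours of \<open>v\<close> form a
        clique.\<close>
      let ?R = "insert u (R - {v})" and ?s = "s(u := v)"
      have pair: "{r, ?s r} = {if r = u then v else r, s (if r = u then v else r)}" if "r \<in> ?R" for r
        by (simp add: u_def insert_commute)
      have su: "s r \<noteq> u" if "r \<in> R" "r \<noteq> v" for r
        using sep[OF that(1) vR that(2)] by (auto simp: separated_def u_def)
      have a1: "card ?R = card R" using u(2) vR finite_subset[OF R(1) finU]
        by (metis card_Suc_Diff1 card_insert_disjoint finite_Diff DiffD1)
      have a2: "?R \<subseteq> U" using R(1) u(1) by blast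
      have a3: "card (U - ?R) = card (U - R)"
        using a1 card_Diff_subset[OF finite_subset[OF a2 finU] a2]
          card_Diff_subset[OF finite_subset[OF R(1) finU] R(1)] by simp
      have a4: "?s r \<in> U - ?R \<and> {r, ?s r} \<in> edges G" if r: "r \<in> ?R" for r
      proof (cases "r = u")
        case True
        then show ?thesis using vU u nbhd_sym[of u v G] by simp
      next
        case False
        then have "r \<in> R" "r \<noteq> v" using r by auto
        then show ?thesis using False s[of r] su[of r] by auto
      qed
      have a5: "separated G {r, ?s r} {r', ?s r'}" if "r \<in> ?R" "r' \<in> ?R" "r \<noteq> r'" for r r'
        unfolding pair[OF that(1)] pair[OF that(2)] using that vR by (intro sep) auto
      have a6: "\<exists>r\<in>?R. {r, z} \<in> edges G" if z: "z \<in> U - ?R" for z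
      proof (cases "z = v")
        case True
        then show ?thesis using u(3) nbhd_sym[of u v G] by blast
      next
        case False
        then have "z \<in> U - R" "z \<noteq> u" using z by auto
        then obtain r where r: "r \<in> R" "{r, z} \<in> edges G" using dom by blast
        show ?thesis
        proof (cases "r = v")
          case True
          then have "z \<in> nbhd G U v" using r z by (simp add: in_nbhd)
          then have "{u, z} \<in> edges G" using simplicialD[OF v uN] \<open>z \<noteq> u\<close> by blast
          then show ?thesis by blast
        qed (use r in blast)
      qed
      have "bouquet_type_of G U i j ?R ?s"
        by (rule bouquet_type_ofI)
          (fact a2, simp only: a1 R, simp only: a3 R, erule a4, erule (2) a5, erule a6)
      moreover have "v \<notin> ?R" using u(4) by blast
      ultimately show ?thesis by blast
    qed
    then obtain R s where RS: "bouquet_type_of G U i j R s" and vR: "v \<notin> R" by blast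
    note R = bouquet_type_ofD(1-3)[OF RS] and s = bouquet_type_ofD(4,5)[OF RS]
      and sep = bouquet_type_ofD(6)[OF RS] and dom = bouquet_type_ofD(7)[OF RS]
    obtain u where u: "u \<in> R" "{u, v} \<in> edges G" using dom[of v] vU vR by blast
    have uN: "u \<in> nbhd G U v" using u R(1) nbhd_sym[of u v G] by (auto simp: in_nbhd)
    define N where "N = nbhd G U u"
    \<comment> \<open>Separation from the stem at \<open>u\<close> keeps all other roots and their
      stem flowers out of the neighbourhood of \<open>u\<close>, so they survive its
      removal.\<close>
    have NR: "r \<notin> N" "s r \<notin> N" "s r \<noteq> u" if "r \<in> R" "r \<noteq> u" for r
      using sep[OF u(1) that(1)] that(2) by (auto simp: separated_def N_def in_nbhd)
    have "u \<notin> N" using irr by (simp add: N_def in_nbhd)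
    moreover have "N \<subseteq> U" by (auto simp: N_def in_nbhd)
    ultimately have NU: "N \<subseteq> U - R" using NR(1) by blast
    let ?U = "U - insert u N" and ?R = "R - {u}"
    have "?U - ?R = U - R - N" using u by blast
    with NU have b3: "card (?U - ?R) = i - card N"
      using card_Diff_subset[of N "U - R"] NU finU R(3) by (simp add: finite_subset)
    have b0: "card N \<le> i" using card_mono[OF _ NU] finU R(3) by simp
    have b2: "card ?R = j - 1" using u(1) R(2) by simp
    have j1: "1 \<le> j" using u(1) R(2) card_gt_0_iff[of R] finite_subset[OF R(1) finU] by auto
    have b1: "?R \<subseteq> ?U" using R(1) NR by blast
    have b4: "s r \<in> ?U - ?R \<and> {r, s r} \<in> edges G" if "r \<in> ?R" for r
      using that s[of r] NR[of r] by blast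
    have b5: "separated G {r, s r} {r', s r'}" if "r \<in> ?R" "r' \<in> ?R" "r \<noteq> r'" for r r'
      using that sep by blast
    have b6: "\<exists>r\<in>?R. {r, z} \<in> edges G" if z: "z \<in> ?U - ?R" for z
    proof -
      have "z \<in> U - R" using z by blast
      then obtain r where r: "r \<in> R" "{r, z} \<in> edges G" using dom by blast
      have "r \<noteq> u" using z r by (auto simp: N_def in_nbhd)
      then show ?thesis using r by blast
    qed
    have "bouquet_type_of G ?U (i - card N) (j - 1) ?R s"
      by (rule bouquet_type_ofI) (fact b1, fact b2, fact b3, erule b4, erule (2) b5, erule b6)
    then show "\<exists>u\<in>nbhd G U v. card (nbhd G U u) \<le> i \<and> 1 \<le> j \<and>
      has_type G (U - insert u (nbhd G U u)) (i - card (nbhd G U u)) (j - 1)"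
      using uN b0 j1 unfolding has_type_def N_def by blast
  next
    assume "\<exists>u\<in>nbhd G U v. card (nbhd G U u) \<le> i \<and> 1 \<le> j \<and>
      has_type G (U - insert u (nbhd G U u)) (i - card (nbhd G U u)) (j - 1)"
    then obtain u where uN: "u \<in> nbhd G U v" and ij: "card (nbhd G U u) \<le> i" "1 \<le> j"
      and t: "has_type G (U - insert u (nbhd G U u)) (i - card (nbhd G U u)) (j - 1)" by blast
    define N where "N = nbhd G U u"
    let ?U = "U - insert u N"
    obtain R s where RS: "bouquet_type_of G ?U (i - card N) (j - 1) R s"
      using t unfolding has_type_def N_def by blast
    note R = bouquet_type_ofD(1-3)[OF RS] and s = bouquet_type_ofD(4,5)[OF RS]
      and sep = bouquet_type_ofD(6)[OF RS] and dom = bouquet_type_ofD(7)[OF RS]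
    have u: "u \<in> U" "{v, u} \<in> edges G" "{u, v} \<in> edges G"
      using uN nbhd_sym[of u v G] by (auto simp: in_nbhd)
    have vN: "v \<in> N" using u vU by (simp add: N_def in_nbhd)
    have uNN: "u \<notin> N" using irr by (simp add: N_def in_nbhd)
    have vu: "v \<noteq> u" using vN uNN by blast
    have NU: "N \<subseteq> U" by (auto simp: N_def in_nbhd)
    have uR: "u \<notin> R" using R(1) by blast
    let ?R = "insert u R" and ?s = "s(u := v)"
    have "U - ?R = N \<union> (?U - R)" using NU uNN R(1) by blast
    moreover have "card (N \<union> (?U - R)) = card N + card (?U - R)"
      using finU finite_subset[OF NU finU] by (intro card_Un_disjoint) auto
    ultimately have c1: "card (U - ?R) = i" using R(3) ij by (simp add: N_def)
    have finR: "finite R" using R(1) finU finite_subset by blast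
    have c2: "card ?R = j" using uR finR R(2) ij by simp
    have c3: "?s r \<in> U - ?R \<and> {r, ?s r} \<in> edges G" if r: "r \<in> ?R" for r
    proof (cases "r = u")
      case True
      then show ?thesis using vU vu vN R(1) u by auto
    next
      case False
      then show ?thesis using r s[of r] by auto
    qed
    \<comment> \<open>All neighbours of the simplicial vertex \<open>v\<close> lie in the closed
      neighbourhood of \<open>u\<close>, so the new stem has no edge to anything that
      remains.\<close>
    have c4: "separated G {u, v} {r, s r}" if r: "r \<in> R" for r
    proof -
      have rU: "r \<in> ?U" "s r \<in> ?U" using R(1) s(1)[OF r] r by blast+
      have "b \<notin> N \<and> b \<noteq> u \<and> {u, b} \<notin> edges G \<and> b \<noteq> v \<and> {v, b} \<notin> edges G" if b: "b \<in> ?U" for b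
      proof -
        have "b \<in> U" "b \<noteq> u" "b \<notin> N" using b by blast+
        moreover have "{u, b} \<notin> edges G" using calculation by (simp add: N_def in_nbhd)
        moreover have "{v, b} \<notin> edges G"
        proof
          assume "{v, b} \<in> edges G"
          then have "b \<in> nbhd G U v" using \<open>b \<in> U\<close> by (simp add: in_nbhd)
          then show False using simplicialD[OF v uN, of b] \<open>b \<noteq> u\<close> \<open>{u, b} \<notin> edges G\<close> by blast
        qed
        ultimately show ?thesis using vN by blast
      qed
      then show ?thesis using rU unfolding separated_def by blast
    qed
    have c5: "separated G {r, ?s r} {r', ?s r'}" if rr: "r \<in> ?R" "r' \<in> ?R" "r \<noteq> r'" for r r'
    proof -
      consider "r = u" "r' \<in> R" | "r' = u" "r \<in> R" | "r \<in> R" "r' \<in> R" using rr by blast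
      then show ?thesis
      proof cases
        case 1
        then show ?thesis using c4[of r'] rr(3) by simp
      next
        case 2
        then show ?thesis using c4[of r] rr(3) separated_commute[of G "{u, v}"] by simp
      next
        case 3
        then have "r \<noteq> u" "r' \<noteq> u" using uR by blast+
        then show ?thesis using sep[OF 3 rr(3)] by simp
      qed
    qed
    have c6: "\<exists>r\<in>?R. {r, z} \<in> edges G" if z: "z \<in> U - ?R" for z
    proof (cases "z \<in> N")
      case True
      then show ?thesis by (auto simp: N_def in_nbhd)
    next
      case False
      then have "z \<in> ?U - R" using z by blast
      then show ?thesis using dom by blast
    qed
    have c0: "?R \<subseteq> U" using R(1) u(1) by blast
    have "bouquet_type_of G U i j ?R ?s"
      by (rule bouquet_type_ofI) (fact c0, fact c2, fact c1, erule c3, erule (2) c5, erule c6)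
    then show "has_type G U i j" unfolding has_type_def by blast
  }
qed

section \<open>Betti numbers of chordal graphs and forests\<close>

lemma forest_imp_chordal: "forest G \<Longrightarrow> chordal G"
  by (auto simp: forest_def chordal_def)

lemma cycle_edges_3:
  assumes vs: "length vs = 3"
  shows "cycle_edges vs \<subseteq> {{vs ! 0, vs ! 1}, {vs ! 1, vs ! 2}, {vs ! 2, vs ! 0}}"
proof
  fix x assume "x \<in> cycle_edges vs"
  then obtain i where i: "i < length vs" "x = {vs ! i, vs ! (Suc i mod length vs)}"
    unfolding cycle_edges_def by blast
  have "i = 0 \<or> i = 1 \<or> i = 2" using i(1) vs by linarith
  then show "x \<in> {{vs ! 0, vs ! 1}, {vs ! 1, vs ! 2}, {vs ! 2, vs ! 0}}"
    using i(2) unfolding vs by (elim disjE) (simp_all add: numeral_2_eq_2)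
qed

text \<open>Two neighbours of a simplicial vertex are adjacent and would close a triangle.\<close>

lemma forest_simplicial_nbhd:
  assumes G: "finite_simple_graph G" and f: "forest G" and v: "simplicial G W v"
    and ab: "a \<in> nbhd G W v" "b \<in> nbhd G W v"
  shows "a = b"
proof (rule ccontr)
  assume ne: "a \<noteq> b"
  have e: "{v, a} \<in> edges G" "{b, v} \<in> edges G" "{a, b} \<in> edges G"
    using ab simplicialD[OF v ab ne] nbhd_sym[of v b G] by (auto simp: in_nbhd)
  have d: "v \<noteq> a" "b \<noteq> v" using edge_doubleton(1)[OF G e(1)] edge_doubleton(1)[OF G e(2)] by auto
  have "cycle_edges [v, a, b] \<subseteq> edges G"
    using cycle_edges_3[of "[v, a, b]"] e by auto
  then have "is_cycle G [v, a, b]" using d ne by (auto simp: is_cycle_def)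
  then show False using f unfolding forest_def by blast
qed

section \<open>Decomposition of vertex sets containing a simplicial vertex\<close>

lemma has_type_empty: "has_type G {} i j \<longleftrightarrow> i = 0 \<and> j = 0"
  by (auto simp: has_type_def bouquet_type_of_def)

lemma simplicial_subset: "simplicial G W v \<Longrightarrow> U \<subseteq> W \<Longrightarrow> v \<in> U \<Longrightarrow> simplicial G U v"
  unfolding simplicial_def nbhd_def by blast

text \<open>A pair \<open>(T, U)\<close> stands for the vertex set
  \<open>{u, v} \<union> T \<union> U\<close>, where \<open>insert v T\<close> is the flower set of
  the bouquet at \<open>u\<close>; hence the \<open>card T + 1\<close>. Indexing by \<open>T\<close>
  mirrors the Koszul sum for the Betti numbers.\<close>

definition bouquet_data ::
    "'v ugraph \<Rightarrow> 'v set \<Rightarrow> 'v \<Rightarrow> 'v \<Rightarrow> nat \<Rightarrow> nat \<Rightarrow> ('v set \<times> 'v set) set" where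
  "bouquet_data G W v u i j = (SIGMA T : {T \<in> Pow (nbhd G W u - {v}). 1 \<le> j \<and> card T + 1 \<le> i}.
     {U. U \<subseteq> W - insert u (nbhd G W u) \<and> has_type G U (i - (card T + 1)) (j - 1)})"

text \<open>Recovers \<open>T\<close> and \<open>U\<close> from the union when \<open>u\<close> is
  known: \<open>U\<close> avoids the closed neighbourhood of \<open>u\<close>, while
  \<open>v\<close> and \<open>T\<close> lie in the neighbourhood.\<close>

lemma bouquet_data_union:
  assumes G: "finite_simple_graph G" and u: "u \<in> nbhd G W v" "v \<in> W"
    and T: "T \<subseteq> nbhd G W u - {v}" and U: "U \<subseteq> W - insert u (nbhd G W u)"
  shows "nbhd G ({u, v} \<union> T \<union> U) u = insert v T"
    "({u, v} \<union> T \<union> U) - insert u (insert v T) = U"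
proof -
  have uu: "{u, u} \<notin> edges G" using edge_doubleton(1)[OF G, of u u] by blast
  have vu: "v \<in> nbhd G W u" using u nbhd_sym[of u v G] by (simp add: in_nbhd)
  have uN: "u \<notin> nbhd G W u" using uu by (simp add: in_nbhd)
  have sub: "{u, v} \<union> T \<union> U \<subseteq> W" using u T U by (auto simp: in_nbhd)
  have "nbhd G ({u, v} \<union> T \<union> U) u = nbhd G W u \<inter> ({u, v} \<union> T \<union> U)"
    unfolding nbhd_def using sub by blast
  also have "\<dots> = insert v T" using T U vu uN by blast
  finally show "nbhd G ({u, v} \<union> T \<union> U) u = insert v T" .
  show "({u, v} \<union> T \<union> U) - insert u (insert v T) = U" using T U vu by blast
qed

text \<open>The vertex \<open>v\<close> stays simplicial in every subset of \<open>W\<close>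
  containing it, so the recursion applies to all of them at once. Different \<open>u\<close> may
  produce the same set, so the union over \<open>u\<close> need not be disjoint.\<close>

lemma has_type_through_simplicial:
  assumes G: "finite_simple_graph G" and W: "W \<subseteq> verts G" and v: "simplicial G W v"
  shows "{U. U \<subseteq> W \<and> v \<in> U \<and> has_type G U i j} =
    (\<Union>u\<in>nbhd G W v. (\<lambda>(T, U). {u, v} \<union> T \<union> U) ` bouquet_data G W v u i j)"
proof (intro equalityI subsetI)
  have finW: "finite W" using W G by (auto simp: finite_simple_graph_def intro: finite_subset)
  have vW: "v \<in> W" using v by (simp add: simplicial_def)
  {
    fix U assume "U \<in> {U. U \<subseteq> W \<and> v \<in> U \<and> has_type G U i j}"
    then have U: "U \<subseteq> W" "v \<in> U" "has_type G U i j" by auto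
    have "simplicial G U v" by (rule simplicial_subset[OF v U(1,2)])
    then obtain u where u: "u \<in> nbhd G U v" "card (nbhd G U u) \<le> i" "1 \<le> j"
      "has_type G (U - insert u (nbhd G U u)) (i - card (nbhd G U u)) (j - 1)"
      using has_type_simplicial_iff[OF G, of U v i j] U W by blast
    have uW: "u \<in> nbhd G W v" "u \<in> U" using u(1) U(1) by (auto simp: in_nbhd)
    have vu: "v \<in> nbhd G U u" using u(1) U(2) nbhd_sym[of u v G] by (simp add: in_nbhd)
    define T where "T = nbhd G U u - {v}"
    define U' where "U' = U - insert u (nbhd G U u)"
    have N: "nbhd G U u = insert v T" using vu by (auto simp: T_def)
    have "finite (nbhd G U u)" using finW U(1) by (auto simp: nbhd_def intro: finite_subset)
    then have cN: "card (nbhd G U u) = card T + 1" using card_Suc_Diff1[OF _ vu] by (simp add: T_def)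
    have T: "T \<subseteq> nbhd G W u - {v}" using U(1) by (auto simp: T_def in_nbhd)
    have U': "U' \<subseteq> W - insert u (nbhd G W u)" using U(1) by (auto simp: U'_def in_nbhd)
    have "(T, U') \<in> bouquet_data G W v u i j"
      unfolding bouquet_data_def using T U' u(2-4) cN by (simp add: U'_def)
    moreover have "U = {u, v} \<union> T \<union> U'"
      unfolding T_def U'_def using U(2) uW(2) vu by (auto simp: in_nbhd)
    ultimately show "U \<in> (\<Union>u\<in>nbhd G W v. (\<lambda>(T, U). {u, v} \<union> T \<union> U) ` bouquet_data G W v u i j)"
      using uW(1) by (intro UN_I[of u] image_eqI[of _ _ "(T, U')"]) auto
  next
    fix U assume "U \<in> (\<Union>u\<in>nbhd G W v. (\<lambda>(T, U). {u, v} \<union> T \<union> U) ` bouquet_data G W v u i j)"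
    then obtain u p where u: "u \<in> nbhd G W v" and p: "p \<in> bouquet_data G W v u i j"
      "U = (\<lambda>(T, U). {u, v} \<union> T \<union> U) p" by blast
    obtain T U' where TU: "p = (T, U')" by (cases p)
    have d: "(T, U') \<in> bouquet_data G W v u i j" and U: "U = {u, v} \<union> T \<union> U'"
      using p unfolding TU by simp_all
    from d have T: "T \<subseteq> nbhd G W u - {v}" and ij: "1 \<le> j" "card T + 1 \<le> i"
      and U': "U' \<subseteq> W - insert u (nbhd G W u)" and t: "has_type G U' (i - (card T + 1)) (j - 1)"
      by (auto simp: bouquet_data_def)
    note data = bouquet_data_union[OF G u vW T U', folded U]
    have UW: "U \<subseteq> W" "v \<in> U" "u \<in> U" using U T U' u vW by (auto simp: in_nbhd)
    have "finite T" using T finW by (auto simp: nbhd_def intro: finite_subset)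
    moreover have "v \<notin> T" using T by blast
    ultimately have cN: "card (nbhd G U u) = card T + 1" by (simp add: data)
    have "has_type G (U - insert u (nbhd G U u)) (i - card (nbhd G U u)) (j - 1)"
      unfolding cN unfolding data using t by simp
    moreover have "u \<in> nbhd G U v" using u UW by (simp add: in_nbhd)
    moreover have "card (nbhd G U u) \<le> i" using cN ij by simp
    ultimately have "has_type G U i j"
      using has_type_simplicial_iff[OF G _ simplicial_subset[OF v UW(1,2)], of i j] ij UW(1) W by blast
    then show "U \<in> {U. U \<subseteq> W \<and> v \<in> U \<and> has_type G U i j}" using UW by blast
  }
qed

lemma inj_on_bouquet_data:
  assumes G: "finite_simple_graph G" and u: "u \<in> nbhd G W v" "v \<in> W"
  shows "inj_on (\<lambda>(T, U). {u, v} \<union> T \<union> U) (bouquet_data G W v u i j)"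
proof (rule inj_onI, clarify)
  fix T U T' U' assume d: "(T, U) \<in> bouquet_data G W v u i j" "(T', U') \<in> bouquet_data G W v u i j"
    and eq: "{u, v} \<union> T \<union> U = {u, v} \<union> T' \<union> U'"
  have T: "T \<subseteq> nbhd G W u - {v}" "T' \<subseteq> nbhd G W u - {v}"
    and U: "U \<subseteq> W - insert u (nbhd G W u)" "U' \<subseteq> W - insert u (nbhd G W u)"
    using d by (auto simp: bouquet_data_def)
  note 1 = bouquet_data_union[OF G u T(1) U(1)] and 2 = bouquet_data_union[OF G u T(2) U(2)]
  have "insert v T = insert v T'" using 1(1) 2(1) eq by simp
  moreover have "v \<notin> T" "v \<notin> T'" using T by auto
  ultimately have "T = T'" by (rule insert_ident[THEN iffD1, rotated 2])
  moreover have "U = U'"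
  proof -
    have "U = ({u, v} \<union> T \<union> U) - insert u (insert v T)" using 1(2) by (rule sym)
    also have "\<dots> = ({u, v} \<union> T' \<union> U') - insert u (insert v T')"
      unfolding eq unfolding \<open>T = T'\<close> by (rule refl)
    also have "\<dots> = U'" by (rule 2(2))
    finally show ?thesis .
  qed
  ultimately show "T = T' \<and> U = U'" by simp
qed

text \<open>The first clause makes every nonzero entry one of those described by the other two.
  Keeping the forest count as an implication lets one induction serve both parts of the
  theorem.\<close>

definition counts_types :: "'v ugraph \<Rightarrow> 'v set \<Rightarrow> (nat \<Rightarrow> int \<Rightarrow> nat) \<Rightarrow> bool" where
  "counts_types G W c \<longleftrightarrow> (\<forall>i d. c i d \<noteq> 0 \<longrightarrow> int i \<le> d) \<and>
     (\<forall>i j. c i (int (i + j)) \<noteq> 0 \<longleftrightarrow> (\<exists>U. U \<subseteq> W \<and> has_type G U i j)) \<and>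
     (forest G \<longrightarrow> (\<forall>i j. c i (int (i + j)) = card {U. U \<subseteq> W \<and> has_type G U i j}))"

lemma counts_typesD:
  assumes "counts_types G W c"
  shows "c i d \<noteq> 0 \<Longrightarrow> int i \<le> d"
    and "c i (int (i + j)) \<noteq> 0 \<longleftrightarrow> (\<exists>U. U \<subseteq> W \<and> has_type G U i j)"
    and "forest G \<Longrightarrow> c i (int (i + j)) = card {U. U \<subseteq> W \<and> has_type G U i j}"
  using assms unfolding counts_types_def by blast+

text \<open>The induction runs over vertex sets inside a fixed chordal \<open>G\<close>, since
  Dirac's theorem supplies a vertex simplicial in each nonempty \<open>W\<close>. Both
  \<open>W - {v}\<close> and the sets \<open>W - insert u (nbhd G W u)\<close> are proper
  subsets.\<close>

lemma has_betti_counts_types: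
  fixes G :: "'v ugraph"
  assumes G: "finite_simple_graph G" and ch: "chordal G"
  shows "W \<subseteq> verts G \<Longrightarrow>
    \<exists>c. has_betti (verts G) (monomial_ideal (verts G) (edge_within G W) :: ('v, 'k::field) mpoly set) c \<and>
      counts_types G W c"
    (is "_ \<Longrightarrow> \<exists>c. ?B W c \<and> _")
proof (induction "card W" arbitrary: W rule: less_induct)
  case less
  note W = less.prems
  have finV: "finite (verts G)" using G by (simp add: finite_simple_graph_def)
  then have finW: "finite W" using W finite_subset by blast
  show ?case
  proof (cases "W = {}")
    case True
    have e: "edge_within G {} = (\<lambda>_. False)" by (simp add: edge_within_def fun_eq_iff)
    have set: "{U. U = {} \<and> has_type G U i j} = (if i = 0 \<and> j = 0 then {{}} else {})" for i j
      by (auto simp: has_type_empty)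
    show ?thesis unfolding True e
      by (intro exI[of _ "\<lambda>i d. if i = 0 \<and> d = 0 then 1 else 0"] conjI has_betti_zero)
        (auto simp: counts_types_def set has_type_empty)
  next
    case False
    obtain v where v: "simplicial G W v" using ex_simplicial[OF G ch W False] .
    have vW: "v \<in> W" using v by (simp add: simplicial_def)
    let ?N = "nbhd G W v" and ?W = "\<lambda>u. W - insert u (nbhd G W u)"
    have finN: "finite (nbhd G W u)" for u using finW by (simp add: nbhd_def)
    have IH: "\<exists>c. ?B W' c \<and> counts_types G W' c" if "W' \<subseteq> W" "W' \<noteq> W" for W'
    proof (rule less.hyps)
      show "card W' < card W" using that by (intro psubset_card_mono finW) blast
      show "W' \<subseteq> verts G" using that W by blast
    qed
    have "\<exists>c. ?B (W - {v}) c \<and> counts_types G (W - {v}) c" using vW by (intro IH) auto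
    then obtain c0 where B0: "?B (W - {v}) c0" and c0: "counts_types G (W - {v}) c0" by blast
    have "\<forall>u\<in>?N. \<exists>c. ?B (?W u) c \<and> counts_types G (?W u) c"
    proof
      fix u assume "u \<in> ?N"
      then have "u \<in> W" by (simp add: in_nbhd)
      then show "\<exists>c. ?B (?W u) c \<and> counts_types G (?W u) c" by (intro IH) auto
    qed
    from bchoice[OF this] obtain c' where "\<forall>u\<in>?N. ?B (?W u) (c' u) \<and> counts_types G (?W u) (c' u)" ..
    then have B': "\<And>u. u \<in> ?N \<Longrightarrow> ?B (?W u) (c' u)" and c': "\<And>u. u \<in> ?N \<Longrightarrow> counts_types G (?W u) (c' u)"
      by simp_all
    define S where "S = (\<lambda>u i d. case i of 0 \<Rightarrow> 0 | Suc j \<Rightarrow>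
      (\<Sum>T\<in>Pow (nbhd G W u - {v}). if card T \<le> j then c' u (j - card T) (d - 2 - int (card T)) else 0))"
    define c where "c = (\<lambda>i d. c0 i d + (\<Sum>u\<in>?N. S u i d))"
    have B: "?B W c"
      unfolding c_def S_def by (rule has_betti_simplicial[OF G W v B0 B'])
    have S_zero: "S u i d = 0" if u: "u \<in> ?N" and d: "d < int i" for u i d
    proof (cases i)
      case (Suc j)
      have "c' u (j - card T) (d - 2 - int (card T)) = 0" if "card T \<le> j" for T :: "'v set"
      proof (rule ccontr)
        assume "c' u (j - card T) (d - 2 - int (card T)) \<noteq> 0"
        then have "int (j - card T) \<le> d - 2 - int (card T)" using counts_typesD(1)[OF c'[OF u]] by blast
        then show False using that d Suc by linarith
      qed
      then show ?thesis unfolding S_def Suc nat.case by (intro sum.neutral) simp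
    qed (simp add: S_def)
    have D: "int i \<le> d" if nz: "c i d \<noteq> 0" for i d
    proof (rule ccontr)
      assume d: "\<not> int i \<le> d"
      then have "c0 i d = 0" using counts_typesD(1)[OF c0] by blast
      moreover have "(\<Sum>u\<in>?N. S u i d) = 0" using S_zero d by (intro sum.neutral) auto
      ultimately show False using nz by (simp add: c_def)
    qed
    \<comment> \<open>The summand of the recursion in natural-number form. With
      \<open>d = i + j\<close> the remaining degree \<open>d - 2 - card T\<close> equals the
      remaining homological degree \<open>i - 1 - card T\<close> plus \<open>j - 1\<close>.\<close>
    define h where "h = (\<lambda>u i j (T :: 'v set). if 1 \<le> j \<and> card T + 1 \<le> i
      then c' u (i - (card T + 1)) (int ((i - (card T + 1)) + (j - 1))) else 0)"
    have S: "S u i (int (i + j)) = (\<Sum>T\<in>Pow (nbhd G W u - {v}). h u i j T)" if u: "u \<in> ?N" for u i j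
    proof (cases i)
      case 0
      then show ?thesis by (simp add: S_def h_def)
    next
      case (Suc k)
      have "(if card T \<le> k then c' u (k - card T) (int (i + j) - 2 - int (card T)) else 0) = h u i j T" for T
      proof (cases "card T \<le> k")
        case T: True
        show ?thesis
        proof (cases "1 \<le> j")
          case True
          then have "int (i + j) - 2 - int (card T) = int ((i - (card T + 1)) + (j - 1))"
            using T Suc by linarith
          then show ?thesis using T True Suc by (simp only: h_def) simp
        next
          case False
          \<comment> \<open>For \<open>j = 0\<close> the remaining degree is one less than the
            homological degree, where the bound from \<open>counts_types\<close> forces 0.\<close>
          have "c' u (k - card T) (int (i + j) - 2 - int (card T)) = 0"
          proof (rule ccontr)
            assume "c' u (k - card T) (int (i + j) - 2 - int (card T)) \<noteq> 0"
            then have "int (k - card T) \<le> int (i + j) - 2 - int (card T)" using counts_typesD(1)[OF c'[OF u]] by blast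
            then show False using False T Suc by linarith
          qed
          then show ?thesis using False T by (simp add: h_def)
        qed
      qed (simp add: h_def Suc)
      then have "(\<Sum>T\<in>Pow (nbhd G W u - {v}).
          if card T \<le> k then c' u (k - card T) (int (i + j) - 2 - int (card T)) else 0) =
        (\<Sum>T\<in>Pow (nbhd G W u - {v}). h u i j T)"
        by (intro sum.cong refl)
      moreover have "S u i d = (\<Sum>T\<in>Pow (nbhd G W u - {v}).
          if card T \<le> k then c' u (k - card T) (d - 2 - int (card T)) else 0)" for d
        unfolding S_def Suc nat.case by (rule refl)
      ultimately show ?thesis by (simp only:)
    qed
    have hT: "h u i j T \<noteq> 0 \<longleftrightarrow> 1 \<le> j \<and> card T + 1 \<le> i \<and>
      (\<exists>U. U \<subseteq> ?W u \<and> has_type G U (i - (card T + 1)) (j - 1))" if "u \<in> ?N" for u i j T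
    proof (cases "1 \<le> j \<and> card T + 1 \<le> i")
      case True
      then have h: "h u i j T = c' u (i - (card T + 1)) (int ((i - (card T + 1)) + (j - 1)))"
        unfolding h_def by (rule if_P)
      show ?thesis unfolding h counts_typesD(2)[OF c'[OF that]] using True by blast
    next
      case False
      then have "h u i j T = 0" unfolding h_def by (rule if_not_P)
      then show ?thesis using False by blast
    qed
    have S_nz: "S u i (int (i + j)) \<noteq> 0 \<longleftrightarrow> bouquet_data G W v u i j \<noteq> {}" if u: "u \<in> ?N" for u i j
    proof -
      have "S u i (int (i + j)) \<noteq> 0 \<longleftrightarrow> (\<exists>T\<in>Pow (nbhd G W u - {v}). h u i j T \<noteq> 0)"
        unfolding S[OF u] using finN[of u] by (subst sum_eq_0_iff) auto
      also have "\<dots> \<longleftrightarrow> bouquet_data G W v u i j \<noteq> {}"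
        unfolding hT[OF u] bouquet_data_def by blast
      finally show ?thesis .
    qed
    have split: "{U. U \<subseteq> W \<and> has_type G U i j} = {U. U \<subseteq> W - {v} \<and> has_type G U i j} \<union>
      {U. U \<subseteq> W \<and> v \<in> U \<and> has_type G U i j}" for i j by blast
    have N: "c i (int (i + j)) \<noteq> 0 \<longleftrightarrow> (\<exists>U. U \<subseteq> W \<and> has_type G U i j)" for i j
    proof -
      have "c i (int (i + j)) \<noteq> 0 \<longleftrightarrow> c0 i (int (i + j)) \<noteq> 0 \<or> (\<exists>u\<in>?N. S u i (int (i + j)) \<noteq> 0)"
        using finN[of v] by (simp add: c_def sum_eq_0_iff)
      also have "\<dots> \<longleftrightarrow> {U. U \<subseteq> W - {v} \<and> has_type G U i j} \<noteq> {} \<or>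
        {U. U \<subseteq> W \<and> v \<in> U \<and> has_type G U i j} \<noteq> {}"
        unfolding has_type_through_simplicial[OF G W v] using counts_typesD(2)[OF c0] S_nz by simp
      also have "\<dots> \<longleftrightarrow> {U. U \<subseteq> W \<and> has_type G U i j} \<noteq> {}" unfolding split[of i j] by blast
      finally show ?thesis by simp
    qed
    have F: "c i (int (i + j)) = card {U. U \<subseteq> W \<and> has_type G U i j}" if f: "forest G" for i j
    proof -
      \<comment> \<open>With at most one neighbour \<open>u\<close>, the union over \<open>u\<close>
        has at most one member, and the encoding by pairs is injective there, so the count is
        exact.\<close>
      have "card {U. U \<subseteq> W \<and> v \<in> U \<and> has_type G U i j} = (\<Sum>u\<in>?N. S u i (int (i + j)))"
      proof (cases "?N = {}")
        case True
        then show ?thesis unfolding has_type_through_simplicial[OF G W v] by simp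
      next
        case False
        then obtain u where u: "u \<in> ?N" by blast
        then have Nu: "?N = {u}" using forest_simplicial_nbhd[OF G f v] by blast
        let ?A = "{T \<in> Pow (nbhd G W u - {v}). 1 \<le> j \<and> card T + 1 \<le> i}"
        have hc: "h u i j T = (if 1 \<le> j \<and> card T + 1 \<le> i
          then card {U. U \<subseteq> ?W u \<and> has_type G U (i - (card T + 1)) (j - 1)} else 0)" for T
          unfolding h_def counts_typesD(3)[OF c'[OF u] f] by (rule refl)
        have "card {U. U \<subseteq> W \<and> v \<in> U \<and> has_type G U i j} = card (bouquet_data G W v u i j)"
          unfolding has_type_through_simplicial[OF G W v] Nu UN_insert UN_empty Un_empty_right
          by (rule card_image[OF inj_on_bouquet_data[OF G u vW]])
        also have "\<dots> = (\<Sum>T\<in>?A. card {U. U \<subseteq> ?W u \<and> has_type G U (i - (card T + 1)) (j - 1)})"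
          unfolding bouquet_data_def using finN[of u] finW by (intro card_SigmaI) auto
        also have "\<dots> = (\<Sum>T\<in>Pow (nbhd G W u - {v}). h u i j T)"
          unfolding hc using finN[of u] by (intro sum.mono_neutral_cong_left) auto
        finally show ?thesis using Nu S[OF u] by simp
      qed
      moreover have "card {U. U \<subseteq> W - {v} \<and> has_type G U i j} = c0 i (int (i + j))"
        using counts_typesD(3)[OF c0 f] by simp
      moreover have "card {U. U \<subseteq> W \<and> has_type G U i j} = card {U. U \<subseteq> W - {v} \<and> has_type G U i j} +
        card {U. U \<subseteq> W \<and> v \<in> U \<and> has_type G U i j}"
        unfolding split[of i j] using finW by (intro card_Un_disjoint) auto
      ultimately show ?thesis by (simp add: c_def)
    qed
    have "counts_types G W c" using D N F by (simp add: counts_types_def)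
    then show ?thesis using B by blast
  qed
qed

theorem theorem4p1:
  fixes G :: "'v ugraph"
    and I :: "('v, 'k::field) mpoly set"
    and i j :: nat
  assumes "finite_simple_graph G"
    and "I = edge_ideal G"
  shows "(chordal G \<longrightarrow>
            (betti (verts G) I i (int (i + j)) \<noteq> 0 \<longleftrightarrow>
               (\<exists>W. W \<subseteq> verts G \<and> contains_strongly_disjoint (induced_subgraph G W) (i, j))) \<and>
            proj_dim (verts G) I = max_flowers G) \<and>
         (forest G \<longrightarrow>
            betti (verts G) I i (int (i + j)) =
              card {W. W \<subseteq> verts G \<and> contains_strongly_disjoint (induced_subgraph G W) (i, j)})"
proof -
  let ?V = "verts G"
  note G = assms(1)
  have I: "I = monomial_ideal ?V (edge_within G ?V)"
    using edge_ideal_eq_monomial_ideal[OF G] assms(2) by simp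
  have t: "W \<subseteq> ?V \<and> contains_strongly_disjoint (induced_subgraph G W) (a, b) \<longleftrightarrow> W \<subseteq> ?V \<and> has_type G W a b"
    for W a b using contains_strongly_disjoint_iff[OF G] by blast
  have main: "\<exists>c. (\<forall>i d. betti ?V I i d = c i d) \<and> counts_types G ?V c" if ch: "chordal G"
  proof -
    obtain c where c: "has_betti ?V I c" "counts_types G ?V c"
      using has_betti_counts_types[OF G ch order_refl, where ?'k = 'k] unfolding I by blast
    obtain F where F: "min_resolution ?V I F" "\<forall>i d. graded_rank F i d = c i d"
      using c(1) unfolding has_betti_def by blast
    have "\<not> edge_within G ?V {}" by (simp add: edge_within_def)
    then have "\<forall>i d. betti ?V I i d = c i d"
      using betti_eq_graded_rank[OF F(1) I mono_edge_within] F(2) by simp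
    then show ?thesis using c(2) by blast
  qed
  show ?thesis
    unfolding t
  proof (intro conjI impI)
    assume ch: "chordal G"
    obtain c where b: "\<forall>i d. betti ?V I i d = c i d" and c: "counts_types G ?V c"
      using main[OF ch] by blast
    show "betti ?V I i (int (i + j)) \<noteq> 0 \<longleftrightarrow> (\<exists>W. W \<subseteq> ?V \<and> has_type G W i j)"
      using b counts_typesD(2)[OF c] by simp
    \<comment> \<open>This makes \<open>proj_dim\<close> and \<open>max_flowers\<close> maxima of
      the same set. A nonzero entry in degree \<open>d\<close> has \<open>d\<close> at least
      \<open>a\<close>, which is why \<open>nat (d - int a)\<close> recovers the number of
      roots.\<close>
    have "(\<exists>d. betti ?V I a d \<noteq> 0) \<longleftrightarrow> (\<exists>b. \<exists>U\<subseteq>?V. has_type G U a b)" for a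
    proof
      assume "\<exists>d. betti ?V I a d \<noteq> 0"
      then obtain d where d: "c a d \<noteq> 0" using b by auto
      then have "d = int (a + nat (d - int a))" using counts_typesD(1)[OF c d] by simp
      then have "c a (int (a + nat (d - int a))) \<noteq> 0" using d by simp
      then show "\<exists>b. \<exists>U\<subseteq>?V. has_type G U a b" unfolding counts_typesD(2)[OF c] by blast
    next
      assume "\<exists>b. \<exists>U\<subseteq>?V. has_type G U a b"
      then obtain b' where "c a (int (a + b')) \<noteq> 0" using counts_typesD(2)[OF c] by blast
      then show "\<exists>d. betti ?V I a d \<noteq> 0" using b by auto
    qed
    then show "proj_dim ?V I = max_flowers G"
      unfolding proj_dim_def max_flowers_eq[OF G] by simp
  next
    assume f: "forest G"
    obtain c where "\<forall>i d. betti ?V I i d = c i d" "counts_types G ?V c"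
      using main[OF forest_imp_chordal[OF f]] by blast
    then show "betti ?V I i (int (i + j)) = card {W. W \<subseteq> ?V \<and> has_type G W i j}"
      using counts_typesD(3)[OF _ f] by simp
  qed
qed

end
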